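(* Let $R$ be a commutative unital ring without zero divisors, let $R[\alpha]$ be graded with $R$ in degree $0$ and $\alpha$ in degree $4$, let $\mathsf q\colon Q\to R[\alpha]$ be any ring homomorphism with $\mathsf q(\alpha)=\alpha$, and let $\iota\colon R[\alpha]\to Q$ be an embedding of rings with $\iota(\alpha)=\alpha$, used to regard $Q$ as an $R[\alpha]$-algebra. Let $\mathfrak A[\alpha,\mathsf q(\varepsilon),\mathsf q(\omega)]=\mathfrak A_{R[\alpha]}[\alpha,\mathsf q(\varepsilon),\mathsf q(\omega)]\otimes_{R[\alpha]}Q$ be the specialized arc algebra, scalar-extended to $Q$. Then there is an isomorphism of graded $Q$-algebras $$\Psi\colon \mathfrak A[Q]\xrightarrow{\ \cong\ }\mathfrak A[\alpha,\mathsf q(\varepsilon),\mathsf q(\omega)].$$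
   Context: Ground ring: $Q=\mathbb Z[\alpha,\varepsilon,\omega^{\pm1}]$, where $\varepsilon$ is a sign, i.e. $\varepsilon^2=1$; $\alpha$ has degree $4$, $\varepsilon,\omega$ have degree $0$. Weights, blocks. A weight is $\lambda=(\lambda_i)_{i\in\mathbb Z}$ with $\lambda_i\in\{\circ,\times,\vee,\wedge\}$ and $\lambda_i=\circ$ for $|i|\gg0$. Two weights are in the same block $\Lambda$ if they differ by permuting the symbols $\vee,\wedge$. The block sequence $\mathrm{seq}(\Lambda)$ is obtained by replacing $\vee,\wedge$ by $\star$. $\Lambda$ is balanced if it has equally many $\wedge$ and $\vee$. The cup diagram $\underline\lambda$ is obtained by successively connecting by cups (arcs below the line) neighbouring pairs $\vee\wedge$ ($\vee$ left, $\wedge$ right), ignoring $\circ,\times$ and already connected vertices; $\overline\lambda$ is its mirror image (cap diagram). Only weights $\lambda$ for which all $\star$-vertices lie on cups are used ("balanced weights"). $\underline\lambda\nu\overline\mu$ ($\nu\in\Lambda$) is oriented if each arc has one endpoint labelled $\vee$ and the other $\wedge$ by $\nu$; so each circle is oriented clockwise or anticlockwise (anticlockwise iff its rightmost vertex is $\wedge$). The degree of $\underline\lambda\nu\overline\mu$ is the number of cups and caps whose left end is $\wedge$ and right end is $\vee$ (clockwise arcs). Positions. $p_\Lambda(i)=\#\{j\le i: \mathrm{seq}(\Lambda)_j=\star\}+2\#\{j\le i:\mathrm{seq}(\Lambda)_j=\times\}$. For a cup or cap $\gamma$ connecting $i<j$: $p_\Lambda(\gamma)=p_\Lambda(i)$,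 $d_\Lambda(\gamma)=p_\Lambda(j)-p_\Lambda(i)$ and $s_\Lambda(\gamma)=\tfrac12(d_\Lambda(\gamma)+1)$ (saddle width). For a circle $C$, $d_\Lambda(C)$ is the sum of $d_\Lambda$ over its cups and caps, and $t(C)$ is the position of its rightmost vertex. Arc algebra. For $\Lambda$ balanced, $\mathfrak A[Q]_\Lambda$ is the free $Q$-module on all oriented $\underline\lambda\nu\overline\mu$, $\lambda,\mu$ balanced weights in $\Lambda$, $\nu\in\Lambda$; $\mathfrak A[Q]=\bigoplus_{\Lambda\text{ balanced}}\mathfrak A[Q]_\Lambda$ (products between different blocks are $0$). The product $(\underline\lambda\nu\overline\mu)(\underline{\mu'}\nu'\overline\eta)$ is $0$ if $\mu\ne\mu'$. If $\mu=\mu'$, put the second diagram on top of the first, giving a stacked diagram with middle part $\overline\mu\,\underline\mu$. Successively (from left to right) choose a mirror-symmetric cap/cup pair in the middle part which can be connected without crossing other arcs (the cap and cup both denoted $\gamma$, with vertices $i<j$) and replace it by two vertical lines at $i$ and $j$ (surgery); all circles not involved keep their orientations; the involved ones are reoriented, with coefficients as follows. At the end collapse the middle part to get a combination of $\underline\lambda\nu''\overline\eta$. (1) Non-nested merge of $C_1,C_2$ into $C$: both anticlockwise $\mapsto$ $C$ anticlockwise, coefficient $1$; exactly one, $C_k$, clockwise $\mapsto$ $C$ clockwise, coefficient $\varepsilon^{t(C)-t(C_k)}$; both clockwise $\mapsto$ $C$ anticlockwise, coefficient $\alpha\,\varepsilon^{t(C)-t(C_1)}\varepsilon^{t(C)-t(C_2)}$.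 (2) Nested merge (inner circle $C_{\rm in}$): as in (1), but with the additional factor $\varepsilon\cdot\varepsilon^{\frac14(d_\Lambda(C_{\rm in})-2)}\cdot\varepsilon^{s_\Lambda(\gamma)}$ in all cases. (3) Non-nested split of $C$ into $C_i\ni i$ and $C_j\ni j$: $C$ anticlockwise $\mapsto$ $\omega\varepsilon^{t(C_i)-p_\Lambda(i)}\varepsilon^{s_\Lambda(\gamma)}\cdot$($C_i$ clockwise, $C_j$ anticlockwise) $+$ $\varepsilon\omega\varepsilon^{t(C_j)-p_\Lambda(j)}\varepsilon^{s_\Lambda(\gamma)}\cdot$($C_j$ clockwise, $C_i$ anticlockwise); $C$ clockwise $\mapsto$ $\omega\varepsilon^{t(C)-t(C_j)}\varepsilon^{t(C_i)-p_\Lambda(i)}\varepsilon^{s_\Lambda(\gamma)}\cdot$(both clockwise) $+$ $\alpha\varepsilon\omega\varepsilon^{t(C)-t(C_j)}\varepsilon^{t(C_j)-p_\Lambda(j)}\varepsilon^{s_\Lambda(\gamma)}\cdot$(both anticlockwise). (4) Nested split of $C$ into $C_{\rm in},C_{\rm out}$, with $\kappa=\varepsilon^{\frac14(d_\Lambda(C_{\rm in})-2)}$: $C$ anticlockwise $\mapsto$ $\omega\kappa\cdot$($C_{\rm in}$ clockwise, $C_{\rm out}$ anticlockwise) $+$ $\varepsilon\omega\kappa\cdot$($C_{\rm out}$ clockwise, $C_{\rm in}$ anticlockwise); $C$ clockwise $\mapsto$ $\omega\kappa\cdot$(both clockwise) $+$ $\alpha\varepsilon\omega\kappa\cdot$(both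 anticlockwise). Specialization. $\mathfrak A_{R[\alpha]}[\alpha,\mathsf q(\varepsilon),\mathsf q(\omega)]$ is the graded $R[\alpha]$-algebra with the same basis and the same multiplication rule, with $\varepsilon,\omega$ replaced by $\mathsf q(\varepsilon),\mathsf q(\omega)$. *)

theory Defs
  imports
    "HOL-Library.Z2"
    "HOL-Library.Product_Plus"
    "HOL-Library.Poly_Mapping"
    "HOL-Computational_Algebra.Polynomial"
    "HOL-Combinatorics.Permutations"
    "HOL-Algebra.Free_Abelian_Groups"
    "HOL-Algebra.Generated_Groups"
begin

section \<open>Ground rings\<close>

text \<open>
  The ring \<open>Q = \<int>[\<alpha>, \<epsilon>, \<omega>\<^sup>\<plusminus>\<^sup>1]\<close> with \<open>\<epsilon>\<^sup>2 = 1\<close> is the monoid algebra over \<open>\<int>\<close> of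
  \<open>\<nat> \<times> \<int>/2 \<times> \<int>\<close>: the key \<open>(a, e, w)\<close> stands for the monomial \<open>\<alpha>\<^sup>a \<epsilon>\<^sup>e \<omega>\<^sup>w\<close>, and the product of
  \<open>'a \<Rightarrow>\<^sub>0 'b\<close> is convolution.
\<close>

type_synonym Q = "(nat \<times> bit \<times> int) \<Rightarrow>\<^sub>0 int"

definition Q_alpha :: Q where "Q_alpha = Poly_Mapping.single (1, 0, 0) 1"
definition Q_eps :: Q where "Q_eps = Poly_Mapping.single (0, 1, 0) 1"
definition Q_omega :: Q where "Q_omega = Poly_Mapping.single (0, 0, 1) 1"

definition Q_grade :: "nat \<Rightarrow> Q set" where
  "Q_grade d = {x. \<forall>(a, e, w) \<in> Poly_Mapping.keys x. 4 * a = d}"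

text \<open>The polynomial ring \<open>R[\<alpha>]\<close> is \<open>'r poly\<close>, with the following variable.\<close>

definition poly_alpha :: "'r::comm_ring_1 poly" where "poly_alpha = [:0, 1:]"

definition is_ring_hom :: "('a::ring_1 \<Rightarrow> 'b::ring_1) \<Rightarrow> bool" where
  "is_ring_hom f \<longleftrightarrow> f 1 = 1 \<and> (\<forall>x y. f (x + y) = f x + f y) \<and> (\<forall>x y. f (x * y) = f x * f y)"


section \<open>Weights, blocks and cup diagrams\<close>

datatype symbol = Circ | Cross | Down | Up  \<comment> \<open>the symbols \<open>\<circ>\<close>, \<open>\<times>\<close>, \<open>\<or>\<close>, \<open>\<and>\<close>\<close>

type_synonym weight = "int \<Rightarrow> symbol"

definition is_weight :: "weight \<Rightarrow> bool" where
  "is_weight \<xi> \<longleftrightarrow> (\<exists>N. \<forall>i. \<bar>i\<bar> > N \<longrightarrow> \<xi> i = Circ)"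

text \<open>The vertices at which the block sequence has the entry \<open>\<star>\<close>.\<close>

definition stars :: "weight \<Rightarrow> int set" where
  "stars \<xi> = {i. \<xi> i = Down \<or> \<xi> i = Up}"

definition same_block :: "weight \<Rightarrow> weight \<Rightarrow> bool" where
  "same_block \<xi> \<mu> \<longleftrightarrow> (\<exists>\<pi>. \<pi> permutes stars \<xi> \<and> \<mu> = \<xi> \<circ> \<pi>)"

text \<open>A block is given by any of its weights; the next two notions depend on the block only.\<close>

definition balanced_block :: "weight \<Rightarrow> bool" where
  "balanced_block \<xi> \<longleftrightarrow> card {i. \<xi> i = Up} = card {i. \<xi> i = Down}"

definition pos :: "weight \<Rightarrow> int \<Rightarrow> int" where
  "pos \<xi> i = int (card {j. j \<le> i \<and> j \<in> stars \<xi>}) + 2 * int (card {j. j \<le> i \<and> \<xi> j = Cross})"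

text \<open>
  Already connected vertices may be ignored in the search for neighbours. As arcs do not cross,
  such a vertex strictly between \<open>i\<close> and \<open>j\<close> is connected to a vertex that also lies strictly
  between \<open>i\<close> and \<open>j\<close>; demanding this keeps \<open>i\<close> and \<open>j\<close> themselves from being connected twice.
\<close>

inductive cup :: "weight \<Rightarrow> int \<Rightarrow> int \<Rightarrow> bool" for \<xi> :: weight where
  "i < j \<Longrightarrow> \<xi> i = Down \<Longrightarrow> \<xi> j = Up \<Longrightarrow>
   (\<And>k. i < k \<Longrightarrow> k < j \<Longrightarrow> \<xi> k = Circ \<or> \<xi> k = Cross \<or>
      (\<exists>l. i < l \<and> l < j \<and> (cup \<xi> k l \<or> cup \<xi> l k))) \<Longrightarrow>
   cup \<xi> i j"

text \<open>An arc is recorded by its left and right end; the cap diagram has the same arcs.\<close>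

type_synonym arcs = "(int \<times> int) set"

definition cups :: "weight \<Rightarrow> arcs" where
  "cups \<xi> = {(i, j). cup \<xi> i j}"

definition balanced_weight :: "weight \<Rightarrow> bool" where
  "balanced_weight \<xi> \<longleftrightarrow> is_weight \<xi> \<and> (\<forall>i \<in> stars \<xi>. \<exists>j. (i, j) \<in> cups \<xi> \<or> (j, i) \<in> cups \<xi>)"

definition oriented_arcs :: "arcs \<Rightarrow> weight \<Rightarrow> bool" where
  "oriented_arcs A \<nu> \<longleftrightarrow>
     (\<forall>(i, j) \<in> A. \<nu> i = Down \<and> \<nu> j = Up \<or> \<nu> i = Up \<and> \<nu> j = Down)"

text \<open>The triple \<open>(\<xi>, \<nu>, \<mu>)\<close> stands for the cup diagram of \<open>\<xi>\<close>, the weight \<open>\<nu>\<close> and the cap diagram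
  of \<open>\<mu>\<close> on top.\<close>

type_synonym diagram = "weight \<times> weight \<times> weight"

definition oriented_diagrams :: "diagram set" where
  "oriented_diagrams = {(\<xi>, \<nu>, \<mu>).
     balanced_weight \<xi> \<and> balanced_weight \<mu> \<and> balanced_block \<xi> \<and>
     same_block \<xi> \<mu> \<and> same_block \<xi> \<nu> \<and> oriented_arcs (cups \<xi>) \<nu> \<and> oriented_arcs (cups \<mu>) \<nu>}"

fun diagram_degree :: "diagram \<Rightarrow> nat" where
  "diagram_degree (\<xi>, \<nu>, \<mu>) =
     card {(i, j) \<in> cups \<xi>. \<nu> i = Up \<and> \<nu> j = Down} + card {(i, j) \<in> cups \<mu>. \<nu> i = Up \<and> \<nu> j = Down}"


section \<open>Stacked diagrams\<close>

text \<open>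
  A stacked diagram lives on two copies of the number line. Below \<open>Lower\<close> are the cups
  \<open>lower_cups\<close>; above \<open>Upper\<close> are the caps \<open>upper_caps\<close>. In between, each arc of \<open>middle\<close> stands for a cap
  on \<open>Lower\<close> together with its mirror image, a cup on \<open>Upper\<close>, and each element of \<open>verticals\<close>
  for a vertical line between the two copies of that vertex.
\<close>

datatype line = Lower | Upper

type_synonym vertex = "line \<times> int"

record stacked =
  lower_cups :: arcs
  middle :: arcs
  verticals :: "int set"
  upper_caps :: arcs

definition edges :: "stacked \<Rightarrow> (vertex \<times> vertex) set" where
  "edges D =
     {((Lower, i), (Lower, j)) | i j. (i, j) \<in> lower_cups D \<union> middle D} \<union>
     {((Upper, i), (Upper, j)) | i j. (i, j) \<in> middle D \<union> upper_caps D} \<union>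
     {((Lower, i), (Upper, i)) | i. i \<in> verticals D}"

definition circle :: "stacked \<Rightarrow> vertex \<Rightarrow> vertex set" where
  "circle D v = {w. (v, w) \<in> (edges D \<union> (edges D)\<inverse>)\<^sup>*}"

text \<open>An orientation is a pair of weights labelling the lower and the upper line.\<close>

type_synonym orientation = "weight \<times> weight"

fun label :: "orientation \<Rightarrow> vertex \<Rightarrow> symbol" where
  "label (\<nu>, \<nu>') (Lower, i) = \<nu> i"
| "label (\<nu>, \<nu>') (Upper, i) = \<nu>' i"

definition orientations :: "weight \<Rightarrow> stacked \<Rightarrow> orientation set" where
  "orientations \<xi> D = {(\<nu>, \<nu>').
     same_block \<xi> \<nu> \<and> same_block \<xi> \<nu>' \<and>
     oriented_arcs (lower_cups D \<union> middle D) \<nu> \<and> oriented_arcs (middle D \<union> upper_caps D) \<nu>' \<and>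
     (\<forall>i \<in> verticals D. \<nu> i = \<nu>' i)}"

definition rightmost :: "vertex set \<Rightarrow> int" where
  "rightmost C = Max (snd ` C)"

text \<open>If a circle has its rightmost vertex on both lines, both copies carry the same label.\<close>

definition clockwise :: "orientation \<Rightarrow> vertex set \<Rightarrow> bool" where
  "clockwise \<nu> C \<longleftrightarrow> (\<exists>v \<in> C. snd v = rightmost C \<and> label \<nu> v = Down)"

definition circle_pos :: "weight \<Rightarrow> vertex set \<Rightarrow> int" where
  "circle_pos \<xi> C = pos \<xi> (rightmost C)"

definition arc_width :: "weight \<Rightarrow> int \<times> int \<Rightarrow> int" where
  "arc_width \<xi> \<gamma> = pos \<xi> (snd \<gamma>) - pos \<xi> (fst \<gamma>)"

definition saddle_width :: "weight \<Rightarrow> int \<times> int \<Rightarrow> int" where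
  "saddle_width \<xi> \<gamma> = (arc_width \<xi> \<gamma> + 1) div 2"

definition circle_width :: "weight \<Rightarrow> stacked \<Rightarrow> vertex set \<Rightarrow> int" where
  "circle_width \<xi> D C =
     (\<Sum>\<gamma> | \<gamma> \<in> lower_cups D \<and> (Lower, fst \<gamma>) \<in> C. arc_width \<xi> \<gamma>) +
     (\<Sum>\<gamma> | \<gamma> \<in> middle D \<and> (Lower, fst \<gamma>) \<in> C. arc_width \<xi> \<gamma>) +
     (\<Sum>\<gamma> | \<gamma> \<in> middle D \<and> (Upper, fst \<gamma>) \<in> C. arc_width \<xi> \<gamma>) +
     (\<Sum>\<gamma> | \<gamma> \<in> upper_caps D \<and> (Upper, fst \<gamma>) \<in> C. arc_width \<xi> \<gamma>)"

text \<open>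
  A circle lies inside \<open>C\<close> if the horizontal ray from a vertex of it to the right crosses \<open>C\<close> an odd
  number of times; along a line, \<open>C\<close> is crossed exactly at its vertices.
\<close>

definition circle_inside :: "vertex set \<Rightarrow> vertex set \<Rightarrow> bool" where
  "circle_inside C' C \<longleftrightarrow> (\<forall>(l, i) \<in> C'. odd (card {k. i < k \<and> (l, k) \<in> C}))"


section \<open>Surgery\<close>

text \<open>As \<open>\<epsilon>\<close> is its own inverse, \<open>\<epsilon>\<^sup>n\<close> makes sense for every integer \<open>n\<close>.\<close>

definition sign_power :: "'k::comm_ring_1 \<Rightarrow> int \<Rightarrow> 'k" where
  "sign_power \<epsilon> n = \<epsilon> ^ nat \<bar>n\<bar>"

definition surgered :: "stacked \<Rightarrow> int \<times> int \<Rightarrow> stacked" where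
  "surgered D \<gamma> = D\<lparr>middle := middle D - {\<gamma>}, verticals := verticals D \<union> {fst \<gamma>, snd \<gamma>}\<rparr>"

definition nesting_sign :: "'k::comm_ring_1 \<Rightarrow> weight \<Rightarrow> stacked \<Rightarrow> vertex set \<Rightarrow> 'k" where
  "nesting_sign \<epsilon> \<xi> D C = sign_power \<epsilon> ((circle_width \<xi> D C - 2) div 4)"

text \<open>
  Coefficient with which the orientation \<open>\<nu>'\<close> of the circle \<open>C\<close> arises when \<open>C1\<close> and \<open>C2\<close>, circles
  of \<open>D\<close> oriented by \<open>\<nu>\<close>, are merged into \<open>C\<close> along \<open>\<gamma>\<close>.
\<close>

definition merge_coeff :: "'k::comm_ring_1 \<Rightarrow> 'k \<Rightarrow> weight \<Rightarrow> stacked \<Rightarrow> int \<times> int \<Rightarrow>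
    vertex set \<Rightarrow> vertex set \<Rightarrow> vertex set \<Rightarrow> orientation \<Rightarrow> orientation \<Rightarrow> 'k" where
  "merge_coeff \<alpha> \<epsilon> \<xi> D \<gamma> C1 C2 C \<nu> \<nu>' =
    (let t = circle_pos \<xi>;
         nested = (\<lambda>C_in. \<epsilon> * nesting_sign \<epsilon> \<xi> D C_in * sign_power \<epsilon> (saddle_width \<xi> \<gamma>))
     in (if circle_inside C1 C2 then nested C1 else if circle_inside C2 C1 then nested C2 else 1) *
        (case (clockwise \<nu> C1, clockwise \<nu> C2, clockwise \<nu>' C) of
           (False, False, False) \<Rightarrow> 1
         | (True, False, True) \<Rightarrow> sign_power \<epsilon> (t C - t C1)
         | (False, True, True) \<Rightarrow> sign_power \<epsilon> (t C - t C2)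
         | (True, True, False) \<Rightarrow> \<alpha> * sign_power \<epsilon> (t C - t C1) * sign_power \<epsilon> (t C - t C2)
         | _ \<Rightarrow> 0))"

text \<open>
  Coefficient with which the orientation \<open>\<nu>'\<close> of \<open>Ci\<close> and \<open>Cj\<close>, circles of \<open>D'\<close> through the left
  and the right end of \<open>\<gamma>\<close>, arises when the circle \<open>C\<close> oriented by \<open>\<nu>\<close> is split along \<open>\<gamma>\<close>.
\<close>

definition split_coeff :: "'k::comm_ring_1 \<Rightarrow> 'k \<Rightarrow> 'k \<Rightarrow> weight \<Rightarrow> stacked \<Rightarrow> int \<times> int \<Rightarrow>
    vertex set \<Rightarrow> vertex set \<Rightarrow> vertex set \<Rightarrow> orientation \<Rightarrow> orientation \<Rightarrow> 'k" where
  "split_coeff \<alpha> \<epsilon> \<omega> \<xi> D' \<gamma> C Ci Cj \<nu> \<nu>' =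
    (let t = circle_pos \<xi>;
         p = pos \<xi>;
         i = fst \<gamma>;
         j = snd \<gamma>;
         s = sign_power \<epsilon> (saddle_width \<xi> \<gamma>);
         nested = (\<lambda>C_in C_out.
           (let \<kappa> = nesting_sign \<epsilon> \<xi> D' C_in
            in case (clockwise \<nu> C, clockwise \<nu>' C_in, clockwise \<nu>' C_out) of
                 (False, True, False) \<Rightarrow> \<omega> * \<kappa>
               | (False, False, True) \<Rightarrow> \<epsilon> * \<omega> * \<kappa>
               | (True, True, True) \<Rightarrow> \<omega> * \<kappa>
               | (True, False, False) \<Rightarrow> \<alpha> * \<epsilon> * \<omega> * \<kappa>
               | _ \<Rightarrow> 0))
     in if circle_inside Ci Cj then nested Ci Cj
        else if circle_inside Cj Ci then nested Cj Ci
        else (case (clockwise \<nu> C, clockwise \<nu>' Ci, clockwise \<nu>' Cj) of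
            (False, True, False) \<Rightarrow> \<omega> * sign_power \<epsilon> (t Ci - p i) * s
          | (False, False, True) \<Rightarrow> \<epsilon> * \<omega> * sign_power \<epsilon> (t Cj - p j) * s
          | (True, True, True) \<Rightarrow>
              \<omega> * sign_power \<epsilon> (t C - t Cj) * sign_power \<epsilon> (t Ci - p i) * s
          | (True, False, False) \<Rightarrow>
              \<alpha> * \<epsilon> * \<omega> * sign_power \<epsilon> (t C - t Cj) * sign_power \<epsilon> (t Cj - p j) * s
          | _ \<Rightarrow> 0))"

definition surgery_coeff :: "'k::comm_ring_1 \<Rightarrow> 'k \<Rightarrow> 'k \<Rightarrow> weight \<Rightarrow> stacked \<Rightarrow> int \<times> int \<Rightarrow>
    orientation \<Rightarrow> orientation \<Rightarrow> 'k" where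
  "surgery_coeff \<alpha> \<epsilon> \<omega> \<xi> D \<gamma> \<nu> \<nu>' =
    (let D' = surgered D \<gamma>;
         C1 = circle D (Lower, fst \<gamma>);
         C2 = circle D (Upper, fst \<gamma>);
         Ci = circle D' (Lower, fst \<gamma>);
         Cj = circle D' (Lower, snd \<gamma>)
     in if \<exists>v. v \<notin> C1 \<union> C2 \<and> label \<nu> v \<noteq> label \<nu>' v then 0
        else if C1 \<noteq> C2 then merge_coeff \<alpha> \<epsilon> \<xi> D \<gamma> C1 C2 Ci \<nu> \<nu>'
        else split_coeff \<alpha> \<epsilon> \<omega> \<xi> D' \<gamma> C1 Ci Cj \<nu> \<nu>')"

definition surgery :: "'k::comm_ring_1 \<Rightarrow> 'k \<Rightarrow> 'k \<Rightarrow> weight \<Rightarrow> stacked \<Rightarrow> int \<times> int \<Rightarrow>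
    (orientation \<Rightarrow>\<^sub>0 'k) \<Rightarrow> (orientation \<Rightarrow>\<^sub>0 'k)" where
  "surgery \<alpha> \<epsilon> \<omega> \<xi> D \<gamma> f =
    (\<Sum>\<nu> \<in> Poly_Mapping.keys f. \<Sum>\<nu>' \<in> orientations \<xi> (surgered D \<gamma>).
       Poly_Mapping.single \<nu>' (Poly_Mapping.lookup f \<nu> * surgery_coeff \<alpha> \<epsilon> \<omega> \<xi> D \<gamma> \<nu> \<nu>'))"

text \<open>A cap in the middle part can be connected to its mirror image without crossing other arcs iff
  no other remaining cap encloses it.\<close>

definition connectable :: "stacked \<Rightarrow> int \<times> int \<Rightarrow> bool" where
  "connectable D \<gamma> \<longleftrightarrow>
     \<gamma> \<in> middle D \<and> \<not> (\<exists>\<gamma>' \<in> middle D. fst \<gamma>' < fst \<gamma> \<and> snd \<gamma> < snd \<gamma>')"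

definition next_pair :: "stacked \<Rightarrow> int \<times> int" where
  "next_pair D = (THE \<gamma>. connectable D \<gamma> \<and> (\<forall>\<gamma>'. connectable D \<gamma>' \<longrightarrow> fst \<gamma> \<le> fst \<gamma>'))"

definition surgery_step :: "'k::comm_ring_1 \<Rightarrow> 'k \<Rightarrow> 'k \<Rightarrow> weight \<Rightarrow>
    stacked \<times> (orientation \<Rightarrow>\<^sub>0 'k) \<Rightarrow> stacked \<times> (orientation \<Rightarrow>\<^sub>0 'k)" where
  "surgery_step \<alpha> \<epsilon> \<omega> \<xi> = (\<lambda>(D, f).
     (surgered D (next_pair D), surgery \<alpha> \<epsilon> \<omega> \<xi> D (next_pair D) f))"

text \<open>After the last surgery all middle arcs are vertical lines, so \<open>\<nu>1 = \<nu>2\<close> in the collapse below.\<close>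

fun diagram_mult :: "'k::comm_ring_1 \<Rightarrow> 'k \<Rightarrow> 'k \<Rightarrow> diagram \<Rightarrow> diagram \<Rightarrow> (diagram \<Rightarrow>\<^sub>0 'k)" where
  "diagram_mult \<alpha> \<epsilon> \<omega> (\<xi>, \<nu>, \<mu>) (\<mu>', \<nu>', \<eta>) =
    (if \<mu> \<noteq> \<mu>' then 0
     else
       let D = \<lparr>lower_cups = cups \<xi>, middle = cups \<mu>, verticals = {}, upper_caps = cups \<eta>\<rparr>;
           f = snd ((surgery_step \<alpha> \<epsilon> \<omega> \<mu> ^^ card (cups \<mu>)) (D, Poly_Mapping.single (\<nu>, \<nu>') 1))
       in \<Sum>(\<nu>1, \<nu>2) \<in> Poly_Mapping.keys f.
            Poly_Mapping.single (\<xi>, \<nu>1, \<eta>) (Poly_Mapping.lookup f (\<nu>1, \<nu>2)))"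


section \<open>Algebras and their gradings\<close>

text \<open>
  The arc algebra has infinitely many blocks and hence no unit, so the ring records of the library
  do not apply.
\<close>

record ('k, 'a) alg =
  acarrier :: "'a set"
  aadd :: "'a \<Rightarrow> 'a \<Rightarrow> 'a"
  ascale :: "'k \<Rightarrow> 'a \<Rightarrow> 'a"
  amult :: "'a \<Rightarrow> 'a \<Rightarrow> 'a"

definition graded_alg_iso ::
  "('a \<Rightarrow> 'b) \<Rightarrow> ('k, 'a) alg \<Rightarrow> (nat \<Rightarrow> 'a set) \<Rightarrow> ('k, 'b) alg \<Rightarrow> (nat \<Rightarrow> 'b set) \<Rightarrow> bool" where
  "graded_alg_iso \<Psi> A gr_A B gr_B \<longleftrightarrow>
     bij_betw \<Psi> (acarrier A) (acarrier B) \<and>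
     (\<forall>x \<in> acarrier A. \<forall>y \<in> acarrier A. \<Psi> (aadd A x y) = aadd B (\<Psi> x) (\<Psi> y)) \<and>
     (\<forall>c. \<forall>x \<in> acarrier A. \<Psi> (ascale A c x) = ascale B c (\<Psi> x)) \<and>
     (\<forall>x \<in> acarrier A. \<forall>y \<in> acarrier A. \<Psi> (amult A x y) = amult B (\<Psi> x) (\<Psi> y)) \<and>
     (\<forall>d. \<Psi> ` gr_A d = gr_B d)"

definition scale :: "'k::comm_ring_1 \<Rightarrow> ('a \<Rightarrow>\<^sub>0 'k) \<Rightarrow> ('a \<Rightarrow>\<^sub>0 'k)" where
  "scale c = Poly_Mapping.map (\<lambda>a. c * a)"

definition arc_algebra :: "'k::comm_ring_1 \<Rightarrow> 'k \<Rightarrow> 'k \<Rightarrow> ('k, diagram \<Rightarrow>\<^sub>0 'k) alg" where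
  "arc_algebra \<alpha> \<epsilon> \<omega> =
    \<lparr>acarrier = {x. Poly_Mapping.keys x \<subseteq> oriented_diagrams},
     aadd = (+),
     ascale = scale,
     amult = (\<lambda>x y. \<Sum>X \<in> Poly_Mapping.keys x. \<Sum>Y \<in> Poly_Mapping.keys y.
       scale (Poly_Mapping.lookup x X * Poly_Mapping.lookup y Y) (diagram_mult \<alpha> \<epsilon> \<omega> X Y))\<rparr>"

text \<open>The grading of the arc algebra over a ring graded by \<open>gr\<close>.\<close>

definition arc_grade :: "(nat \<Rightarrow> 'k::comm_ring_1 set) \<Rightarrow> nat \<Rightarrow> (diagram \<Rightarrow>\<^sub>0 'k) set" where
  "arc_grade gr d =
    {x. Poly_Mapping.keys x \<subseteq> oriented_diagrams \<and>
        (\<forall>X \<in> Poly_Mapping.keys x. \<exists>e. Poly_Mapping.lookup x X \<in> gr e \<and> diagram_degree X + e = d)}"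


section \<open>Scalar extension\<close>

text \<open>
  For an algebra \<open>A\<close> over \<open>'s\<close> and a ring homomorphism \<open>\<iota> :: 's \<Rightarrow> 'k\<close>, the tensor product
  \<open>A \<otimes> 'k\<close> over \<open>'s\<close> is the free abelian group on the pairs \<open>(a, c)\<close> modulo the usual relations.
\<close>

definition tensor_free :: "('s, 'a) alg \<Rightarrow> ('a \<times> 'k \<Rightarrow>\<^sub>0 int) monoid" where
  "tensor_free A = free_Abelian_group (acarrier A \<times> UNIV)"

definition tensor_relators ::
  "('s \<Rightarrow> 'k::comm_ring_1) \<Rightarrow> ('s, 'a) alg \<Rightarrow> ('a \<times> 'k \<Rightarrow>\<^sub>0 int) set" where
  "tensor_relators \<iota> A =
    (let pair = (\<lambda>a c. Poly_Mapping.single (a, c) (1::int))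
     in {pair (aadd A a b) c - pair a c - pair b c | a b c. a \<in> acarrier A \<and> b \<in> acarrier A} \<union>
        {pair a (c + c') - pair a c - pair a c' | a c c'. a \<in> acarrier A} \<union>
        {pair (ascale A s a) c - pair a (\<iota> s * c) | s a c. a \<in> acarrier A})"

definition tensor_null ::
  "('s \<Rightarrow> 'k::comm_ring_1) \<Rightarrow> ('s, 'a) alg \<Rightarrow> ('a \<times> 'k \<Rightarrow>\<^sub>0 int) set" where
  "tensor_null \<iota> A = generate (tensor_free A) (tensor_relators \<iota> A)"

definition tensor_group ::
  "('s \<Rightarrow> 'k::comm_ring_1) \<Rightarrow> ('s, 'a) alg \<Rightarrow> ('a \<times> 'k \<Rightarrow>\<^sub>0 int) set monoid" where
  "tensor_group \<iota> A = tensor_free A Mod tensor_null \<iota> A"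

definition tensor_class ::
  "('s \<Rightarrow> 'k::comm_ring_1) \<Rightarrow> ('s, 'a) alg \<Rightarrow> ('a \<times> 'k \<Rightarrow>\<^sub>0 int) \<Rightarrow> ('a \<times> 'k \<Rightarrow>\<^sub>0 int) set" where
  "tensor_class \<iota> A x = tensor_null \<iota> A #>\<^bsub>tensor_free A\<^esub> x"

definition pure_tensor ::
  "('s \<Rightarrow> 'k::comm_ring_1) \<Rightarrow> ('s, 'a) alg \<Rightarrow> 'a \<Rightarrow> 'k \<Rightarrow> ('a \<times> 'k \<Rightarrow>\<^sub>0 int) set" where
  "pure_tensor \<iota> A a c = tensor_class \<iota> A (Poly_Mapping.single (a, c) 1)"

text \<open>\<open>c \<cdot> (a \<otimes> b) = a \<otimes> c b\<close> and \<open>(a \<otimes> c) (b \<otimes> d) = a b \<otimes> c d\<close>, extended additively on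
  representatives; all representatives give the same class, so the unions below have one member.\<close>

definition free_scale :: "'k::comm_ring_1 \<Rightarrow> ('a \<times> 'k \<Rightarrow>\<^sub>0 int) \<Rightarrow> ('a \<times> 'k \<Rightarrow>\<^sub>0 int)" where
  "free_scale c x = (\<Sum>(a, b) \<in> Poly_Mapping.keys x.
     Poly_Mapping.single (a, c * b) (Poly_Mapping.lookup x (a, b)))"

definition free_mult ::
  "('s, 'a) alg \<Rightarrow> ('a \<times> 'k::comm_ring_1 \<Rightarrow>\<^sub>0 int) \<Rightarrow> ('a \<times> 'k \<Rightarrow>\<^sub>0 int) \<Rightarrow> ('a \<times> 'k \<Rightarrow>\<^sub>0 int)" where
  "free_mult A x y = (\<Sum>(a, c) \<in> Poly_Mapping.keys x. \<Sum>(b, d) \<in> Poly_Mapping.keys y.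
     Poly_Mapping.single (amult A a b, c * d)
       (Poly_Mapping.lookup x (a, c) * Poly_Mapping.lookup y (b, d)))"

definition scalar_extension ::
  "('s \<Rightarrow> 'k::comm_ring_1) \<Rightarrow> ('s, 'a) alg \<Rightarrow> ('k, ('a \<times> 'k \<Rightarrow>\<^sub>0 int) set) alg" where
  "scalar_extension \<iota> A =
    \<lparr>acarrier = carrier (tensor_group \<iota> A),
     aadd = monoid.mult (tensor_group \<iota> A),
     ascale = (\<lambda>c X. \<Union>x \<in> X. tensor_class \<iota> A (free_scale c x)),
     amult = (\<lambda>X Y. \<Union>x \<in> X. \<Union>y \<in> Y. tensor_class \<iota> A (free_mult A x y))\<rparr>"

text \<open>
  The grading of a scalar extension \<open>A \<otimes> 'k\<close> of an arc algebra \<open>A\<close>: the part of degree \<open>d\<close> is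
  spanned additively by the \<open>X \<otimes> c\<close> with \<open>X\<close> an oriented diagram, \<open>c\<close> homogeneous and
  \<open>deg X + deg c = d\<close>. If \<open>\<iota>\<close> preserves degrees, this is the usual grading of a tensor product of
  graded modules; but \<open>\<iota>\<close> is not required to do so (for \<open>R = \<int>[x]\<close>, it may send \<open>x\<close> to \<open>\<alpha> \<omega>\<close>).
\<close>

definition extension_grade ::
  "('s::comm_ring_1 \<Rightarrow> 'k::comm_ring_1) \<Rightarrow> ('s, diagram \<Rightarrow>\<^sub>0 's) alg \<Rightarrow> (nat \<Rightarrow> 'k set) \<Rightarrow>
    nat \<Rightarrow> ((diagram \<Rightarrow>\<^sub>0 's) \<times> 'k \<Rightarrow>\<^sub>0 int) set set" where
  "extension_grade \<iota> A gr d = generate (tensor_group \<iota> A)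
     {pure_tensor \<iota> A (Poly_Mapping.single X 1) c | X c e.
        X \<in> oriented_diagrams \<and> c \<in> gr e \<and> diagram_degree X + e = d}"

end

theory Submission
  imports Defs
begin

text \<open>
  Up to the nesting signs and the powers of \<open>\<epsilon>\<close> in front of clockwise circles, a surgery is the
  multiplication or comultiplication of the Frobenius algebra \<open>k[X]/(X\<^sup>2 - \<alpha>)\<close>, i.e. the surgery for
  \<open>\<epsilon> = \<omega> = 1\<close>. These signs can be removed by rescaling the basis: multiply an oriented diagram by
  \<open>\<epsilon>\<close> to the power \<open>\<Sum>\<^sub>C (d(C) - 2)/4 \<cdot> t(C)\<close>, summed over all circles, plus the sum of \<open>t(C)\<close> over
  the clockwise circles. Then a surgery along \<open>\<gamma>\<close> differs from the one for \<open>\<epsilon> = \<omega> = 1\<close> only by the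
  factor \<open>\<epsilon>\<close> to the power \<open>(p(\<gamma>) + 1)(s(\<gamma>) + 1)\<close>, which does not depend on the circles, and by a factor
  \<open>\<epsilon>\<omega>\<close> if it is a split. The planar geometry enters through two facts: \<open>d(C)\<close> is \<open>2\<close> modulo \<open>4\<close>, and the
  parity of \<open>t(C)\<close> is that of \<open>p(v)\<close> plus the number of vertices of \<open>C\<close> to the right of \<open>v\<close>, for any
  vertex \<open>v\<close> of \<open>C\<close>; the latter determines the parities of all \<open>t(C)\<close> involved in a surgery from
  \<open>p(\<gamma>)\<close> and the nesting.

  The number of splits in a product is a function of the three weights, determined by the numbers of
  circles before and after. It is a cocycle, hence the coboundary of the number of splits in the
  product with a fixed weight of the block. So over every ring the algebra with parameters \<open>\<alpha>, \<epsilon>, \<omega>\<close>,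
  where \<open>\<epsilon>\<^sup>2 = 1\<close> and \<open>\<omega>\<close> is a unit, is isomorphic to the one with parameters \<open>\<alpha>, 1, 1\<close>. Over \<open>Q\<close> this is
  applied to the original and to the specialized parameters; the isomorphism is graded as units of \<open>Q\<close>
  have degree \<open>0\<close>.
\<close>

text \<open>The weighting of \<open>(d(C) - 2)/4\<close> by \<open>t(C)\<close> is forced by
  nesting. In a surgery of unnested circles the three values of \<open>t\<close> have the same
  parity, and the weighted widths contribute only a term in \<open>p\<close> and \<open>s\<close> of
  the saddle. If one circle lies inside another, the inner \<open>t\<close> is off by one from the
  other two, and the sum leaves \<open>(d(C_in) - 2)/4\<close> behind, which is the nesting sign of
  the multiplication rule. The obstacle is that circles are bare finite sets of vertices, so
  planarity has to be expressed by counting. Everything is reduced to two noncrossing perfect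
  matchings: being inside is a parity of vertices to the right, its invariance is checked arc by
  arc, and whether a surgery leaves one or two circles is decided by a parity count and a
  two-colouring of the vertices. The scalar extension is a quotient of a free abelian group. It is
  identified with the arc algebra over \<open>Q\<close> with the images of the parameters by
  computing the kernel of an evaluation map.\<close>

abbreviation (input) "lookup \<equiv> Poly_Mapping.lookup"
abbreviation (input) "keys \<equiv> Poly_Mapping.keys"
abbreviation (input) "single \<equiv> Poly_Mapping.single"

section \<open>Noncrossing matchings\<close>

definition nc_matching :: "int set \<Rightarrow> arcs \<Rightarrow> bool" where
  "nc_matching S A \<longleftrightarrow> (\<forall>(i, j) \<in> A. i < j \<and> i \<in> S \<and> j \<in> S) \<and>
     (\<forall>x \<in> S. \<exists>!y. (x, y) \<in> A \<or> (y, x) \<in> A) \<and>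
     (\<forall>(i, j) \<in> A. \<forall>(k, l) \<in> A. \<not> (i < k \<and> k < j \<and> j < l))"

definition mate :: "arcs \<Rightarrow> int \<Rightarrow> int" where
  "mate A x = (THE y. (x, y) \<in> A \<or> (y, x) \<in> A)"

lemma nc_matchingD:
  assumes "nc_matching S A" "(i, j) \<in> A"
  shows "i < j" "i \<in> S" "j \<in> S"
  using assms unfolding nc_matching_def by auto

lemma nc_matching_noncrossing:
  assumes "nc_matching S A" "(i, j) \<in> A" "(k, l) \<in> A" "i < k" "k < j" "j < l"
  shows False
  using assms unfolding nc_matching_def by fast

lemma mate_iff:
  assumes "nc_matching S A" "x \<in> S"
  shows "(x, y) \<in> A \<or> (y, x) \<in> A \<longleftrightarrow> y = mate A x"
proof -
  have ex1: "\<exists>!y. (x, y) \<in> A \<or> (y, x) \<in> A"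
    using assms unfolding nc_matching_def by blast
  show ?thesis
    unfolding mate_def
    by (rule iffI, rule the1_equality[OF ex1, symmetric], assumption, hypsubst, rule theI'[OF ex1])
qed

lemma mate_eq:
  assumes "nc_matching S A" "(i, j) \<in> A"
  shows "mate A i = j" "mate A j = i"
  using mate_iff[OF assms(1)] nc_matchingD[OF assms] assms(2) by metis+

lemma mate_props:
  assumes "nc_matching S A" "x \<in> S"
  shows "mate A x \<in> S" "mate A (mate A x) = x" "mate A x \<noteq> x"
    "x < mate A x \<longleftrightarrow> (x, mate A x) \<in> A" "mate A x < x \<longleftrightarrow> (mate A x, x) \<in> A"
proof -
  have *: "(x, mate A x) \<in> A \<or> (mate A x, x) \<in> A"
    using mate_iff[OF assms] by blast
  then show "mate A x \<in> S" "mate A x \<noteq> x" "mate A (mate A x) = x"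
    using nc_matchingD[OF assms(1)] mate_eq[OF assms(1)] by (metis order_less_irrefl)+
  show "x < mate A x \<longleftrightarrow> (x, mate A x) \<in> A" "mate A x < x \<longleftrightarrow> (mate A x, x) \<in> A"
    using * nc_matchingD(1)[OF assms(1)] by (meson order_less_asym)+
qed

lemma mate_between:
  assumes "nc_matching S A" "(i, j) \<in> A" "x \<in> S" "i < x" "x < j"
  shows "i < mate A x" "mate A x < j"
proof -
  note m = mate_props[OF assms(1,3)]
  have n: "mate A x \<noteq> i" "mate A x \<noteq> j"
    using mate_eq[OF assms(1,2)] m(2) assms(4,5) by auto
  have "\<not> j < mate A x"
    using nc_matching_noncrossing[OF assms(1,2)] m(4) assms(4,5) by (meson order_less_trans)
  moreover have "\<not> mate A x < i"
    using nc_matching_noncrossing[OF assms(1) _ assms(2)] m(5) assms(4,5) by (meson order_less_trans)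
  ultimately show "i < mate A x" "mate A x < j"
    using n by auto
qed

lemma nc_matching_remove:
  assumes "nc_matching S A" "(i, j) \<in> A"
  shows "nc_matching (S - {i, j}) (A - {(i, j)})"
  unfolding nc_matching_def
proof (intro conjI ballI)
  fix a assume a: "a \<in> A - {(i, j)}"
  obtain k l where kl: "a = (k, l)" by force
  then have "(k, l) \<in> A" "(k, l) \<noteq> (i, j)" using a by auto
  then have "k \<noteq> i \<and> k \<noteq> j \<and> l \<noteq> i \<and> l \<noteq> j"
    using mate_eq[OF assms] mate_eq[OF assms(1) \<open>(k, l) \<in> A\<close>] nc_matchingD[OF assms(1)] assms(2)
    by (metis order_less_asym)
  then show "case a of (i', j') \<Rightarrow> i' < j' \<and> i' \<in> S - {i, j} \<and> j' \<in> S - {i, j}"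
    using kl nc_matchingD[OF assms(1) \<open>(k, l) \<in> A\<close>] by auto
next
  fix x assume x: "x \<in> S - {i, j}"
  then have "(x, y) \<in> A - {(i, j)} \<or> (y, x) \<in> A - {(i, j)} \<longleftrightarrow> y = mate A x" for y
    using mate_iff[OF assms(1), of x y] by auto
  then show "\<exists>!y. (x, y) \<in> A - {(i, j)} \<or> (y, x) \<in> A - {(i, j)}"
    by auto
next
  fix a assume "a \<in> A - {(i, j)}"
  then show "case a of (i', j') \<Rightarrow> \<forall>(k, l) \<in> A - {(i, j)}. \<not> (i' < k \<and> k < j' \<and> j' < l)"
    using nc_matching_noncrossing[OF assms(1)] by (auto split: prod.splits)
qed

lemma mate_remove:
  assumes "nc_matching S A" "(i, j) \<in> A" "x \<in> S - {i, j}"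
  shows "mate (A - {(i, j)}) x = mate A x"
proof -
  have "(x, mate A x) \<in> A \<or> (mate A x, x) \<in> A"
    using mate_iff[OF assms(1)] assms(3) by blast
  then have "(x, mate A x) \<in> A - {(i, j)} \<or> (mate A x, x) \<in> A - {(i, j)}"
    using assms(3) by auto
  then show ?thesis
    using mate_iff[OF nc_matching_remove[OF assms(1,2)] assms(3)] by metis
qed

lemma nc_matching_finite:
  assumes "nc_matching S A" "finite S"
  shows "finite A"
proof (rule finite_subset)
  show "A \<subseteq> S \<times> S"
    using nc_matchingD[OF assms(1)] by auto
qed (use assms(2) in simp)

text \<open>Removing an orbit \<open>{x, f x}\<close> takes away two elements. This is the counting
  device behind the parities below, with \<open>f\<close> following the arcs of a matching.\<close>

lemma even_card_involution:
  assumes "finite X" "\<And>x. x \<in> X \<Longrightarrow> f x \<in> X \<and> f (f x) = x \<and> f x \<noteq> x"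
  shows "even (card X)"
  using assms
proof (induction "card X" arbitrary: X rule: less_induct)
  case less
  show ?case
  proof (cases "X = {}")
    case False
    then obtain x where x: "x \<in> X" by auto
    note fx = less.prems(2)[OF x]
    let ?Y = "X - {x, f x}"
    have c: "card X = Suc (Suc (card ?Y))"
    proof -
      have "X = insert x (insert (f x) ?Y)" using fx x by auto
      moreover have "card (insert x (insert (f x) ?Y)) = Suc (Suc (card ?Y))"
        using fx[THEN conjunct2, THEN conjunct2, symmetric] less.prems(1) by (subst card_insert_disjoint; simp)
      ultimately show ?thesis by simp
    qed
    have "f y \<in> ?Y \<and> f (f y) = y \<and> f y \<noteq> y" if "y \<in> ?Y" for y
      using that less.prems(2)[of y] fx by auto
    then have "even (card ?Y)"
      using less.hyps[of ?Y] c less.prems(1) by simp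
    then show ?thesis using c by simp
  qed simp
qed

lemma nc_matching_card:
  assumes "nc_matching S A" "finite S"
  shows "card S = 2 * card A"
proof -
  have inj: "inj_on fst A" "inj_on snd A"
    using mate_eq[OF assms(1)] by (metis inj_onI prod.collapse)+
  have S: "S = fst ` A \<union> snd ` A"
  proof (intro equalityI subsetI)
    fix x assume "x \<in> S"
    then show "x \<in> fst ` A \<union> snd ` A"
      using mate_iff[OF assms(1)] by (metis UnI1 UnI2 fst_conv image_eqI snd_conv)
  qed (use nc_matchingD[OF assms(1)] in auto)
  have disj: "fst ` A \<inter> snd ` A = {}"
  proof -
    have False if "(x, y) \<in> A" "(z, x) \<in> A" for x y z
      using mate_eq[OF assms(1) that(1)] mate_eq[OF assms(1) that(2)]
        nc_matchingD(1)[OF assms(1) that(1)] nc_matchingD(1)[OF assms(1) that(2)] by simp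
    then show ?thesis by auto
  qed
  have "finite A" by (rule nc_matching_finite[OF assms])
  then show ?thesis
    unfolding S using disj by (subst card_Un_disjoint) (auto simp: card_image inj)
qed

section \<open>Cup diagrams\<close>

lemma cupD:
  assumes "cup \<xi> i j"
  shows "i < j" "\<xi> i = Down" "\<xi> j = Up"
    "\<And>k. i < k \<Longrightarrow> k < j \<Longrightarrow> k \<in> stars \<xi> \<Longrightarrow> \<exists>l. i < l \<and> l < j \<and> (cup \<xi> k l \<or> cup \<xi> l k)"
  using assms by (cases; force simp: stars_def)+

text \<open>Uniqueness of right and of left ends is proved simultaneously. Two arcs with the same
  left end put the nearer right end strictly below the longer arc, where the definition supplies a
  second arc into it; this violates uniqueness of left ends on a shorter interval. The mirror case
  leads back, so the induction runs over the span of the longer arc.\<close>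

lemma cup_inject:
  "(cup \<xi> i j \<longrightarrow> cup \<xi> i j' \<longrightarrow> j < j' \<longrightarrow> False) \<and>
   (cup \<xi> j j' \<longrightarrow> cup \<xi> i j' \<longrightarrow> i < j \<longrightarrow> False)"
proof (induction "nat (j' - i)" arbitrary: i j j' rule: less_induct)
  case less
  show ?case
  proof (intro conjI impI)
    assume c: "cup \<xi> i j" "cup \<xi> i j'" "j < j'"
    then obtain l where l: "i < l" "cup \<xi> j l \<or> cup \<xi> l j"
      using cupD(4)[OF c(2), of j] cupD[OF c(1)] by (auto simp: stars_def)
    moreover have "\<not> cup \<xi> j l"
      using cupD(3)[OF c(1)] cupD(2) by force
    ultimately show False
      using less[of j i l] c cupD(1)[OF c(1)] by auto
  next
    assume c: "cup \<xi> j j'" "cup \<xi> i j'" "i < j"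
    then obtain l where l: "l < j'" "cup \<xi> j l \<or> cup \<xi> l j"
      using cupD(4)[OF c(2), of j] cupD[OF c(1)] by (auto simp: stars_def)
    moreover have "\<not> cup \<xi> l j"
      using cupD(2)[OF c(1)] cupD(3) by force
    ultimately show False
      using less[of j' j l] c cupD(1)[OF c(1)] by auto
  qed
qed

lemma cup_unique:
  assumes "cup \<xi> i j"
  shows "cup \<xi> i j' \<Longrightarrow> j' = j" "cup \<xi> i' j \<Longrightarrow> i' = i"
  using assms cup_inject by (metis linorder_neqE)+

text \<open>Crossings are excluded by the clause of \<open>cup\<close> that a vertex below an arc
  has its partner below the same arc. No vertex is both a left and a right end, as left ends carry
  \<open>Down\<close> and right ends \<open>Up\<close>.\<close>

lemma nc_matching_cups:
  assumes "balanced_weight \<xi>"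
  shows "nc_matching (stars \<xi>) (cups \<xi>)"
  unfolding nc_matching_def
proof (intro conjI ballI)
  fix a assume "a \<in> cups \<xi>"
  then show "case a of (i, j) \<Rightarrow> i < j \<and> i \<in> stars \<xi> \<and> j \<in> stars \<xi>"
    using cupD by (auto simp: cups_def stars_def)
next
  fix x assume "x \<in> stars \<xi>"
  then obtain y where y: "cup \<xi> x y \<or> cup \<xi> y x"
    using assms by (auto simp: balanced_weight_def cups_def)
  have "z = y" if z: "cup \<xi> x z \<or> cup \<xi> z x" for z
    using y z
  proof (elim disjE)
    assume "cup \<xi> x y" "cup \<xi> z x"
    then show ?thesis using cupD(2)[of \<xi> x y] cupD(3)[of \<xi> z x] by simp
  next
    assume "cup \<xi> y x" "cup \<xi> x z"
    then show ?thesis using cupD(2)[of \<xi> x z] cupD(3)[of \<xi> y x] by simp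
  qed (use cup_unique in blast)+
  then show "\<exists>!y. (x, y) \<in> cups \<xi> \<or> (y, x) \<in> cups \<xi>"
    using y by (auto simp: cups_def)
next
  fix a assume a: "a \<in> cups \<xi>"
  have False if c: "cup \<xi> i j" "cup \<xi> k l" and lt: "i < k" "k < j" "j < l" for i j k l
  proof -
    obtain m where m: "m < j" "cup \<xi> k m \<or> cup \<xi> m k"
      using cupD(4)[OF c(1) lt(1,2)] cupD(2)[OF c(2)] by (auto simp: stars_def)
    moreover have "\<not> cup \<xi> m k"
      using cupD(2)[OF c(2)] cupD(3) by force
    ultimately show False
      using cup_unique(1)[OF c(2), of m] lt by auto
  qed
  then show "case a of (i, j) \<Rightarrow> \<forall>(k, l) \<in> cups \<xi>. \<not> (i < k \<and> k < j \<and> j < l)"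
    using a by (auto simp: cups_def)
qed

lemma finite_stars:
  assumes "is_weight \<xi>"
  shows "finite (stars \<xi>)" "finite {i. \<xi> i = Cross}"
proof -
  obtain N where N: "\<And>i. \<bar>i\<bar> > N \<Longrightarrow> \<xi> i = Circ"
    using assms by (auto simp: is_weight_def)
  have *: "i \<in> {-N..N}" if "\<xi> i \<noteq> Circ" for i
  proof -
    have "\<not> \<bar>i\<bar> > N" using N that by auto
    then show ?thesis by auto
  qed
  then show "finite (stars \<xi>)" "finite {i. \<xi> i = Cross}"
    by (rule_tac finite_subset[of _ "{-N..N}"], use * in \<open>auto simp: stars_def\<close>)+
qed

lemma pos_diff:
  assumes "is_weight \<xi>" "i < j"
  shows "pos \<xi> j - pos \<xi> i =
    int (card (stars \<xi> \<inter> {i<..j})) + 2 * int (card {k. i < k \<and> k \<le> j \<and> \<xi> k = Cross})"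
proof -
  have 1: "{k. k \<le> j \<and> k \<in> stars \<xi>} = {k. k \<le> i \<and> k \<in> stars \<xi>} \<union> (stars \<xi> \<inter> {i<..j})"
    and 2: "{k. k \<le> j \<and> \<xi> k = Cross} = {k. k \<le> i \<and> \<xi> k = Cross} \<union> {k. i < k \<and> k \<le> j \<and> \<xi> k = Cross}"
    using assms(2) by auto
  have f: "finite {k. k \<le> i \<and> k \<in> stars \<xi>}" "finite (stars \<xi> \<inter> {i<..j})"
    by (rule finite_subset[OF _ finite_stars(1)[OF assms(1)]], blast)+
  have g: "finite {k. k \<le> i \<and> \<xi> k = Cross}" "finite {k. i < k \<and> k \<le> j \<and> \<xi> k = Cross}"
    by (rule finite_subset[OF _ finite_stars(2)[OF assms(1)]], blast)+
  have "card {k. k \<le> j \<and> k \<in> stars \<xi>} = card {k. k \<le> i \<and> k \<in> stars \<xi>} + card (stars \<xi> \<inter> {i<..j})"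
    using card_Un_disjoint[OF f] 1 by (simp add: disjoint_iff)
  moreover have "card {k. k \<le> j \<and> \<xi> k = Cross} =
    card {k. k \<le> i \<and> \<xi> k = Cross} + card {k. i < k \<and> k \<le> j \<and> \<xi> k = Cross}"
    using card_Un_disjoint[OF g] 2 by (simp add: disjoint_iff)
  ultimately show ?thesis
    by (simp add: pos_def)
qed

text \<open>The vertices strictly below an arc are matched among themselves, crosses count twice,
  and only the right end remains. Hence the halving in \<open>saddle_width\<close> is exact.\<close>

lemma odd_arc_width:
  assumes "is_weight \<xi>" "nc_matching (stars \<xi>) A" "\<gamma> \<in> A"
  shows "odd (arc_width \<xi> \<gamma>)"
proof -
  obtain i j where g: "\<gamma> = (i, j)" by force
  have ij: "(i, j) \<in> A" using assms(3) g by simp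
  have "even (card (stars \<xi> \<inter> {i<..<j}))"
    by (rule even_card_involution[where f = "mate A"])
      (use finite_stars[OF assms(1)] mate_props[OF assms(2)] mate_between[OF assms(2) ij] in auto)
  moreover have "stars \<xi> \<inter> {i<..j} = insert j (stars \<xi> \<inter> {i<..<j})"
    using nc_matchingD[OF assms(2) ij] by auto
  ultimately have "odd (card (stars \<xi> \<inter> {i<..j}))"
    using finite_stars[OF assms(1)] by simp
  then show ?thesis
    unfolding arc_width_def g using pos_diff[OF assms(1) nc_matchingD(1)[OF assms(2) ij]] by simp
qed

section \<open>Circles in stacked diagrams\<close>

text \<open>\<open>a \<circ> b\<close> is injective on the finite set \<open>T\<close>, hence
  permutes it. So \<open>x = a (b y)\<close> with \<open>y\<close> in \<open>T\<close>, and
  \<open>a x = b y\<close> lies in the image of \<open>T\<close> under \<open>b\<close>.\<close>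

lemma closed_under_alternating_orbit:
  assumes "finite T" "T \<subseteq> V" "\<And>x. x \<in> V \<Longrightarrow> a x \<in> V \<and> a (a x) = x"
    and "\<And>x. x \<in> V \<Longrightarrow> b x \<in> V \<and> b (b x) = x" and "\<And>x. x \<in> T \<Longrightarrow> a (b x) \<in> T"
  shows "a ` (T \<union> b ` T) \<subseteq> T \<union> b ` T" "b ` (T \<union> b ` T) \<subseteq> T \<union> b ` T"
proof -
  have "inj_on (a \<circ> b) T"
    using assms(2-4) by (intro inj_onI) (metis comp_apply subsetD)
  moreover have "(a \<circ> b) ` T \<subseteq> T"
    using assms(5) by auto
  ultimately have onto: "(a \<circ> b) ` T = T"
    using endo_inj_surj[OF assms(1), of "a \<circ> b"] by blast
  have "a x \<in> b ` T" if x: "x \<in> T" for x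
  proof -
    obtain y where y: "y \<in> T" "x = a (b y)" using onto x by auto
    then show ?thesis using assms(2-4) by (metis imageI subsetD)
  qed
  then show "a ` (T \<union> b ` T) \<subseteq> T \<union> b ` T"
    using assms(5) by auto
  show "b ` (T \<union> b ` T) \<subseteq> T \<union> b ` T"
    using assms(2,4) by auto
qed

text \<open>
  The walk \<open>u, a (b u), a (b (a (b u))), \<dots>\<close> stays in one colour class. It first returns to \<open>{u, w}\<close>
  at \<open>w\<close>, so after reconnecting it closes up at \<open>w\<close> without passing through \<open>u\<close>.
\<close>

lemma alternating_split:
  fixes colour :: "'a \<Rightarrow> bool"
  assumes fin: "finite V"
    and a: "\<And>x. x \<in> V \<Longrightarrow> a x \<in> V \<and> a (a x) = x \<and> colour (a x) \<noteq> colour x"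
    and b: "\<And>x. x \<in> V \<Longrightarrow> b x \<in> V \<and> b (b x) = x \<and> colour (b x) \<noteq> colour x"
    and c: "\<And>x. x \<in> V \<Longrightarrow> c x \<in> V \<and> c (c x) = x \<and> colour (c x) \<noteq> colour x"
    and uw: "u \<in> V" "w \<in> V" "u \<noteq> w" "colour u = colour w"
    and c_uw: "c w = b u" "\<And>x. x \<in> V \<Longrightarrow> x \<notin> {u, w, b u, b w} \<Longrightarrow> c x = b x"
    and conn: "\<And>T. T \<subseteq> V \<Longrightarrow> a ` T \<subseteq> T \<Longrightarrow> b ` T \<subseteq> T \<Longrightarrow> u \<in> T \<Longrightarrow> w \<in> T"
  shows "\<exists>T \<subseteq> V. a ` T \<subseteq> T \<and> c ` T \<subseteq> T \<and> w \<in> T \<and> u \<notin> T"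
proof -
  define orb where "orb t = ((a \<circ> b) ^^ t) u" for t
  have orb0: "orb 0 = u" and orbS: "orb (Suc t) = a (b (orb t))" for t
    by (simp_all add: orb_def)
  have orbV: "orb t \<in> V \<and> colour (orb t) = colour u" for t
  proof (induction t)
    case (Suc t)
    then show ?case using a[of "b (orb t)"] b[of "orb t"] by (auto simp: orbS)
  qed (simp add: orb0 uw)
  have inj: "orb s = orb t" if "orb (Suc s) = orb (Suc t)" for s t
    using that a b orbV unfolding orbS by metis
  \<comment> \<open>By finiteness some point repeats; cancelling steps backwards moves the
    repetition to time 0.\<close>
  have "\<exists>t>0. orb t = u"
  proof -
    have "\<not> inj orb"
      using range_inj_infinite[of orb] finite_subset[OF _ fin, of "range orb"] orbV by blast
    then obtain s t where "s < t" "orb s = orb t"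
      unfolding inj_on_def by (metis linorder_neqE_nat)
    then show ?thesis
    proof (induction s arbitrary: t)
      case (Suc s)
      then obtain t' where "t = Suc t'" "s < t'"
        by (metis Suc_lessE)
      then show ?case using Suc.IH[of t'] inj[of s t'] Suc.prems(2) by blast
    qed (metis orb0)
  qed
  then obtain k0 where k0: "k0 > 0 \<and> orb k0 \<in> {u, w}" by auto
  define k where "k = (LEAST t. t > 0 \<and> orb t \<in> {u, w})"
  have k: "k > 0" "orb k \<in> {u, w}"
    using LeastI[of "\<lambda>t. t > 0 \<and> orb t \<in> {u, w}", OF k0] unfolding k_def by auto
  have less_k: "orb t \<notin> {u, w}" if "0 < t" "t < k" for t
    using not_less_Least[of t "\<lambda>t. t > 0 \<and> orb t \<in> {u, w}"] that unfolding k_def by auto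
  \<comment> \<open>If the walk returned to \<open>u\<close> without meeting \<open>w\<close>, its
    points and their images under \<open>b\<close> would form a set closed under \<open>a\<close>
    and \<open>b\<close>, which contains \<open>w\<close> by \<open>conn\<close>. But
    \<open>w\<close> is not on the walk, and the images under \<open>b\<close> have the other
    colour.\<close>
  have "orb k \<noteq> u"
  proof
    assume ku: "orb k = u"
    define T where "T = orb ` {..<k}"
    have T: "finite T" "T \<subseteq> V" "w \<notin> T" "u \<in> T"
      using orbV less_k uw(3) orb0 k(1) unfolding T_def by (auto, metis insertCI neq0_conv)
    have "a (b x) \<in> T" if x: "x \<in> T" for x
    proof -
      obtain t where t: "t < k" "x = orb t" using x unfolding T_def by auto
      then have "a (b x) = orb (Suc t)" by (simp add: orbS)
      moreover have "orb (Suc t) \<in> T"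
        using t(1) ku orb0 k(1) unfolding T_def
        by (cases "Suc t = k") (metis imageI lessThan_iff, simp)
      ultimately show ?thesis by simp
    qed
    then have "a ` (T \<union> b ` T) \<subseteq> T \<union> b ` T" "b ` (T \<union> b ` T) \<subseteq> T \<union> b ` T"
      using closed_under_alternating_orbit[of T V a b, OF T(1,2)] a b by blast+
    then have "w \<in> T \<union> b ` T"
      using conn[of "T \<union> b ` T"] T(2,4) b by (metis UnI1 Un_subset_iff image_subset_iff subsetD)
    moreover have "w \<notin> b ` T"
    proof
      assume "w \<in> b ` T"
      then obtain t where "w = b (orb t)" unfolding T_def by auto
      then show False using b[of "orb t"] orbV[of t] uw(4) by simp
    qed
    ultimately show False using T by auto
  qed
  then have kw: "orb k = w" using k by auto
  define T where "T = orb ` {1..k}"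
  have T: "finite T" "T \<subseteq> V" "w \<in> T"
    using orbV k kw unfolding T_def by (auto intro!: image_eqI[of _ _ k])
  have uT: "u \<notin> T"
  proof
    assume "u \<in> T"
    then obtain t where t: "1 \<le> t" "t \<le> k" "orb t = u" unfolding T_def by auto
    then show False using less_k[of t] kw uw(3) by (cases "t = k") auto
  qed
  have "a (c x) \<in> T" if x: "x \<in> T" for x
  proof -
    obtain t where t: "1 \<le> t" "t \<le> k" "x = orb t" using x unfolding T_def by auto
    show ?thesis
    proof (cases "t = k")
      \<comment> \<open>At \<open>w\<close> the new matching \<open>c\<close> leads to
        \<open>b u\<close>, so the walk goes on with \<open>a (b u) = orb 1\<close>: the new orbit
        closes up without its former starting point \<open>u\<close>.\<close>
      case True
      then have "a (c x) = orb 1"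
        using t kw c_uw(1) orbS[of 0] orb0 by simp
      then show ?thesis using k(1) unfolding T_def by auto
    next
      case False
      then have "x \<notin> {u, w}" using less_k t by auto
      moreover have "x \<notin> {b u, b w}"
        using orbV[of t] b uw t by (metis insertE singletonD)
      ultimately have "a (c x) = orb (Suc t)"
        using c_uw(2)[of x] orbV[of t] t by (simp add: orbS)
      then show ?thesis using False t unfolding T_def by auto
    qed
  qed
  then have "a ` (T \<union> c ` T) \<subseteq> T \<union> c ` T" "c ` (T \<union> c ` T) \<subseteq> T \<union> c ` T"
    using closed_under_alternating_orbit[of T V a c, OF T(1,2)] a c by blast+
  moreover have "u \<notin> c ` T"
  proof
    assume "u \<in> c ` T"
    then obtain t where "u = c (orb t)" unfolding T_def by auto
    then show False using c[of "orb t"] orbV[of t] by simp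
  qed
  moreover have "T \<union> c ` T \<subseteq> V" using T(2) c by auto
  ultimately show ?thesis
    using T(3) uT by (intro exI[of _ "T \<union> c ` T"]) simp
qed

section \<open>Circles as orbits of two involutions\<close>

definition vertices :: "weight \<Rightarrow> vertex set" where
  "vertices \<xi> = UNIV \<times> stars \<xi>"

fun flip :: "line \<Rightarrow> line" where
  "flip Lower = Upper"
| "flip Upper = Lower"

lemma flip_flip [simp]: "flip (flip l) = l" "flip l \<noteq> l" "l \<noteq> flip l"
  by (cases l; simp)+

text \<open>The edges form two perfect matchings of the vertices: the arcs outside the two lines
  (\<open>outer\<close>), and the middle arcs together with the vertical lines
  (\<open>inner\<close>). A circle is an orbit of these two involutions, and the sets in
  \<open>closed_in\<close> are the unions of circles.\<close>

fun outer :: "stacked \<Rightarrow> vertex \<Rightarrow> vertex" where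
  "outer D (Lower, x) = (Lower, mate (lower_cups D) x)"
| "outer D (Upper, x) = (Upper, mate (upper_caps D) x)"

fun inner :: "stacked \<Rightarrow> vertex \<Rightarrow> vertex" where
  "inner D (l, x) = (if x \<in> verticals D then (flip l, x) else (l, mate (middle D) x))"

definition closed_in :: "weight \<Rightarrow> stacked \<Rightarrow> vertex set \<Rightarrow> bool" where
  "closed_in \<xi> D T \<longleftrightarrow> T \<subseteq> vertices \<xi> \<and> outer D ` T \<subseteq> T \<and> inner D ` T \<subseteq> T"

definition circles :: "weight \<Rightarrow> stacked \<Rightarrow> vertex set set" where
  "circles \<xi> D = circle D ` vertices \<xi>"

text \<open>The count of \<open>circle_inside\<close>. It is also used for \<open>v\<close> on
  \<open>C\<close> itself, where its parity determines that of the rightmost position.\<close>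

definition right_count :: "vertex set \<Rightarrow> vertex \<Rightarrow> nat" where
  "right_count C v = card {k. snd v < k \<and> (fst v, k) \<in> C}"

lemma circle_refl: "v \<in> circle D v"
  by (simp add: circle_def)

lemma circle_eq:
  assumes "w \<in> circle D v"
  shows "circle D w = circle D v"
proof -
  let ?R = "(edges D \<union> (edges D)\<inverse>)\<^sup>*"
  have "sym ?R"
    by (intro sym_rtrancl sym_Un_converse)
  moreover have "(v, w) \<in> ?R"
    using assms by (simp add: circle_def)
  ultimately have "(v, u) \<in> ?R \<longleftrightarrow> (w, u) \<in> ?R" for u
    by (meson rtrancl_trans symD)
  then show ?thesis by (auto simp: circle_def)
qed

lemma circle_disjoint: "circle D v \<noteq> circle D w \<Longrightarrow> circle D v \<inter> circle D w = {}"
  using circle_eq by blast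

text \<open>The invariants of a diagram between two surgeries. \<open>free\<close> is kept because
  only arcs not enclosed by others are cut, so a new vertical line never ends below a remaining
  middle arc.\<close>

locale stacked_diagram =
  fixes \<xi> :: weight and D :: stacked
  assumes fin_stars: "finite (stars \<xi>)"
    and lower: "nc_matching (stars \<xi>) (lower_cups D)"
    and upper: "nc_matching (stars \<xi>) (upper_caps D)"
    and mid: "nc_matching (stars \<xi> - verticals D) (middle D)"
    and verts: "verticals D \<subseteq> stars \<xi>"
    and free: "(i, j) \<in> middle D \<Longrightarrow> v \<in> verticals D \<Longrightarrow> \<not> (i < v \<and> v < j)"
    and odd_width: "\<gamma> \<in> lower_cups D \<union> middle D \<union> upper_caps D \<Longrightarrow> odd (arc_width \<xi> \<gamma>)"
begin

abbreviation "V \<equiv> vertices \<xi>"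

lemma finite_V: "finite V"
proof -
  have "(UNIV :: line set) = {Lower, Upper}"
    using line.exhaust by auto
  then have "finite (UNIV :: line set)" by (metis finite.emptyI finite.insertI)
  then show ?thesis unfolding vertices_def using fin_stars by simp
qed

lemma outer_props:
  assumes "v \<in> V"
  shows "outer D v \<in> V" "outer D (outer D v) = v" "outer D v \<noteq> v" "fst (outer D v) = fst v"
  using assms mate_props[OF lower] mate_props[OF upper]
  by (cases v; cases "fst v"; auto simp: vertices_def)+

lemma inner_props:
  assumes "v \<in> V"
  shows "inner D v \<in> V" "inner D (inner D v) = v" "inner D v \<noteq> v"
  using assms mate_props[OF mid] verts
  by (cases v; auto simp: vertices_def)+

lemma odd_mate:
  assumes "nc_matching S A" "x \<in> S" "A \<subseteq> lower_cups D \<union> middle D \<union> upper_caps D"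
  shows "odd (pos \<xi> x + pos \<xi> (mate A x))"
proof -
  consider "(x, mate A x) \<in> A" | "(mate A x, x) \<in> A"
    using mate_iff[OF assms(1,2)] by blast
  then show ?thesis
  proof cases
    case 1
    then show ?thesis using odd_width[of "(x, mate A x)"] assms(3) by (auto simp: arc_width_def)
  next
    case 2
    then show ?thesis using odd_width[of "(mate A x, x)"] assms(3) by (auto simp: arc_width_def)
  qed
qed

text \<open>A two-colouring reversed by both involutions: an arc changes the parity of the position
  and stays on its line, a vertical line does the opposite. It acts as an orientation of the circles
  in \<open>split_circles\<close>.\<close>

definition colour :: "vertex \<Rightarrow> bool" where
  "colour v \<longleftrightarrow> (even (pos \<xi> (snd v)) \<longleftrightarrow> fst v = Lower)"

lemma pos_outer: "v \<in> V \<Longrightarrow> odd (pos \<xi> (snd v) + pos \<xi> (snd (outer D v)))"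
  using odd_mate[OF lower] odd_mate[OF upper]
  by (cases v; cases "fst v") (auto simp: vertices_def)

lemma pos_inner:
  "v \<in> V \<Longrightarrow> odd (pos \<xi> (snd v) + pos \<xi> (snd (inner D v))) \<longleftrightarrow> snd v \<notin> verticals D"
  using odd_mate[OF mid] by (cases v) (auto simp: vertices_def)

lemma colour_outer: "v \<in> V \<Longrightarrow> colour (outer D v) \<noteq> colour v"
  using pos_outer[of v] outer_props(4)[of v] by (auto simp: colour_def)

lemma colour_inner: "v \<in> V \<Longrightarrow> colour (inner D v) \<noteq> colour v"
  using pos_inner[of v] by (cases v; cases "fst v") (auto simp: colour_def split: if_splits)

lemma edges_iff:
  "(v, w) \<in> edges D \<union> (edges D)\<inverse> \<longleftrightarrow> v \<in> V \<and> (w = outer D v \<or> w = inner D v)"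
proof -
  obtain l x m y where vw: "v = (l, x)" "w = (m, y)" by (metis surj_pair)
  have low: "(x, y) \<in> lower_cups D \<or> (y, x) \<in> lower_cups D \<longleftrightarrow> x \<in> stars \<xi> \<and> y = mate (lower_cups D) x"
    using mate_iff[OF lower, of x y] nc_matchingD(2,3)[OF lower] by blast
  have up: "(x, y) \<in> upper_caps D \<or> (y, x) \<in> upper_caps D \<longleftrightarrow> x \<in> stars \<xi> \<and> y = mate (upper_caps D) x"
    using mate_iff[OF upper, of x y] nc_matchingD(2,3)[OF upper] by blast
  have mi: "(x, y) \<in> middle D \<or> (y, x) \<in> middle D \<longleftrightarrow>
      x \<in> stars \<xi> \<and> x \<notin> verticals D \<and> y = mate (middle D) x"
    using mate_iff[OF mid, of x y] nc_matchingD(2,3)[OF mid] by blast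
  show ?thesis
    using low up mi verts unfolding vw edges_def vertices_def
    by (cases l; cases m) auto
qed

lemma closed_circle:
  assumes "v \<in> V"
  shows "closed_in \<xi> D (circle D v)"
proof -
  have "w \<in> V" if "(v, w) \<in> (edges D \<union> (edges D)\<inverse>)\<^sup>*" for w
    using that
  proof (induction rule: rtrancl_induct)
    case (step y z)
    then show ?case
      using edges_iff[of y z] outer_props(1)[of y] inner_props(1)[of y] by metis
  qed (rule assms)
  then have sub: "circle D v \<subseteq> V" by (auto simp: circle_def)
  moreover have "outer D w \<in> circle D v \<and> inner D w \<in> circle D v" if "w \<in> circle D v" for w
  proof -
    have "(w, outer D w) \<in> edges D \<union> (edges D)\<inverse>" "(w, inner D w) \<in> edges D \<union> (edges D)\<inverse>"
      using that sub edges_iff[of w] by blast+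
    moreover have "(v, w) \<in> (edges D \<union> (edges D)\<inverse>)\<^sup>*"
      using that by (simp add: circle_def)
    ultimately show ?thesis
      unfolding circle_def by (simp add: rtrancl_into_rtrancl)
  qed
  ultimately show ?thesis unfolding closed_in_def by (simp add: image_subset_iff)
qed

lemma circle_least:
  assumes "closed_in \<xi> D T" "v \<in> T"
  shows "circle D v \<subseteq> T"
proof -
  have "w \<in> T" if "(v, w) \<in> (edges D \<union> (edges D)\<inverse>)\<^sup>*" for w
    using that assms(2) by (induction) (use edges_iff assms(1) in \<open>auto simp: closed_in_def\<close>)
  then show ?thesis by (auto simp: circle_def)
qed

lemma closed_in_iff:
  assumes "closed_in \<xi> D T" "v \<in> V"
  shows "outer D v \<in> T \<longleftrightarrow> v \<in> T" "inner D v \<in> T \<longleftrightarrow> v \<in> T"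
  using assms outer_props[of v] inner_props[of v] unfolding closed_in_def by (metis image_subset_iff)+

lemma closed_Un:
  "closed_in \<xi> D T \<Longrightarrow> closed_in \<xi> D T' \<Longrightarrow> closed_in \<xi> D (T \<union> T')"
  unfolding closed_in_def by (simp add: image_Un le_supI1 le_supI2)

lemma finite_closed: "closed_in \<xi> D C \<Longrightarrow> finite C"
  using finite_V finite_subset unfolding closed_in_def by blast

section \<open>Parities of crossings with horizontal rays\<close>

lemma finite_line: "finite C \<Longrightarrow> finite {k. P k \<and> (l, k) \<in> C}"
  by (rule finite_subset[of _ "snd ` C"]) force+

text \<open>The points of \<open>X\<close> strictly between the ends cancel in pairs. What remains
  is \<open>j\<close> itself, which is counted from \<open>i\<close> but not from
  \<open>j\<close>.\<close>

lemma line_parity: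
  assumes "nc_matching S A" "finite X" "(i, j) \<in> A"
    and "\<And>x. x \<in> X \<Longrightarrow> i < x \<Longrightarrow> x < j \<Longrightarrow> x \<in> S \<and> mate A x \<in> X"
  shows "even (card {k. i < k \<and> k \<in> X} + card {k. j < k \<and> k \<in> X}) \<longleftrightarrow> j \<notin> X"
proof -
  have ij: "i < j" using nc_matchingD(1)[OF assms(1,3)] .
  have ev: "even (card (X \<inter> {i<..<j}))"
    by (rule even_card_involution[where f = "mate A"])
      (use assms mate_props[OF assms(1)] mate_between[OF assms(1,3)] in auto)
  have "{k. i < k \<and> k \<in> X} = (X \<inter> {i<..<j}) \<union> (X \<inter> {j}) \<union> {k. j < k \<and> k \<in> X}"
    using ij by auto
  moreover have "finite {k. j < k \<and> k \<in> X}"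
    using assms(2) by (rule rev_finite_subset) blast
  ultimately have "card {k. i < k \<and> k \<in> X} =
      card (X \<inter> {i<..<j}) + card (X \<inter> {j}) + card {k. j < k \<and> k \<in> X}"
    using assms(2) by (simp add: card_Un_disjoint disjoint_iff)
  then show ?thesis using ev by (cases "j \<in> X") auto
qed

lemma line_parity_mate:
  assumes "nc_matching S A" "finite X" "x \<in> S"
    and "\<And>k. k \<in> X \<Longrightarrow> k \<in> {x<..<mate A x} \<union> {mate A x<..<x} \<Longrightarrow> k \<in> S \<and> mate A k \<in> X"
    and "x \<in> X \<longleftrightarrow> mate A x \<in> X"
  shows "even (card {k. x < k \<and> k \<in> X} + card {k. mate A x < k \<and> k \<in> X}) \<longleftrightarrow> x \<notin> X"
proof (cases "x < mate A x")
  case True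
  then show ?thesis
    using line_parity[OF assms(1,2), of x "mate A x"] mate_props[OF assms(1,3)] assms by auto
next
  case False
  then have "mate A x < x" using mate_props[OF assms(1,3)] by auto
  then show ?thesis
    using line_parity[OF assms(1,2), of "mate A x" x] mate_props[OF assms(1,3)] assms
    by (auto simp: add.commute)
qed

text \<open>A discrete form of moving a point along an arc: off \<open>C\<close> the arc crosses
  nothing and the parity is kept, whereas on \<open>C\<close> the right end of the arc is counted
  from its left end only.\<close>

lemma right_count_outer:
  assumes C: "closed_in \<xi> D C" and v: "v \<in> V"
  shows "even (right_count C v + right_count C (outer D v)) \<longleftrightarrow> v \<notin> C"
proof -
  obtain l x where vx: "v = (l, x)" by force
  define A where "A = (if l = Lower then lower_cups D else upper_caps D)"
  have A: "nc_matching (stars \<xi>) A" using lower upper by (simp add: A_def)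
  have out: "outer D (l, k) = (l, mate A k)" for k by (cases l) (simp_all add: A_def)
  have *: "(l, k) \<in> C \<Longrightarrow> k \<in> stars \<xi>" for k
    using C by (auto simp: closed_in_def vertices_def)
  have **: "(l, mate A k) \<in> C \<longleftrightarrow> (l, k) \<in> C" if "k \<in> stars \<xi>" for k
    using closed_in_iff(1)[OF C, of "(l, k)"] that out by (simp add: vertices_def)
  have "finite {k. (l, k) \<in> C}"
    using finite_line[OF finite_closed[OF C], of "\<lambda>_. True" l] by simp
  from line_parity_mate[OF A this, of x] show ?thesis
    using * ** v unfolding vx right_count_def by (auto simp: out vertices_def)
qed

text \<open>Where no middle arc passes over the position, the vertices of \<open>C\<close> to the
  right are paired along middle arcs on each line separately; those left over lie on vertical lines
  and so correspond to each other on the two lines.\<close>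

lemma right_count_lines:
  assumes C: "closed_in \<xi> D C" and x: "\<And>k l. (k, l) \<in> middle D \<Longrightarrow> \<not> (k \<le> x \<and> x < l)"
  shows "even (right_count C (Lower, x) + right_count C (Upper, x))"
proof -
  have ev: "even (card {k. x < k \<and> k \<notin> verticals D \<and> (l, k) \<in> C})" for l
  proof (rule even_card_involution[where f = "mate (middle D)"])
    show "finite {k. x < k \<and> k \<notin> verticals D \<and> (l, k) \<in> C}"
      using finite_line[OF finite_closed[OF C], of "\<lambda>k. x < k \<and> k \<notin> verticals D" l] by (simp add: conj_assoc)
  next
    fix k assume k: "k \<in> {k. x < k \<and> k \<notin> verticals D \<and> (l, k) \<in> C}"
    then have kV: "k \<in> stars \<xi> - verticals D"
      using C by (auto simp: closed_in_def vertices_def)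
    note m = mate_props[OF mid kV]
    have "inner D (l, k) \<in> C"
      using k C by (auto simp: closed_in_def)
    then have "(l, mate (middle D) k) \<in> C"
      using k by simp
    moreover have "x < mate (middle D) k"
      using x[of "mate (middle D) k" k] m(3,5) k by force
    ultimately show "mate (middle D) k \<in> {k. x < k \<and> k \<notin> verticals D \<and> (l, k) \<in> C} \<and>
        mate (middle D) (mate (middle D) k) = k \<and> mate (middle D) k \<noteq> k"
      using m by auto
  qed
  have split: "right_count C (l, x) = card {k. x < k \<and> k \<in> verticals D \<and> (l, k) \<in> C} +
      card {k. x < k \<and> k \<notin> verticals D \<and> (l, k) \<in> C}" for l
  proof -
    have "{k. x < k \<and> (l, k) \<in> C} = {k. x < k \<and> k \<in> verticals D \<and> (l, k) \<in> C} \<union>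
      {k. x < k \<and> k \<notin> verticals D \<and> (l, k) \<in> C}" by auto
    then show ?thesis
      unfolding right_count_def fst_conv snd_conv
      using finite_line[OF finite_closed[OF C], of "\<lambda>k. x < k \<and> k \<notin> verticals D" l]
        finite_line[OF finite_closed[OF C], of "\<lambda>k. x < k \<and> k \<in> verticals D" l]
      by (simp add: card_Un_disjoint disjoint_iff conj_assoc)
  qed
  have "(Lower, k) \<in> C \<longleftrightarrow> (Upper, k) \<in> C" if "k \<in> verticals D" for k
    using closed_in_iff(2)[OF C, of "(Lower, k)"] that verts by (auto simp: vertices_def)
  then have "{k. x < k \<and> k \<in> verticals D \<and> (Lower, k) \<in> C} = {k. x < k \<and> k \<in> verticals D \<and> (Upper, k) \<in> C}"
    by auto
  then show ?thesis
    using split[of Lower] split[of Upper] ev[of Lower] ev[of Upper] by simp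
qed

lemma right_count_vertical:
  assumes C: "closed_in \<xi> D C" and x: "x \<in> verticals D"
  shows "even (right_count C (Lower, x) + right_count C (Upper, x))"
  using free[OF _ x] nc_matchingD(2)[OF mid] x by (intro right_count_lines[OF C]) (auto simp: le_less)

lemma right_count_inner:
  assumes C: "closed_in \<xi> D C" and v: "v \<in> V"
  shows "even (right_count C v + right_count C (inner D v)) \<longleftrightarrow> v \<notin> C \<or> snd v \<in> verticals D"
proof (cases "snd v \<in> verticals D")
  case True
  then show ?thesis
    using right_count_vertical[OF C True] by (cases v; cases "fst v") (auto simp: add.commute)
next
  case False
  obtain l x where vx: "v = (l, x)" by force
  let ?A = "middle D"
  have x: "x \<in> stars \<xi> - verticals D" using v False vx by (auto simp: vertices_def)
  have fin: "finite {k. (l, k) \<in> C}"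
    using finite_line[OF finite_closed[OF C], of "\<lambda>_. True" l] by simp
  have *: "k \<notin> verticals D" if "k \<in> {x<..<mate ?A x} \<union> {mate ?A x<..<x}" for k
    using that free[of x "mate ?A x" k] free[of "mate ?A x" x k] mate_props(4,5)[OF mid x] by auto
  have **: "(l, mate ?A k) \<in> C \<longleftrightarrow> (l, k) \<in> C" if "k \<in> stars \<xi> - verticals D" for k
    using closed_in_iff(2)[OF C, of "(l, k)"] that by (simp add: vertices_def)
  have ***: "(l, k) \<in> C \<Longrightarrow> k \<in> stars \<xi>" for k
    using C by (auto simp: closed_in_def vertices_def)
  have "even (card {k. x < k \<and> k \<in> {k. (l, k) \<in> C}} + card {k. mate ?A x < k \<and> k \<in> {k. (l, k) \<in> C}})
      \<longleftrightarrow> x \<notin> {k. (l, k) \<in> C}"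
    by (rule line_parity_mate[OF mid fin x]) (use * ** *** x in auto)
  then show ?thesis
    using False unfolding vx right_count_def by simp
qed

text \<open>This takes the place of the Jordan curve theorem. The vertices off \<open>C\<close> with
  a given ray parity form a closed set, hence a union of circles.\<close>

lemma right_count_const:
  assumes C: "closed_in \<xi> D C" and v: "v \<in> V" "v \<notin> C" and w: "w \<in> circle D v"
  shows "even (right_count C w) \<longleftrightarrow> even (right_count C v)"
proof -
  let ?T = "{w \<in> V - C. even (right_count C w) \<longleftrightarrow> even (right_count C v)}"
  have "outer D u \<in> ?T \<and> inner D u \<in> ?T" if "u \<in> ?T" for u
  proof -
    have u: "u \<in> V" "u \<notin> C" using that by auto
    then show ?thesis
      using right_count_outer[OF C u(1)] right_count_inner[OF C u(1)] closed_in_iff[OF C u(1)]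
        outer_props(1)[OF u(1)] inner_props(1)[OF u(1)] that
      by (simp add: even_add del: inner.simps)
  qed
  then have "closed_in \<xi> D ?T"
    unfolding closed_in_def by (simp add: image_subset_iff del: inner.simps)
  then show ?thesis
    using circle_least[of ?T v] v w by auto
qed

text \<open>Along \<open>C\<close> itself every arc reverses both the ray parity and the parity of
  the position, and a vertical line preserves both; so the parity of the sum is invariant.\<close>

lemma right_count_pos_const:
  assumes v: "v \<in> V" and w: "w \<in> circle D v"
  defines "C \<equiv> circle D v"
  shows "even (int (right_count C w) + pos \<xi> (snd w)) \<longleftrightarrow> even (int (right_count C v) + pos \<xi> (snd v))"
proof -
  note C = closed_circle[OF v, folded C_def]
  let ?T = "{w \<in> C. even (int (right_count C w) + pos \<xi> (snd w)) \<longleftrightarrow> even (int (right_count C v) + pos \<xi> (snd v))}"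
  have CV: "C \<subseteq> V" using C by (simp add: closed_in_def)
  have "outer D u \<in> ?T \<and> inner D u \<in> ?T" if "u \<in> ?T" for u
  proof -
    have u: "u \<in> C" "u \<in> V" using that CV by auto
    then show ?thesis
      using right_count_outer[OF C u(2)] right_count_inner[OF C u(2)] closed_in_iff[OF C u(2)]
        pos_outer[OF u(2)] pos_inner[OF u(2)] that by (auto simp: even_add simp del: inner.simps)
  qed
  moreover have "?T \<subseteq> V" using CV by auto
  ultimately have "closed_in \<xi> D ?T"
    unfolding closed_in_def image_subset_iff by blast
  then show ?thesis
    using circle_least[of ?T v] w circle_refl[of v D] unfolding C_def by blast
qed

lemma rightmost_vertex:
  assumes "v \<in> V"
  obtains w where "w \<in> circle D v" "snd w = rightmost (circle D v)"
proof -
  have "finite (circle D v)" using finite_closed[OF closed_circle[OF assms]] .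
  then have "Max (snd ` circle D v) \<in> snd ` circle D v"
    using circle_refl[of v D] by (intro Max_in) auto
  then show ?thesis using that unfolding rightmost_def by (metis imageE)
qed

lemma right_count_beyond:
  assumes "finite C" "rightmost C \<le> snd w"
  shows "right_count C w = 0"
proof -
  have "k \<le> snd w" if "(fst w, k) \<in> C" for k
  proof -
    have "k \<in> snd ` C" using that by force
    from order_trans[OF Max_ge[OF finite_imageI[OF assms(1)] this] assms(2)[unfolded rightmost_def]]
    show ?thesis .
  qed
  then have "{k. snd w < k \<and> (fst w, k) \<in> C} = {}" by force
  then show ?thesis unfolding right_count_def by (metis card.empty)
qed

text \<open>The invariant is evaluated at a rightmost vertex, from which the ray meets
  nothing.\<close>

lemma circle_pos_parity:
  assumes "v \<in> V"
  shows "even (circle_pos \<xi> (circle D v)) \<longleftrightarrow> even (int (right_count (circle D v) v) + pos \<xi> (snd v))"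
proof -
  obtain w where w: "w \<in> circle D v" "snd w = rightmost (circle D v)"
    using rightmost_vertex[OF assms] .
  then show ?thesis
    using right_count_pos_const[OF assms w(1)]
      right_count_beyond[OF finite_closed[OF closed_circle[OF assms]], of w]
    by (simp add: circle_pos_def)
qed

lemma circle_inside_iff:
  assumes C: "closed_in \<xi> D C" and v: "v \<in> V" "v \<notin> C"
  shows "circle_inside (circle D v) C \<longleftrightarrow> odd (right_count C v)"
proof -
  have "circle_inside (circle D v) C \<longleftrightarrow> (\<forall>w \<in> circle D v. odd (right_count C w))"
    unfolding circle_inside_def right_count_def by (auto split: prod.splits)
  then show ?thesis
    using right_count_const[OF C v] circle_refl by blast
qed

text \<open>The ray from a rightmost vertex of one circle can meet the other circle only if that one
  reaches further to the right, which cannot hold both ways.\<close>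

lemma not_mutually_inside:
  assumes v: "v \<in> V" and w: "w \<in> V" and ne: "circle D v \<noteq> circle D w"
    and odd: "odd (right_count (circle D w) v)"
  shows "even (right_count (circle D v) w)"
proof -
  have d: "v \<notin> circle D w" "w \<notin> circle D v"
    using ne circle_disjoint[OF ne] circle_refl by blast+
  note cl = closed_circle[OF v] closed_circle[OF w]
  obtain v' where v': "v' \<in> circle D v" "snd v' = rightmost (circle D v)"
    using rightmost_vertex[OF v] .
  obtain w' where w': "w' \<in> circle D w" "snd w' = rightmost (circle D w)"
    using rightmost_vertex[OF w] .
  have "\<not> rightmost (circle D w) \<le> rightmost (circle D v)"
    using right_count_beyond[OF finite_closed[OF cl(2)], of v'] v' odd
      right_count_const[OF cl(2) v d(1) v'(1)] by auto
  then show ?thesis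
    using right_count_beyond[OF finite_closed[OF cl(1)], of w'] w'
      right_count_const[OF cl(1) w d(2) w'(1)] by auto
qed

end

section \<open>The effect of a surgery on circles\<close>

lemma outer_surgered [simp]: "outer (surgered D \<gamma>) v = outer D v"
  by (cases v; cases "fst v") (auto simp: surgered_def)

locale surgery_diagram = stacked_diagram +
  fixes i j :: int
  assumes connectable: "connectable D (i, j)"
begin

abbreviation "D' \<equiv> surgered D (i, j)"

lemma gamma: "(i, j) \<in> middle D"
  using connectable by (simp add: connectable_def)

lemma gamma_less: "i < j"
  using nc_matchingD(1)[OF mid gamma] .

lemma gamma_free: "i \<notin> verticals D" "j \<notin> verticals D"
  using nc_matchingD[OF mid gamma] by auto

lemma gamma_V: "(l, i) \<in> V" "(l, j) \<in> V"
  using nc_matchingD[OF mid gamma] by (auto simp: vertices_def)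

lemma odd_gamma: "odd (pos \<xi> i + pos \<xi> j)"
  using odd_width[of "(i, j)"] gamma by (simp add: arc_width_def)

lemma not_enclosed:
  assumes "(k, l) \<in> middle D" "k < i" "i < l"
  shows False
proof -
  have "k < j" "j < l"
    using mate_between[OF mid assms(1), of i] nc_matchingD[OF mid gamma] mate_eq[OF mid gamma] assms
    by auto
  then show False
    using connectable assms unfolding connectable_def by auto
qed

lemma not_enclosed_right:
  assumes "(k, l) \<in> middle D" "k \<le> j" "j < l"
  shows False
proof -
  have "k \<noteq> j" "k \<noteq> i"
    using mate_eq[OF mid gamma] mate_eq[OF mid assms(1)] gamma_less assms(3) by auto
  then consider "k < i" | "i < k" "k < j"
    using assms(2) by linarith
  then show False
  proof cases
    case 1
    then show False using not_enclosed[OF assms(1)] assms(3) gamma_less by auto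
  next
    case 2
    then show False using nc_matching_noncrossing[OF mid gamma assms(1)] assms(3) by auto
  qed
qed

lemma surgered_simps [simp]:
  "lower_cups D' = lower_cups D" "upper_caps D' = upper_caps D"
  "middle D' = middle D - {(i, j)}" "verticals D' = verticals D \<union> {i, j}"
  by (simp_all add: surgered_def)

lemma stacked_diagram_surgered: "stacked_diagram \<xi> D'"
proof
  have *: "stars \<xi> - verticals D' = stars \<xi> - verticals D - {i, j}"
    by auto
  show "nc_matching (stars \<xi> - verticals D') (middle D')"
    using nc_matching_remove[OF mid gamma] unfolding * by simp
  fix k l v assume kl: "(k, l) \<in> middle D'" and v: "v \<in> verticals D'"
  show "\<not> (k < v \<and> v < l)"
  proof
    assume kvl: "k < v \<and> v < l"
    consider "v \<in> verticals D" | "v = i" | "v = j" using v by auto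
    then show False
    proof cases
      case 1
      then show False using free[of k l v] kl kvl by simp
    next
      case 2
      then show False using not_enclosed[of k l] kl kvl by simp
    next
      case 3
      then show False using not_enclosed_right[of k l] kl kvl by simp
    qed
  qed
qed (use fin_stars lower upper verts gamma_V odd_width in \<open>auto simp: vertices_def\<close>)

sublocale after: stacked_diagram \<xi> D'
  by (rule stacked_diagram_surgered)

lemma inner_gamma:
  "inner D (l, i) = (l, j)" "inner D (l, j) = (l, i)"
  "inner D' (l, i) = (flip l, i)" "inner D' (l, j) = (flip l, j)"
  using gamma_free mate_eq[OF mid gamma] by simp_all

lemma inner_surgered:
  assumes "v \<in> V" "snd v \<notin> {i, j}"
  shows "inner D' v = inner D v"
  using assms mate_remove[OF mid gamma, of "snd v"]
  by (cases v) (auto simp: vertices_def)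

abbreviation "C1 \<equiv> circle D (Lower, i)"
abbreviation "C2 \<equiv> circle D (Upper, i)"
abbreviation "Ci \<equiv> circle D' (Lower, i)"
abbreviation "Cj \<equiv> circle D' (Lower, j)"

lemma closed_C [simp]:
  "closed_in \<xi> D C1" "closed_in \<xi> D C2" "closed_in \<xi> D' Ci" "closed_in \<xi> D' Cj"
  using closed_circle after.closed_circle gamma_V by auto

lemma ends_mem [simp]:
  "(Lower, i) \<in> C1" "(Lower, j) \<in> C1" "(Upper, i) \<in> C2" "(Upper, j) \<in> C2"
  "(Lower, i) \<in> Ci" "(Upper, i) \<in> Ci" "(Lower, j) \<in> Cj" "(Upper, j) \<in> Cj"
  using closed_in_iff(2)[OF closed_C(1) gamma_V(1)[of Lower]] closed_in_iff(2)[OF closed_C(2) gamma_V(1)[of Upper]]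
    after.closed_in_iff(2)[OF closed_C(3) gamma_V(1)[of Lower]]
    after.closed_in_iff(2)[OF closed_C(4) gamma_V(2)[of Lower]]
  by (simp_all add: inner_gamma circle_refl del: inner.simps)

lemma ends_mem_iff:
  "(Lower, j) \<in> circle D v \<longleftrightarrow> (Lower, i) \<in> circle D v"
  "(Upper, j) \<in> circle D v \<longleftrightarrow> (Upper, i) \<in> circle D v"
  "(Upper, i) \<in> circle D' v \<longleftrightarrow> (Lower, i) \<in> circle D' v"
  "(Upper, j) \<in> circle D' v \<longleftrightarrow> (Lower, j) \<in> circle D' v"
  using ends_mem circle_eq circle_refl by metis+

lemma end_cases: "snd v \<in> {i, j} \<Longrightarrow> v \<in> {(Lower, i), (Lower, j), (Upper, i), (Upper, j)}"
  by (cases v; cases "fst v") auto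

text \<open>The two \<open>inner\<close> involutions differ only on the four ends of the saddle,
  which both of them permute; a set containing all or none of these ends cannot tell the diagrams
  apart.\<close>

lemma closed_surgered_iff:
  assumes "{(Lower, i), (Lower, j), (Upper, i), (Upper, j)} \<subseteq> T \<or>
    {(Lower, i), (Lower, j), (Upper, i), (Upper, j)} \<inter> T = {}"
  shows "closed_in \<xi> D' T \<longleftrightarrow> closed_in \<xi> D T"
proof -
  have "inner D' v \<in> T \<longleftrightarrow> inner D v \<in> T" if "v \<in> T" "T \<subseteq> V" for v
  proof (cases "snd v \<in> {i, j}")
    case True
    then consider "v = (Lower, i)" | "v = (Lower, j)" | "v = (Upper, i)" | "v = (Upper, j)"
      using end_cases by blast
    then show ?thesis
      using that assms by cases (auto simp: inner_gamma simp del: inner.simps)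
  next
    case False
    then show ?thesis using inner_surgered[of v] that by auto
  qed
  then show ?thesis
    unfolding closed_in_def image_subset_iff outer_surgered by blast
qed

lemma circles_union: "Ci \<union> Cj = C1 \<union> C2"
proof
  have "closed_in \<xi> D' (C1 \<union> C2)"
    by (subst closed_surgered_iff) (simp_all add: closed_Un)
  then show "Ci \<union> Cj \<subseteq> C1 \<union> C2"
    using after.circle_least[of "C1 \<union> C2"] by simp
  have "closed_in \<xi> D (Ci \<union> Cj)"
    by (subst closed_surgered_iff[symmetric]) (simp_all add: after.closed_Un)
  then show "C1 \<union> C2 \<subseteq> Ci \<union> Cj"
    using circle_least[of "Ci \<union> Cj"] by simp
qed

lemma circle_surgered:
  assumes v: "v \<in> V" "v \<notin> C1 \<union> C2"
  shows "circle D' v = circle D v"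
proof
  have ne: "(Lower, i) \<notin> circle D v" "(Upper, i) \<notin> circle D v"
    using circle_eq[of "(Lower, i)" D v] circle_eq[of "(Upper, i)" D v] circle_refl[of v D] v by auto
  have "closed_in \<xi> D' (circle D v)"
    by (subst closed_surgered_iff) (simp_all add: ne ends_mem_iff closed_circle v)
  then show "circle D' v \<subseteq> circle D v"
    by (rule after.circle_least) (rule circle_refl)
  have v': "v \<notin> Ci \<union> Cj" using v circles_union by simp
  have ne': "(Lower, i) \<notin> circle D' v" "(Lower, j) \<notin> circle D' v"
    using circle_eq[of "(Lower, i)" D' v] circle_eq[of "(Lower, j)" D' v] circle_refl[of v D'] v' by auto
  have "closed_in \<xi> D (circle D' v)"
    by (subst closed_surgered_iff[symmetric]) (simp_all add: ne' ends_mem_iff after.closed_circle v)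
  then show "circle D v \<subseteq> circle D' v"
    by (rule circle_least) (rule circle_refl)
qed

definition rest :: "vertex set set" where
  "rest = circle D ` (V - (C1 \<union> C2))"

lemma rest_disjoint: "C \<in> rest \<Longrightarrow> C \<inter> (C1 \<union> C2) = {}"
  unfolding rest_def using circle_eq circle_refl by blast

lemma circles_eq: "circles \<xi> D = {C1, C2} \<union> rest" "circles \<xi> D' = {Ci, Cj} \<union> rest"
proof -
  have rest': "rest = circle D' ` (V - (C1 \<union> C2))"
    unfolding rest_def using circle_surgered by (intro image_cong) auto
  have *: "circle D v \<in> {C1, C2}" if "v \<in> C1 \<union> C2" for v
    using that circle_eq by blast
  have **: "circle D' v \<in> {Ci, Cj}" if "v \<in> C1 \<union> C2" for v
    using that circle_eq[of v D'] unfolding circles_union[symmetric] by blast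
  have V: "V = (V - (C1 \<union> C2)) \<union> (C1 \<union> C2)"
    using closed_C(1,2) by (auto simp: closed_in_def)
  have "circle D ` (C1 \<union> C2) = {C1, C2}"
    using * ends_mem(1,3) by (auto intro!: imageI)
  moreover have "circle D' ` (C1 \<union> C2) = {Ci, Cj}"
    using ** ends_mem(1,2) ends_mem(7) circles_union by (auto intro!: imageI)
  moreover have "circles \<xi> D = rest \<union> circle D ` (C1 \<union> C2)" "circles \<xi> D' = rest \<union> circle D' ` (C1 \<union> C2)"
    unfolding circles_def by (subst V, simp only: image_Un rest_def, subst V, simp only: image_Un rest')
  ultimately show "circles \<xi> D = {C1, C2} \<union> rest" "circles \<xi> D' = {Ci, Cj} \<union> rest"
    by (simp_all only: Un_commute)
qed

lemma not_in_rest: "C1 \<notin> rest" "C2 \<notin> rest" "Ci \<notin> rest" "Cj \<notin> rest"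
  using rest_disjoint[of C1] rest_disjoint[of C2] rest_disjoint[of Ci] rest_disjoint[of Cj]
    ends_mem circles_union by blast+

lemma finite_rest: "finite rest"
  unfolding rest_def using finite_V by simp

text \<open>Otherwise the part of \<open>C1\<close> connected to its left end would have an even number of vertices, all
  but one of which are paired by middle arcs and vertical lines.\<close>

lemma merge_circles:
  assumes "C1 \<noteq> C2"
  shows "Ci = Cj"
proof (rule ccontr)
  assume ne: "Ci \<noteq> Cj"
  let ?T = "C1 \<inter> Ci"
  have V: "?T \<subseteq> V" using closed_C(1) by (auto simp: closed_in_def)
  have fin: "finite ?T" using finite_closed[OF closed_C(1)] by simp
  have "even (card ?T)"
  proof (rule even_card_involution[where f = "outer D"])
    fix v assume v: "v \<in> ?T"
    then have "v \<in> V" using V by auto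
    then show "outer D v \<in> ?T \<and> outer D (outer D v) = v \<and> outer D v \<noteq> v"
      using v outer_props[of v] closed_in_iff(1)[OF closed_C(1)] after.closed_in_iff(1)[OF closed_C(3)]
      by simp
  qed (rule fin)
  moreover have "even (card (?T - {(Lower, i)}))"
  proof (rule even_card_involution[where f = "inner D"])
    fix v assume v: "v \<in> ?T - {(Lower, i)}"
    then have vV: "v \<in> V" using V by auto
    have "snd v \<notin> {i, j}"
    proof
      assume "snd v \<in> {i, j}"
      from end_cases[OF this] v consider "(Lower, j) \<in> Ci" | "(Upper, i) \<in> C1" | "(Upper, j) \<in> C1"
        by auto
      then show False
        using circle_eq ne assms ends_mem by cases metis+
    qed
    then have eq: "inner D' v = inner D v"
      using inner_surgered vV by blast
    have "inner D v \<noteq> (Lower, i)"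
    proof
      assume "inner D v = (Lower, i)"
      then have "v = (Lower, j)" using inner_props(2)[OF vV] inner_gamma(1) by metis
      then show False using \<open>snd v \<notin> {i, j}\<close> by simp
    qed
    moreover have "inner D v \<in> Ci"
      using after.closed_in_iff(2)[OF closed_C(3) vV] v eq by auto
    ultimately show "inner D v \<in> ?T - {(Lower, i)} \<and> inner D (inner D v) = v \<and> inner D v \<noteq> v"
      using v inner_props[OF vV] closed_in_iff(2)[OF closed_C(1) vV] by auto
  qed (use fin in simp)
  moreover have "(Lower, i) \<in> ?T" by simp
  ultimately show False
    using fin by (metis card_Suc_Diff1 even_Suc)
qed

text \<open>\<open>alternating_split\<close> is applied to \<open>u = (Lower, i)\<close> and
  \<open>w = (Upper, j)\<close>. Their colours agree because positions change parity from
  \<open>i\<close> to \<open>j\<close>, and the new vertical line at \<open>j\<close> joins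
  \<open>w\<close> to the former partner of \<open>u\<close>. The colouring rules out the
  reconnection that would leave a single circle.\<close>

lemma split_circles:
  assumes "C1 = C2"
  shows "Ci \<noteq> Cj"
proof -
  have "\<exists>T \<subseteq> V. outer D ` T \<subseteq> T \<and> inner D' ` T \<subseteq> T \<and> (Upper, j) \<in> T \<and> (Lower, i) \<notin> T"
  proof (rule alternating_split[where colour = colour and b = "inner D"])
    show "(Lower, i) \<noteq> (Upper, j)" by simp
    show "colour (Lower, i) = colour (Upper, j)"
      using odd_gamma by (auto simp: colour_def)
    show "inner D' (Upper, j) = inner D (Lower, i)"
      by (simp add: inner_gamma del: inner.simps)
    fix v assume "v \<in> V" "v \<notin> {(Lower, i), (Upper, j), inner D (Lower, i), inner D (Upper, j)}"
    then have "snd v \<notin> {i, j}"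
      using end_cases[of v] by (auto simp: inner_gamma simp del: inner.simps)
    then show "inner D' v = inner D v"
      using inner_surgered \<open>v \<in> V\<close> by blast
  next
    fix T assume "T \<subseteq> V" "outer D ` T \<subseteq> T" "inner D ` T \<subseteq> T" "(Lower, i) \<in> T"
    then show "(Upper, j) \<in> T"
      using circle_least[of T "(Lower, i)"] assms ends_mem(4) by (auto simp: closed_in_def simp del: inner.simps)
  qed (use finite_V outer_props inner_props colour_outer colour_inner after.inner_props after.colour_inner
      gamma_V in \<open>simp_all del: inner.simps\<close>)
  then obtain T where T: "closed_in \<xi> D' T" "(Upper, j) \<in> T" "(Lower, i) \<notin> T"
    unfolding closed_in_def by auto
  then have "circle D' (Upper, j) \<subseteq> T"
    using after.circle_least by blast
  then have "(Lower, i) \<notin> Cj"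
    using T(3) circle_eq[OF ends_mem(8)] by auto
  then show ?thesis using ends_mem(5) by auto
qed

text \<open>The source of the split count: as the number of circles moves by one per surgery, its
  initial and final values determine how many surgeries were splits.\<close>

lemma card_circles:
  "C1 \<noteq> C2 \<Longrightarrow> card (circles \<xi> D) = card (circles \<xi> D') + 1"
  "C1 = C2 \<Longrightarrow> card (circles \<xi> D') = card (circles \<xi> D) + 1"
  unfolding circles_eq using merge_circles split_circles not_in_rest finite_rest by auto

section \<open>Parities of circle positions around a saddle\<close>

lemma right_count_Un:
  assumes "finite A" "finite B" "A \<inter> B = {}"
  shows "right_count (A \<union> B) v = right_count A v + right_count B v"
proof -
  have "{k. snd v < k \<and> (fst v, k) \<in> A \<union> B} =
      {k. snd v < k \<and> (fst v, k) \<in> A} \<union> {k. snd v < k \<and> (fst v, k) \<in> B}" by auto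
  then show ?thesis
    unfolding right_count_def
    by (simp only:) (rule card_Un_disjoint[OF finite_line finite_line, OF assms(1,2)], use assms(3) in blast)
qed

lemma finite_C [simp]: "finite C1" "finite C2" "finite Ci" "finite Cj"
  using finite_closed after.finite_closed closed_C by blast+

text \<open>Although \<open>(i, j)\<close> is no longer an arc of the surgered diagram, the vertices
  strictly below it are still paired by the old middle arcs, as no vertical line ends there.\<close>

lemma right_count_gamma:
  assumes "closed_in \<xi> D' T"
  shows "even (right_count T (l, i) + right_count T (l, j)) \<longleftrightarrow> (l, j) \<notin> T"
proof -
  have "even (card {k. i < k \<and> k \<in> {k. (l, k) \<in> T}} + card {k. j < k \<and> k \<in> {k. (l, k) \<in> T}})
      \<longleftrightarrow> j \<notin> {k. (l, k) \<in> T}"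
  proof (rule line_parity[OF mid _ gamma])
    show "finite {k. (l, k) \<in> T}"
      using finite_line[OF after.finite_closed[OF assms], of "\<lambda>_. True" l] by simp
    fix x assume x: "x \<in> {k. (l, k) \<in> T}" "i < x" "x < j"
    then have xV: "(l, x) \<in> V" using assms by (auto simp: closed_in_def)
    have xn: "x \<notin> verticals D" using free[OF gamma, of x] x by auto
    have "inner D (l, x) \<in> T"
      using after.closed_in_iff(2)[OF assms xV] inner_surgered[OF xV] x by (auto simp del: inner.simps)
    then show "x \<in> stars \<xi> - verticals D \<and> mate (middle D) x \<in> {k. (l, k) \<in> T}"
      using xV xn by (simp add: vertices_def)
  qed
  then show ?thesis by (simp add: right_count_def)
qed

lemma merge_right_counts:
  assumes "C1 \<noteq> C2"
  shows "odd (right_count C1 (Lower, i) + right_count C1 (Upper, i))" (is ?a)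
    "odd (right_count C2 (Lower, i) + right_count C2 (Upper, i))" (is ?b)
    "even (right_count C1 (Upper, i)) \<or> even (right_count C2 (Lower, i))" (is ?c)
    "circle_inside C1 C2 \<longleftrightarrow> odd (right_count C2 (Lower, i))" (is ?d)
    "circle_inside C2 C1 \<longleftrightarrow> odd (right_count C1 (Upper, i))" (is ?e)
proof -
  have d: "(Lower, i) \<notin> C2" "(Upper, i) \<notin> C1"
    using circle_disjoint[OF assms] ends_mem by blast+
  have 1: "even (right_count T (l, i) + right_count T (l, j)) \<longleftrightarrow> (l, i) \<notin> T" if "closed_in \<xi> D T" for l T
    using right_count_inner[OF that gamma_V(1)[of l]] gamma_free by (simp add: inner_gamma del: inner.simps)
  \<comment> \<open>A middle arc passing over \<open>j\<close> to the right of it would enclose or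
    cross \<open>(i, j)\<close>. So the parity is carried from one line to the other at
    \<open>j\<close>, and the cap and cup of the saddle carry it on to \<open>i\<close>.\<close>
  have 2: "even (right_count T (Lower, j) + right_count T (Upper, j))" if "closed_in \<xi> D T" for T
    using right_count_lines[OF that, of j] not_enclosed_right by blast
  show ?a
    using 1[of C1 Lower] 1[of C1 Upper] 2[of C1] d by simp
  show ?b
    using 1[of C2 Lower] 1[of C2 Upper] 2[of C2] d by simp
  show ?c
    using not_mutually_inside[OF gamma_V(1) gamma_V(1) assms] by blast
  show ?d
    ?e
    using circle_inside_iff gamma_V d by simp_all
qed

text \<open>The ray from \<open>(Lower, i)\<close> meets the merged circle in the points of
  \<open>C1\<close> and those of \<open>C2\<close>. Modulo 2 the chains of equivalences say that
  each \<open>t\<close> is \<open>p(i) + 1\<close>, plus 1 for a circle enclosing the other one, and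
  plus 1 for the merged circle of a nested pair.\<close>

lemma merge_parity:
  assumes "C1 \<noteq> C2"
  shows "\<not> (circle_inside C1 C2 \<and> circle_inside C2 C1)" (is ?a)
    "even (circle_pos \<xi> C1) \<longleftrightarrow> even (pos \<xi> i) \<longleftrightarrow> circle_inside C2 C1" (is ?b)
    "even (circle_pos \<xi> C2) \<longleftrightarrow> even (pos \<xi> i) \<longleftrightarrow> circle_inside C1 C2" (is ?c)
    "even (circle_pos \<xi> Ci) \<longleftrightarrow> even (pos \<xi> i) \<longleftrightarrow> circle_inside C1 C2 \<or> circle_inside C2 C1" (is ?d)
proof -
  note r = merge_right_counts[OF assms]
  have "Ci = C1 \<union> C2" using circles_union merge_circles[OF assms] by simp
  then have "right_count Ci (Lower, i) = right_count C1 (Lower, i) + right_count C2 (Lower, i)"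
    using right_count_Un[OF _ _ circle_disjoint[OF assms]] by simp
  then show ?a ?b ?c ?d
    using r circle_pos_parity[OF gamma_V(1)[of Lower]] circle_pos_parity[OF gamma_V(1)[of Upper]]
      after.circle_pos_parity[OF gamma_V(1)[of Lower]] by auto
qed

text \<open>Now the ends \<open>i\<close> and \<open>j\<close> lie on different circles, and their
  positions differ in parity. Modulo 2 each \<open>t\<close> is \<open>p(i)\<close>, plus 1 for an
  enclosing circle, and plus 1 for the old circle if the new ones are nested.\<close>

lemma split_parity:
  assumes "C1 = C2"
  shows "\<not> (circle_inside Ci Cj \<and> circle_inside Cj Ci)" (is ?a)
    "even (circle_pos \<xi> Ci) \<longleftrightarrow> even (pos \<xi> i) \<longleftrightarrow> \<not> circle_inside Cj Ci" (is ?b)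
    "even (circle_pos \<xi> Cj) \<longleftrightarrow> even (pos \<xi> i) \<longleftrightarrow> \<not> circle_inside Ci Cj" (is ?c)
    "even (circle_pos \<xi> C1) \<longleftrightarrow> even (pos \<xi> i) \<longleftrightarrow> \<not> (circle_inside Ci Cj \<or> circle_inside Cj Ci)" (is ?d)
proof -
  note ne = split_circles[OF assms]
  have d: "(Lower, i) \<notin> Cj" "(Lower, j) \<notin> Ci"
    using circle_disjoint[OF ne] ends_mem by blast+
  have ij: "circle_inside Ci Cj \<longleftrightarrow> odd (right_count Cj (Lower, i))"
    and ji: "circle_inside Cj Ci \<longleftrightarrow> odd (right_count Ci (Lower, j))"
    using after.circle_inside_iff gamma_V d by simp_all
  have "even (right_count Ci (Lower, i) + right_count Ci (Lower, j))"
    "odd (right_count Cj (Lower, i) + right_count Cj (Lower, j))"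
    using right_count_gamma[of Ci Lower] right_count_gamma[of Cj Lower] d by simp_all
  moreover have "right_count C1 (Lower, i) = right_count Ci (Lower, i) + right_count Cj (Lower, i)"
    using right_count_Un[OF _ _ circle_disjoint[OF ne]] circles_union assms by simp
  moreover have "even (right_count Cj (Lower, i)) \<or> even (right_count Ci (Lower, j))"
    using after.not_mutually_inside[OF gamma_V(1) gamma_V(2) ne] by blast
  ultimately show ?a ?b ?c ?d
    using ij ji circle_pos_parity[OF gamma_V(1)[of Lower]] after.circle_pos_parity[OF gamma_V(1)[of Lower]]
      after.circle_pos_parity[OF gamma_V(2)[of Lower]] odd_gamma by auto
qed

end

section \<open>Circle widths before and after a surgery\<close>

context stacked_diagram
begin

lemma finite_arcs: "finite (lower_cups D)" "finite (upper_caps D)" "finite (middle D)"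
  using nc_matching_finite lower upper mid fin_stars by auto

lemma circle_width_Un:
  assumes "A \<inter> B = {}"
  shows "circle_width \<xi> D (A \<union> B) = circle_width \<xi> D A + circle_width \<xi> D B"
proof -
  have "(\<Sum>\<gamma> | \<gamma> \<in> M \<and> (l, fst \<gamma>) \<in> A \<union> B. arc_width \<xi> \<gamma>) =
    (\<Sum>\<gamma> | \<gamma> \<in> M \<and> (l, fst \<gamma>) \<in> A. arc_width \<xi> \<gamma>) + (\<Sum>\<gamma> | \<gamma> \<in> M \<and> (l, fst \<gamma>) \<in> B. arc_width \<xi> \<gamma>)"
    if "finite M" for M l
  proof -
    have "{\<gamma>. \<gamma> \<in> M \<and> (l, fst \<gamma>) \<in> A \<union> B} = {\<gamma>. \<gamma> \<in> M \<and> (l, fst \<gamma>) \<in> A} \<union> {\<gamma>. \<gamma> \<in> M \<and> (l, fst \<gamma>) \<in> B}"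
      by auto
    then show ?thesis
      using that assms by (simp add: sum.union_disjoint disjoint_iff)
  qed
  then show ?thesis
    using finite_arcs by (simp add: circle_width_def)
qed

end

context surgery_diagram
begin

lemma sum_middle_surgered:
  "(\<Sum>\<gamma> | \<gamma> \<in> middle D \<and> (l, fst \<gamma>) \<in> T. arc_width \<xi> \<gamma>) =
   (\<Sum>\<gamma> | \<gamma> \<in> middle D' \<and> (l, fst \<gamma>) \<in> T. arc_width \<xi> \<gamma>) +
     (if (l, i) \<in> T then arc_width \<xi> (i, j) else 0)"
proof (cases "(l, i) \<in> T")
  case True
  then have "{\<gamma>. \<gamma> \<in> middle D \<and> (l, fst \<gamma>) \<in> T} = insert (i, j) {\<gamma>. \<gamma> \<in> middle D' \<and> (l, fst \<gamma>) \<in> T}"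
    using gamma by auto
  then show ?thesis
    using True finite_arcs by simp
next
  case False
  then have "{\<gamma>. \<gamma> \<in> middle D \<and> (l, fst \<gamma>) \<in> T} = {\<gamma>. \<gamma> \<in> middle D' \<and> (l, fst \<gamma>) \<in> T}"
    by auto
  then show ?thesis using False by simp
qed

lemma circle_width_surgered:
  "circle_width \<xi> D T = circle_width \<xi> D' T + (if (Lower, i) \<in> T then arc_width \<xi> (i, j) else 0) +
     (if (Upper, i) \<in> T then arc_width \<xi> (i, j) else 0)"
  unfolding circle_width_def using sum_middle_surgered[of Lower T] sum_middle_surgered[of Upper T]
  by simp

lemma circle_width_rest: "C \<in> rest \<Longrightarrow> circle_width \<xi> D' C = circle_width \<xi> D C"
  using rest_disjoint[of C] ends_mem by (auto simp: circle_width_surgered)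

lemma circle_width_merge:
  "C1 \<noteq> C2 \<Longrightarrow> circle_width \<xi> D' Ci = circle_width \<xi> D C1 + circle_width \<xi> D C2 - 2 * arc_width \<xi> (i, j)"
  using circle_width_surgered[of "C1 \<union> C2"] circle_width_Un[OF circle_disjoint[of D "(Lower, i)" "(Upper, i)"]]
    circles_union merge_circles by simp

lemma circle_width_split:
  "C1 = C2 \<Longrightarrow> circle_width \<xi> D' Ci + circle_width \<xi> D' Cj = circle_width \<xi> D C1 - 2 * arc_width \<xi> (i, j)"
  using circle_width_surgered[of C1] after.circle_width_Un[OF circle_disjoint[of D' "(Lower, i)" "(Lower, j)"]]
    circles_union split_circles ends_mem(1,3) by simp

end

section \<open>Circle widths modulo 4\<close>

lemma sum_involution_eq_0:
  fixes h :: "'a \<Rightarrow> int"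
  assumes "\<And>x. x \<in> X \<Longrightarrow> f x \<in> X \<and> f (f x) = x \<and> h (f x) = - h x"
  shows "sum h X = 0"
proof -
  have "sum h X = (\<Sum>x\<in>X. - h x)"
    by (rule sum.reindex_bij_witness[of _ f f]) (use assms in auto)
  then show ?thesis by (simp add: sum_negf)
qed

text \<open>An abstract meander: points ordered by \<open>r\<close> on a line, joined by noncrossing
  arcs on either side, one matching for each side. The values \<open>P\<close> are kept apart from
  the order, so that points can be removed without renumbering; \<open>arcs_on\<close> retains only
  that \<open>P\<close> changes parity along arcs.\<close>

definition arc_sum :: "('a \<Rightarrow> int) \<Rightarrow> ('a \<Rightarrow> int) \<Rightarrow> ('a \<Rightarrow> 'a) \<Rightarrow> 'a set \<Rightarrow> int" where
  "arc_sum r P f X = (\<Sum>x\<in>X. if r x < r (f x) then P (f x) - P x else 0)"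

definition arcs_on :: "('a \<Rightarrow> int) \<Rightarrow> ('a \<Rightarrow> int) \<Rightarrow> ('a \<Rightarrow> 'a) \<Rightarrow> 'a set \<Rightarrow> bool" where
  "arcs_on r P f X \<longleftrightarrow> (\<forall>x\<in>X. f x \<in> X \<and> f (f x) = x \<and> odd (P (f x) - P x)) \<and>
     (\<forall>x\<in>X. \<forall>y\<in>X. \<not> (r x < r y \<and> r y < r (f x) \<and> r (f x) < r (f y)))"

lemma arc_sum_remove:
  assumes "finite X" "x \<in> X" "f x \<in> X" "f (f x) = x" "r x \<noteq> r (f x)"
  shows "arc_sum r P f X = arc_sum r P f (X - {x, f x}) +
    (if r x < r (f x) then P (f x) - P x else P x - P (f x))"
proof -
  have "x \<noteq> f x" using assms(5) by auto
  then have "X = insert x (insert (f x) (X - {x, f x}))" using assms by auto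
  then have "arc_sum r P f X = arc_sum r P f (insert x (insert (f x) (X - {x, f x})))" by simp
  also have "\<dots> = (if r x < r (f x) then P (f x) - P x else P x - P (f x)) + arc_sum r P f (X - {x, f x})"
    unfolding arc_sum_def using assms \<open>x \<noteq> f x\<close> by (subst sum.insert; simp)+
  finally show ?thesis by simp
qed

text \<open>The eight placements arise by exchanging the two ends of either arc and the two
  arcs.\<close>

lemma arcs_on_noncrossing:
  assumes "arcs_on r P f X" "x \<in> X" "y \<in> X"
  shows "\<not> (r x < r y \<and> r y < r (f x) \<and> r (f x) < r (f y))"
    "\<not> (r y < r x \<and> r x < r (f y) \<and> r (f y) < r (f x))"
    "\<not> (r (f x) < r y \<and> r y < r x \<and> r x < r (f y))"
    "\<not> (r y < r (f x) \<and> r (f x) < r (f y) \<and> r (f y) < r x)"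
    "\<not> (r x < r (f y) \<and> r (f y) < r (f x) \<and> r (f x) < r y)"
    "\<not> (r (f y) < r x \<and> r x < r y \<and> r y < r (f x))"
    "\<not> (r (f x) < r (f y) \<and> r (f y) < r x \<and> r x < r y)"
    "\<not> (r (f y) < r (f x) \<and> r (f x) < r y \<and> r y < r x)"
  using assms unfolding arcs_on_def by metis+

text \<open>
  If a curve is not just a pair of arcs with the same ends, it contains an arc \<open>f\<close> joining
  neighbouring points. Straightening the zigzag (or spiral) formed by this arc and the two arcs next
  to it changes the total width by a multiple of 4.
\<close>

lemma arc_sum_connected:
  assumes "finite X" "X \<noteq> {}" "inj_on r X" "arcs_on r P f X" "arcs_on r P g X"
    and "\<And>T. T \<subseteq> X \<Longrightarrow> T \<noteq> {} \<Longrightarrow> f ` T \<subseteq> T \<Longrightarrow> g ` T \<subseteq> T \<Longrightarrow> T = X"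
  shows "4 dvd arc_sum r P f X + arc_sum r P g X - 2"
  using assms
proof (induction "card X" arbitrary: X g rule: less_induct)
  case less
  note fin = less.prems(1) and inj = less.prems(3) and af = less.prems(4) and ag = less.prems(5)
    and conn = less.prems(6)
  have f: "f x \<in> X" "f (f x) = x" "odd (P (f x) - P x)" and g: "g x \<in> X" "g (g x) = x" "odd (P (g x) - P x)"
    if "x \<in> X" for x
    using af ag that unfolding arcs_on_def by auto
  have r_eq: "r x = r y \<longleftrightarrow> x = y" if "x \<in> X" "y \<in> X" for x y
    using inj_on_eq_iff[OF inj] that by simp
  have fn: "f x \<noteq> x" and gn: "g x \<noteq> x" if "x \<in> X" for x
    using f[OF that] g[OF that] by auto
  let ?L = "{x \<in> X. r x < r (f x)}"
  obtain x0 where "x0 \<in> X" using less.prems(2) by auto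
  then have "x0 \<in> ?L \<or> f x0 \<in> ?L"
    using f[of x0] fn[of x0] r_eq[of x0 "f x0"] by auto
  then have "?L \<noteq> {}" by blast
  moreover have finL: "finite ?L" using fin by simp
  \<comment> \<open>An arc of minimal length in the order \<open>r\<close> joins neighbours, since a
    point below it would belong to a shorter arc below it.\<close>
  ultimately obtain i where i: "i \<in> ?L" and min: "\<And>x. x \<in> ?L \<Longrightarrow> r (f i) - r i \<le> r (f x) - r x"
    using arg_min_if_finite(1)[of ?L "\<lambda>x. r (f x) - r x"] arg_min_least[of ?L _ "\<lambda>x. r (f x) - r x"] finL
    by blast
  define j where "j = f i"
  have ij: "i \<in> X" "j \<in> X" "r i < r j" "f j = i" "i \<noteq> j" "odd (P j - P i)"
    using i f[of i] fn[of i] by (auto simp: j_def)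
  have adjacent: "r y < r i \<or> r j < r y" if y: "y \<in> X" "y \<noteq> i" "y \<noteq> j" for y
  proof (rule ccontr)
    assume "\<not> ?thesis"
    then have b: "r i < r y" "r y < r j" using r_eq[of y i] r_eq[of y j] y ij by auto
    have fy: "f y \<in> X" "f y \<noteq> i" "f y \<noteq> j" "f (f y) = y" "f y \<noteq> y"
      using f[OF y(1)] fn[OF y(1)] y(2,3) ij(4) j_def by metis+
    have "r i < r (f y)" "r (f y) < r j"
      using arcs_on_noncrossing(1,6)[OF af ij(1) y(1)] b r_eq[OF fy(1) ij(1)] r_eq[OF fy(1) ij(2)] fy(2,3)
      unfolding j_def[symmetric] by auto
    moreover consider "y \<in> ?L" | "f y \<in> ?L"
      using fy y r_eq[OF fy(1) y(1)] by fastforce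
    ultimately show False
      using min[of y] min[of "f y"] b fy unfolding j_def[symmetric] by cases auto
  qed
  show ?case
  proof (cases "g i = j")
    case True
    then have gj: "g j = i" using g(2)[OF ij(1)] by simp
    \<comment> \<open>The curve consists of two arcs with the same ends. Its total width is twice
      the odd number \<open>P j - P i\<close>, hence 2 modulo 4.\<close>
    have X: "{i, j} = X"
      by (rule conn) (use True gj ij j_def in auto)
    have e: "X - {i, j} = {}" using X by auto
    have "arc_sum r P f X = P j - P i"
      using arc_sum_remove[OF fin ij(1), of f r P] f[OF ij(1)] ij e unfolding j_def[symmetric]
      by (simp add: arc_sum_def)
    moreover have "arc_sum r P g X = P j - P i"
      using arc_sum_remove[OF fin ij(1), of g r P] g[OF ij(1)] ij e True by (simp add: arc_sum_def)
    moreover obtain m where "P j - P i = 2 * m + 1" using ij(6) oddE by blast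
    ultimately show ?thesis by simp
  next
    case False
    define i' where "i' = g i"
    define j' where "j' = g j"
    have i'j': "i' \<in> X" "j' \<in> X" "g i' = i" "g j' = j" "i' \<noteq> j'" "i' \<noteq> i" "i' \<noteq> j" "j' \<noteq> i" "j' \<noteq> j"
      using g gn ij False unfolding i'_def j'_def by metis+
    have odd: "odd (P i' - P i)" "odd (P j' - P j)"
      using g(3) ij by (simp_all add: i'_def j'_def)
    \<comment> \<open>The points \<open>i\<close> and \<open>j\<close> are removed, and the two arcs
      of \<open>g\<close> ending there are joined to a single arc from \<open>i'\<close> to
      \<open>j'\<close>. The matching \<open>f\<close> is merely restricted.\<close>
    define Y where "Y = X - {i, j}"
    define h where "h y = (if y = i' then j' else if y = j' then i' else g y)" for y
    have YX: "Y \<subset> X" using ij(1) by (auto simp: Y_def)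
    then have cardY: "card Y < card X" "finite Y"
      using psubset_card_mono[OF fin] finite_subset[OF _ fin] by auto
    have YX: "Y \<subseteq> X" using YX by auto
    have i'Y: "i' \<in> Y" "j' \<in> Y" using i'j' by (auto simp: Y_def)
    have h_i': "h i' = j'" "h j' = i'" using i'j' by (simp_all add: h_def)
    have h_other: "h y = g y" "g y \<in> Y" "g y \<noteq> i'" "g y \<noteq> j'" if "y \<in> Y" "y \<noteq> i'" "y \<noteq> j'" for y
      using that g[of y] i'j' g(2)[OF ij(1)] g(2)[OF ij(2)] unfolding Y_def h_def i'_def j'_def by auto
    have af': "arcs_on r P f Y"
    proof -
      have "f y \<in> Y" if "y \<in> Y" for y
        using that f[of y] ij j_def unfolding Y_def by (metis Diff_iff insert_iff singletonD)
      then show ?thesis using af YX unfolding arcs_on_def by blast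
    qed
    have ah: "arcs_on r P h Y"
      unfolding arcs_on_def
    proof (intro conjI ballI)
      fix y assume y: "y \<in> Y"
      consider "y = i'" | "y = j'" | "y \<noteq> i'" "y \<noteq> j'" by blast
      then show "h y \<in> Y" "h (h y) = y" "odd (P (h y) - P y)"
        using i'Y h_i' h_other[OF y] odd ij(6) y YX g[of y] by (cases; auto simp: h_def)+
    next
      fix x y assume xy: "x \<in> Y" "y \<in> Y"
      \<comment> \<open>As \<open>i\<close> and \<open>j\<close> are neighbours, every remaining
        point is on the same side of both. So an arc crossing the joined arc would already cross one
        of the two arcs at \<open>i\<close> and \<open>j\<close>.\<close>
      have ord: "r z < r i \<and> r z < r j \<or> r i < r z \<and> r j < r z" if "z \<in> Y" for z
        using adjacent[of z] ij(3) that unfolding Y_def by auto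
      have nci: "\<not> (r u < r i \<and> r i < r (g u) \<and> (r i' < r u \<or> r (g u) < r i'))"
        "\<not> (r u < r i' \<and> r i' < r (g u) \<and> (r i < r u \<or> r (g u) < r i))"
        "\<not> (r u < r j \<and> r j < r (g u) \<and> (r j' < r u \<or> r (g u) < r j'))"
        "\<not> (r u < r j' \<and> r j' < r (g u) \<and> (r j < r u \<or> r (g u) < r j))" if "u \<in> X" for u
        using arcs_on_noncrossing(1,6)[OF ag that ij(1)] arcs_on_noncrossing(1,6)[OF ag that ij(2)]
          arcs_on_noncrossing(1,6)[OF ag that i'j'(1)] arcs_on_noncrossing(1,6)[OF ag that i'j'(2)]
        unfolding i'j'(3,4) i'_def[symmetric] j'_def[symmetric] by argo+
      have key: "\<not> (r u < r i' \<and> r i' < r (g u) \<and> (r j' < r u \<or> r (g u) < r j'))"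
        "\<not> (r u < r j' \<and> r j' < r (g u) \<and> (r i' < r u \<or> r (g u) < r i'))"
        if u: "u \<in> Y" "u \<noteq> i'" "u \<noteq> j'" for u
      proof -
        have uX: "u \<in> X" using u YX by auto
        note o = ord[OF u(1)] ord[OF h_other(2)[OF u]]
        show "\<not> (r u < r i' \<and> r i' < r (g u) \<and> (r j' < r u \<or> r (g u) < r j'))"
          "\<not> (r u < r j' \<and> r j' < r (g u) \<and> (r i' < r u \<or> r (g u) < r i'))"
          using nci[OF uX] o by (smt (verit))+
      qed
      show "\<not> (r x < r y \<and> r y < r (h x) \<and> r (h x) < r (h y))"
      proof (cases "x \<in> {i', j'}")
        case True
        then show ?thesis
        proof (cases "y \<in> {i', j'}")
          case True
          then show ?thesis using \<open>x \<in> {i', j'}\<close> h_i' by auto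
        next
          case False
          then have hy: "h y = g y" and "y \<noteq> i'" "y \<noteq> j'" using h_other[OF xy(2)] by auto
          have "g y \<in> Y" "g y \<noteq> i'" "g y \<noteq> j'" using h_other[OF xy(2)] False by auto
          then show ?thesis using True h_i' key[OF xy(2)] False hy by auto
        qed
      next
        case False
        then have hx: "h x = g x" using h_other[OF xy(1)] by auto
        show ?thesis
        proof (cases "y \<in> {i', j'}")
          case True
          then show ?thesis using h_i' key[OF xy(1)] False hx by auto
        next
          case False
          then have "h y = g y" using h_other[OF xy(2)] by auto
          then show ?thesis using hx arcs_on_noncrossing(1)[OF ag] xy YX by auto
        qed
      qed
    qed
    have "4 dvd arc_sum r P f Y + arc_sum r P h Y - 2"
    proof (rule less.hyps[OF cardY(1,2) _ _ af' ah])
      show "Y \<noteq> {}" using i'Y by auto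
      show "inj_on r Y" using inj_on_subset[OF inj YX] .
      fix T assume T: "T \<subseteq> Y" "T \<noteq> {}" "f ` T \<subseteq> T" "h ` T \<subseteq> T"
      \<comment> \<open>A set closed for the shortened curve becomes closed for the original one by
        reinserting \<open>i\<close> and \<open>j\<close> if it contains the joined arc; thus
        connectedness passes from \<open>X\<close> to \<open>Y\<close>.\<close>
      define T' where "T' = T \<union> (if i' \<in> T then {i, j} else {})"
      have ij': "i' \<in> T \<longleftrightarrow> j' \<in> T" using T(4) h_i' by (metis image_subset_iff)
      have "T' = X"
      proof (rule conn)
        show "T' \<subseteq> X" "T' \<noteq> {}" using T YX ij by (auto simp: T'_def)
        show "f ` T' \<subseteq> T'" using T(3) ij j_def by (auto simp: T'_def)
        have "g y \<in> T'" if y: "y \<in> T" for y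
        proof (cases "y \<in> {i', j'}")
          case True
          then show ?thesis using y i'j'(3,4) ij' unfolding T'_def by auto
        next
          case False
          then have "h y = g y" using h_other(1)[of y] y T(1) by auto
          then show ?thesis using y T(4) unfolding T'_def by (metis UnI1 image_subset_iff)
        qed
        moreover have "g i \<in> T'" "g j \<in> T'" if "i' \<in> T"
          using that ij' unfolding T'_def i'_def j'_def by auto
        moreover have "y \<in> T \<or> i' \<in> T \<and> (y = i \<or> y = j)" if "y \<in> T'" for y
          using that unfolding T'_def by (auto split: if_splits)
        ultimately show "g ` T' \<subseteq> T'" by blast
      qed
      then show "T = Y" using T(1) unfolding T'_def Y_def by (auto split: if_splits)
    qed
    moreover have "arc_sum r P f X = arc_sum r P f Y + (P j - P i)"
      using arc_sum_remove[OF fin ij(1), of f r P] f[OF ij(1)] ij unfolding j_def[symmetric] Y_def by simp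
    moreover have "4 dvd arc_sum r P g X + (P j - P i) - arc_sum r P h Y"
    proof -
      let ?w = "\<lambda>x y. if r x < r y then P y - P x else P x - P y"
      have 1: "arc_sum r P g X = arc_sum r P g (X - {i, i'}) + ?w i i'"
        using arc_sum_remove[OF fin ij(1), of g r P] g[OF ij(1)] r_eq[OF ij(1) i'j'(1)] i'j'
        unfolding i'_def by auto
      have 2: "arc_sum r P g (X - {i, i'}) = arc_sum r P g (X - {i, i'} - {j, j'}) + ?w j j'"
        using arc_sum_remove[of "X - {i, i'}" j g r P] fin g[OF ij(2)] r_eq[OF ij(2) i'j'(2)] i'j' ij
        unfolding j'_def[symmetric] by auto
      have 3: "arc_sum r P h Y = arc_sum r P h (Y - {i', j'}) + ?w i' j'"
        using arc_sum_remove[of Y i' h r P] cardY(2) i'Y h_i' r_eq[OF i'j'(1,2)] i'j'(5) by auto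
      have 4: "X - {i, i'} - {j, j'} = Y - {i', j'}" by (auto simp: Y_def)
      have 5: "arc_sum r P h (Y - {i', j'}) = arc_sum r P g (Y - {i', j'})"
        unfolding arc_sum_def by (rule sum.cong) (use h_other in auto)
      obtain a b c where abc: "P j - P i = 2 * a + 1" "P i' - P i = 2 * b + 1" "P j' - P j = 2 * c + 1"
        using odd ij(6) by (metis oddE)
      have adj: "r i' < r i \<or> r j < r i'" "r j' < r i \<or> r j < r j'"
        using adjacent i'j' by auto
      \<comment> \<open>As the arcs at \<open>i\<close> and \<open>j\<close> do not cross, only a
        zigzag and two spirals remain. Straightening the zigzag does not change the total width; for
        a spiral the change is a multiple of 4 because the three widths involved are odd.\<close>
      have nc: "\<not> (r i' < r j' \<and> r j' < r i)" "\<not> (r j < r i' \<and> r i' < r j')"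
        "\<not> (r j' < r i \<and> r j < r i')"
        using arcs_on_noncrossing[OF ag ij(1,2)] ij(3) unfolding i'_def[symmetric] j'_def[symmetric]
        by linarith+
      have "r i' \<noteq> r j'" using r_eq i'j' by auto
      then consider "r i' < r i" "r j < r j'" | "r j < r j'" "r j' < r i'" | "r j' < r i'" "r i' < r i"
        using adj nc by linarith
      then have "4 dvd (P j - P i) + ?w i i' + ?w j j' - ?w i' j'"
      proof cases
        case 1
        then have "(P j - P i) + ?w i i' + ?w j j' - ?w i' j' = 0" using ij(3) by simp
        then show ?thesis by simp
      next
        case 2
        then have "(P j - P i) + ?w i i' + ?w j j' - ?w i' j' = 4 * (a + c + 1)" using ij(3) abc by simp
        then show ?thesis by simp
      next
        case 3
        then have "(P j - P i) + ?w i i' + ?w j j' - ?w i' j' = 4 * (a - b)" using ij(3) abc by simp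
        then show ?thesis by simp
      qed
      moreover have "arc_sum r P g X + (P j - P i) - arc_sum r P h Y = (P j - P i) + ?w i i' + ?w j j' - ?w i' j'"
        unfolding 1 2 3 4 5 by simp
      ultimately show ?thesis by (simp only:)
    qed
    ultimately have "4 dvd (arc_sum r P f Y + arc_sum r P h Y - 2) + (arc_sum r P g X + (P j - P i) - arc_sum r P h Y)"
      by (intro dvd_add)
    moreover have "arc_sum r P f X + arc_sum r P g X - 2 =
        (arc_sum r P f Y + arc_sum r P h Y - 2) + (arc_sum r P g X + (P j - P i) - arc_sum r P h Y)"
      using \<open>arc_sum r P f X = arc_sum r P f Y + (P j - P i)\<close> by simp
    ultimately show ?thesis by (simp only:)
  qed
qed


section \<open>Application to the circles of a stacked diagram\<close>

lemma matching_sum_left: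
  assumes "nc_matching S A" "finite S"
  shows "(\<Sum>x\<in>X \<inter> S. if x < mate A x then pos \<xi> (mate A x) - pos \<xi> x else 0) =
    (\<Sum>\<gamma> | \<gamma> \<in> A \<and> fst \<gamma> \<in> X. arc_width \<xi> \<gamma>)"
proof -
  have "(\<Sum>x\<in>X \<inter> S. if x < mate A x then pos \<xi> (mate A x) - pos \<xi> x else 0) =
      (\<Sum>x\<in>{x \<in> X \<inter> S. x < mate A x}. pos \<xi> (mate A x) - pos \<xi> x)"
    using assms(2) by (intro sum.inter_filter[symmetric]) simp
  also have "\<dots> = (\<Sum>\<gamma> | \<gamma> \<in> A \<and> fst \<gamma> \<in> X. arc_width \<xi> \<gamma>)"
    by (rule sum.reindex_bij_witness[of _ fst "\<lambda>x. (x, mate A x)"])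
      (use mate_props(4)[OF assms(1)] nc_matchingD[OF assms(1)] mate_eq[OF assms(1)] in
        \<open>auto simp: arc_width_def\<close>)
  finally show ?thesis .
qed

text \<open>On the rotated upper line left and right are exchanged, so an arc is met first at its
  right end. Closure of \<open>X\<close> under \<open>mate\<close> allows it to be counted at the
  other end.\<close>

lemma matching_sum_right:
  assumes "nc_matching S A" "finite S" "\<And>x. x \<in> X \<Longrightarrow> x \<in> S \<Longrightarrow> mate A x \<in> X"
  shows "(\<Sum>x\<in>X \<inter> S. if mate A x < x then pos \<xi> x - pos \<xi> (mate A x) else 0) =
    (\<Sum>\<gamma> | \<gamma> \<in> A \<and> fst \<gamma> \<in> X. arc_width \<xi> \<gamma>)"
proof -
  have "(\<Sum>x\<in>X \<inter> S. if mate A x < x then pos \<xi> x - pos \<xi> (mate A x) else 0) =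
      (\<Sum>x\<in>X \<inter> S. if x < mate A x then pos \<xi> (mate A x) - pos \<xi> x else 0)"
    by (rule sum.reindex_bij_witness[of _ "mate A" "mate A"])
      (use mate_props[OF assms(1)] assms(3) in auto)
  then show ?thesis using matching_sum_left[OF assms(1,2)] by simp
qed

context stacked_diagram
begin

text \<open>
  The upper line is rotated about its right end, so that it continues the lower line and the
  vertical lines become nested arcs.
\<close>

lemma circle_width_mod_4:
  assumes v: "v \<in> V"
  shows "4 dvd circle_width \<xi> D (circle D v) - 2"
proof -
  define C where "C = circle D v"
  have cl: "closed_in \<xi> D C" using closed_circle[OF v] by (simp add: C_def)
  then have CV: "C \<subseteq> V" by (simp add: closed_in_def)
  have fin: "finite C" using finite_closed[OF cl] .
  define XL where "XL = {x. (Lower, x) \<in> C}"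
  define XU where "XU = {x. (Upper, x) \<in> C}"
  have XS: "XL \<subseteq> stars \<xi>" "XU \<subseteq> stars \<xi>"
    using CV by (auto simp: XL_def XU_def vertices_def)
  have finX: "finite XL" "finite XU" using finite_subset[OF _ fin_stars] XS by auto
  have C_eq: "C = Pair Lower ` XL \<union> Pair Upper ` XU"
  proof (intro equalityI subsetI)
    fix w assume "w \<in> C"
    then show "w \<in> Pair Lower ` XL \<union> Pair Upper ` XU"
      by (cases w; cases "fst w") (auto simp: XL_def XU_def)
  qed (auto simp: XL_def XU_def)
  have sum_C: "(\<Sum>w\<in>C. h w) = (\<Sum>x\<in>XL. h (Lower, x)) + (\<Sum>x\<in>XU. h (Upper, x))" for h :: "vertex \<Rightarrow> int"
    unfolding C_eq using finX
    by (subst sum.union_disjoint) (auto simp: sum.reindex inj_on_def)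
  \<comment> \<open>\<open>M\<close> bounds all positions, so the rotated position
    \<open>2 * M + 1 - x\<close> of an upper vertex lies to the right of the whole lower
    line.\<close>
  define M where "M = Max (insert 0 (abs ` stars \<xi>))"
  have M: "\<bar>x\<bar> \<le> M" if "x \<in> stars \<xi>" for x
    unfolding M_def using that fin_stars by (intro Max_ge) auto
  define r :: "vertex \<Rightarrow> int" where "r w = (if fst w = Lower then snd w else 2 * M + 1 - snd w)" for w
  \<comment> \<open>The sign change on the upper line compensates for the reversed order, so arcs
    keep their widths. The summand 1 makes the step \<open>1 - 2 * pos \<xi> x\<close> along a
    vertical line odd.\<close>
  define P :: "vertex \<Rightarrow> int" where "P w = (if fst w = Lower then pos \<xi> (snd w) else 1 - pos \<xi> (snd w))" for w
  have r [simp]: "r (Lower, x) = x" "r (Upper, x) = 2 * M + 1 - x"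
    and P [simp]: "P (Lower, x) = pos \<xi> x" "P (Upper, x) = 1 - pos \<xi> x" for x
    by (simp_all add: r_def P_def)
  have LU: "x < 2 * M + 1 - y" if "x \<in> stars \<xi>" "y \<in> stars \<xi>" for x y
    using M[OF that(1)] M[OF that(2)] by linarith
  have V_cases: "(\<exists>x\<in>stars \<xi>. w = (Lower, x)) \<or> (\<exists>x\<in>stars \<xi>. w = (Upper, x))" if "w \<in> C" for w
    using that CV by (cases w; cases "fst w") (auto simp: vertices_def)
  have inj: "inj_on r C"
  proof (rule inj_onI)
    fix a b assume ab: "a \<in> C" "b \<in> C" "r a = r b"
    show "a = b" using V_cases[OF ab(1)] V_cases[OF ab(2)] ab(3) LU by fastforce
  qed
  have nc_mate: "\<not> (x < y \<and> y < mate A x \<and> mate A x < mate A y)" if "nc_matching S A" "x \<in> S" "y \<in> S" for S A x y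
    using nc_matching_noncrossing[OF that(1), of x "mate A x" y "mate A y"] mate_props(4)[OF that(1)] that
    by (meson order_less_trans)
  have outer_arcs: "arcs_on r P (outer D) C"
    unfolding arcs_on_def
  proof (intro conjI ballI)
    fix w assume w: "w \<in> C"
    then have wV: "w \<in> V" using CV by auto
    show "outer D w \<in> C" "outer D (outer D w) = w"
      using w wV closed_in_iff(1)[OF cl] outer_props(2) by auto
    show "odd (P (outer D w) - P w)"
      using pos_outer[OF wV] outer_props(4)[OF wV] by (auto simp: P_def)
  next
    fix a b assume ab: "a \<in> C" "b \<in> C"
    have m: "mate (lower_cups D) x \<in> stars \<xi>" "mate (upper_caps D) x \<in> stars \<xi>"
      "mate (upper_caps D) (mate (upper_caps D) x) = x" if "x \<in> stars \<xi>" for x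
      using mate_props[OF lower that] mate_props[OF upper that] by auto
    show "\<not> (r a < r b \<and> r b < r (outer D a) \<and> r (outer D a) < r (outer D b))"
      using V_cases[OF ab(1)] V_cases[OF ab(2)]
    proof (elim disjE bexE)
      fix x y assume "x \<in> stars \<xi>" "a = (Lower, x)" "y \<in> stars \<xi>" "b = (Lower, y)"
      then show ?thesis using nc_mate[OF lower] by simp
    next
      fix x y assume "x \<in> stars \<xi>" "a = (Lower, x)" "y \<in> stars \<xi>" "b = (Upper, y)"
      then show ?thesis using LU[OF m(1), of x y] by auto
    next
      fix x y assume "x \<in> stars \<xi>" "a = (Upper, x)" "y \<in> stars \<xi>" "b = (Lower, y)"
      then show ?thesis using LU[of y x] by auto
    next
      fix x y assume xy: "x \<in> stars \<xi>" "a = (Upper, x)" "y \<in> stars \<xi>" "b = (Upper, y)"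
      then show ?thesis using nc_mate[OF upper m(2)[OF xy(3)] m(2)[OF xy(1)]] m(3) by auto
    qed
  qed
  have inner_arcs: "arcs_on r P (inner D) C"
    unfolding arcs_on_def
  proof (intro conjI ballI)
    fix w assume w: "w \<in> C"
    then have wV: "w \<in> V" using CV by auto
    show "inner D w \<in> C" "inner D (inner D w) = w"
      using w wV closed_in_iff(2)[OF cl] inner_props(2) by auto
    show "odd (P (inner D w) - P w)"
      using pos_inner[OF wV] by (cases w; cases "fst w") (auto simp: P_def)
  next
    fix a b assume ab: "a \<in> C" "b \<in> C"
    have m: "mate (middle D) x \<in> stars \<xi> - verticals D" "mate (middle D) (mate (middle D) x) = x"
      if "x \<in> stars \<xi> - verticals D" for x
      using mate_props[OF mid that] by auto
    have free': "\<not> (x < z \<and> z < mate (middle D) x)" "\<not> (mate (middle D) x < z \<and> z < x)"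
      if "x \<in> stars \<xi> - verticals D" "z \<in> verticals D" for x z
      using free[OF _ that(2)] mate_props(4,5)[OF mid that(1)] by (meson order_less_trans)+
    show "\<not> (r a < r b \<and> r b < r (inner D a) \<and> r (inner D a) < r (inner D b))"
      using V_cases[OF ab(1)] V_cases[OF ab(2)]
    proof (elim disjE bexE)
      fix x y assume xy: "x \<in> stars \<xi>" "a = (Lower, x)" "y \<in> stars \<xi>" "b = (Lower, y)"
      then show ?thesis
        using nc_mate[OF mid, of x y] free'[of x y] LU[of "mate (middle D) y" x] m[of y] m[of x] by auto
    next
      fix x y assume xy: "x \<in> stars \<xi>" "a = (Lower, x)" "y \<in> stars \<xi>" "b = (Upper, y)"
      then show ?thesis
        using LU[of "mate (middle D) x" y] m[of x] m[of y] free'(2)[of y x]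
        by (auto dest: order_less_trans)
    next
      fix x y assume "x \<in> stars \<xi>" "a = (Upper, x)" "y \<in> stars \<xi>" "b = (Lower, y)"
      then show ?thesis using LU[of y x] by auto
    next
      fix x y assume xy: "x \<in> stars \<xi>" "a = (Upper, x)" "y \<in> stars \<xi>" "b = (Upper, y)"
      then show ?thesis
        using nc_mate[OF mid, of "mate (middle D) y" "mate (middle D) x"] m[of x] m[of y]
          LU[of x y] LU[of y "mate (middle D) x"] by (auto split: if_splits)
    qed
  qed
  have "4 dvd arc_sum r P (outer D) C + arc_sum r P (inner D) C - 2"
  proof (rule arc_sum_connected[OF fin _ inj outer_arcs inner_arcs])
    show "C \<noteq> {}" using circle_refl[of v D] by (auto simp: C_def)
    fix T assume T: "T \<subseteq> C" "T \<noteq> {}" "outer D ` T \<subseteq> T" "inner D ` T \<subseteq> T"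
    then obtain w where w: "w \<in> T" by auto
    have "closed_in \<xi> D T" using T CV by (auto simp: closed_in_def)
    then have "circle D w \<subseteq> T" using circle_least w by blast
    moreover have "circle D w = C" using circle_eq[of w D v] w T(1) by (auto simp: C_def)
    ultimately show "T = C" using T(1) by simp
  qed
  moreover have "arc_sum r P (outer D) C =
      (\<Sum>\<gamma> | \<gamma> \<in> lower_cups D \<and> (Lower, fst \<gamma>) \<in> C. arc_width \<xi> \<gamma>) +
      (\<Sum>\<gamma> | \<gamma> \<in> upper_caps D \<and> (Upper, fst \<gamma>) \<in> C. arc_width \<xi> \<gamma>)"
  proof -
    have "mate (upper_caps D) x \<in> XU" if "x \<in> XU" for x
      using closed_in_iff(1)[OF cl, of "(Upper, x)"] that XS by (auto simp: XU_def vertices_def)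
    moreover have "XL \<inter> stars \<xi> = XL" "XU \<inter> stars \<xi> = XU" using XS by auto
    ultimately show ?thesis
      unfolding arc_sum_def sum_C
      using matching_sum_left[OF lower fin_stars, where \<xi> = \<xi> and X = XL] matching_sum_right[OF upper fin_stars, where \<xi> = \<xi> and X = XU]
      by (simp add: XL_def XU_def cong: if_cong)
  qed
  moreover have "arc_sum r P (inner D) C =
      (\<Sum>\<gamma> | \<gamma> \<in> middle D \<and> (Lower, fst \<gamma>) \<in> C. arc_width \<xi> \<gamma>) +
      (\<Sum>\<gamma> | \<gamma> \<in> middle D \<and> (Upper, fst \<gamma>) \<in> C. arc_width \<xi> \<gamma>) +
      (\<Sum>x\<in>XL \<inter> verticals D. 1 - 2 * pos \<xi> x)"
  proof -
    let ?S = "stars \<xi> - verticals D"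
    have finS: "finite ?S" using fin_stars by simp
    have mU: "mate (middle D) x \<in> XU" if "x \<in> XU" "x \<in> ?S" for x
      using closed_in_iff(2)[OF cl, of "(Upper, x)"] that XS by (auto simp: XU_def vertices_def)
    have split: "sum h X = sum h (X \<inter> ?S) + sum h (X \<inter> verticals D)" if "X \<subseteq> stars \<xi>" for X and h :: "int \<Rightarrow> int"
    proof -
      have "X = (X \<inter> ?S) \<union> (X \<inter> verticals D)" using that by auto
      moreover have "finite X" using finite_subset[OF that fin_stars] .
      ultimately show ?thesis using sum.union_disjoint[of "X \<inter> ?S" "X \<inter> verticals D" h] by auto
    qed
    have L: "(\<Sum>x\<in>XL. if r (Lower, x) < r (inner D (Lower, x)) then P (inner D (Lower, x)) - P (Lower, x) else 0) =
        (\<Sum>\<gamma> | \<gamma> \<in> middle D \<and> (Lower, fst \<gamma>) \<in> C. arc_width \<xi> \<gamma>) + (\<Sum>x\<in>XL \<inter> verticals D. 1 - 2 * pos \<xi> x)"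
      (is "sum ?h XL = ?A + ?B")
    proof -
      have "sum ?h (XL \<inter> ?S) = (\<Sum>x\<in>XL \<inter> ?S. if x < mate (middle D) x then pos \<xi> (mate (middle D) x) - pos \<xi> x else 0)"
        by (rule sum.cong) (auto cong: if_cong)
      also have "\<dots> = ?A"
        using matching_sum_left[OF mid finS, where \<xi> = \<xi> and X = XL] by (simp add: XL_def)
      finally have "sum ?h (XL \<inter> ?S) = ?A" .
      moreover have "sum ?h (XL \<inter> verticals D) = ?B"
      proof (rule sum.cong)
        fix x assume x: "x \<in> XL \<inter> verticals D"
        then show "?h x = 1 - 2 * pos \<xi> x" using LU[of x x] verts by auto
      qed simp
      ultimately show ?thesis using split[OF XS(1), of ?h] by simp
    qed
    have U: "(\<Sum>x\<in>XU. if r (Upper, x) < r (inner D (Upper, x)) then P (inner D (Upper, x)) - P (Upper, x) else 0) =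
        (\<Sum>\<gamma> | \<gamma> \<in> middle D \<and> (Upper, fst \<gamma>) \<in> C. arc_width \<xi> \<gamma>)"
      (is "sum ?h XU = ?A")
    proof -
      have "sum ?h (XU \<inter> ?S) = (\<Sum>x\<in>XU \<inter> ?S. if mate (middle D) x < x then pos \<xi> x - pos \<xi> (mate (middle D) x) else 0)"
        by (rule sum.cong) (auto cong: if_cong)
      also have "\<dots> = ?A"
        using matching_sum_right[OF mid finS, where \<xi> = \<xi> and X = XU] mU by (simp add: XU_def)
      finally have "sum ?h (XU \<inter> ?S) = ?A" .
      moreover have "sum ?h (XU \<inter> verticals D) = 0"
      proof (rule sum.neutral, rule ballI)
        fix x assume x: "x \<in> XU \<inter> verticals D"
        then show "?h x = 0" using LU[of x x] verts by auto
      qed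
      ultimately show ?thesis using split[OF XS(2), of ?h] by simp
    qed
    show ?thesis unfolding arc_sum_def sum_C L U by simp
  qed
  \<comment> \<open>Modulo 4 a vertical line contributes 1 or -1 according to the parity of its
    position. These signs cancel over all lower vertices of \<open>C\<close>, paired by lower cups,
    and over those without vertical line, paired by middle arcs; hence also over the others.\<close>
  moreover have "4 dvd (\<Sum>x\<in>XL \<inter> verticals D. 1 - 2 * pos \<xi> x)"
  proof -
    define sg :: "int \<Rightarrow> int" where "sg x = (if even (pos \<xi> x) then 1 else - 1)" for x
    have sg_mate: "sg (mate A x) = - sg x"
      if "nc_matching S A" "x \<in> S" "A \<subseteq> lower_cups D \<union> middle D \<union> upper_caps D" for S A x
      using odd_mate[OF that] by (auto simp: sg_def)
    have "sum sg XL = 0"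
    proof (rule sum_involution_eq_0[of _ "mate (lower_cups D)"])
      fix x assume x: "x \<in> XL"
      then have xS: "x \<in> stars \<xi>" using XS by auto
      have "mate (lower_cups D) x \<in> XL"
        using closed_in_iff(1)[OF cl, of "(Lower, x)"] x xS by (auto simp: XL_def vertices_def)
      then show "mate (lower_cups D) x \<in> XL \<and> mate (lower_cups D) (mate (lower_cups D) x) = x \<and>
          sg (mate (lower_cups D) x) = - sg x"
        using mate_props(2)[OF lower xS] sg_mate[OF lower xS] by auto
    qed
    moreover have "sum sg (XL - verticals D) = 0"
    proof (rule sum_involution_eq_0[of _ "mate (middle D)"])
      fix x assume x: "x \<in> XL - verticals D"
      then have xS: "x \<in> stars \<xi> - verticals D" using XS by auto
      have "mate (middle D) x \<in> XL"
        using closed_in_iff(2)[OF cl, of "(Lower, x)"] x xS by (auto simp: XL_def vertices_def)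
      then show "mate (middle D) x \<in> XL - verticals D \<and> mate (middle D) (mate (middle D) x) = x \<and>
          sg (mate (middle D) x) = - sg x"
        using mate_props(1,2)[OF mid xS] sg_mate[OF mid xS] by auto
    qed
    moreover have "sum sg XL = sum sg (XL - verticals D) + sum sg (XL \<inter> verticals D)"
      using sum.Int_Diff[OF finX(1), of sg "verticals D"] by simp
    ultimately have "sum sg (XL \<inter> verticals D) = 0" by simp
    moreover have "4 dvd (\<Sum>x\<in>XL \<inter> verticals D. (1 - 2 * pos \<xi> x) - sg x)"
    proof (rule dvd_sum)
      fix x
      show "4 dvd (1 - 2 * pos \<xi> x) - sg x"
        unfolding sg_def by (cases "even (pos \<xi> x)") (auto elim!: evenE oddE)
    qed
    ultimately show ?thesis by (simp add: sum_subtractf)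
  qed
  ultimately have "4 dvd (circle_width \<xi> D C - 2 + (\<Sum>x\<in>XL \<inter> verticals D. 1 - 2 * pos \<xi> x)) -
      (\<Sum>x\<in>XL \<inter> verticals D. 1 - 2 * pos \<xi> x)"
    unfolding circle_width_def by (intro dvd_diff) (simp_all add: algebra_simps)
  then show ?thesis by (simp add: C_def)
qed

end

section \<open>Removing the signs\<close>

lemma power_sign:
  fixes \<epsilon> :: "'k::comm_ring_1"
  assumes "\<epsilon> * \<epsilon> = 1"
  shows "\<epsilon> ^ n = (if even n then 1 else \<epsilon>)"
  using assms by (induction n) auto

lemma sign_power_parity:
  fixes \<epsilon> :: "'k::comm_ring_1"
  assumes "\<epsilon> * \<epsilon> = 1"
  shows "sign_power \<epsilon> n = (if even n then 1 else \<epsilon>)"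
  unfolding sign_power_def power_sign[OF assms] by (simp add: even_nat_iff)

lemma sign_power_eps [simp]: "sign_power \<epsilon> 0 = 1" "sign_power \<epsilon> 1 = \<epsilon>"
  by (simp_all add: sign_power_def)

lemma sign_power_one [simp]: "sign_power 1 n = 1"
  by (simp add: sign_power_def)

lemma sign_power_add:
  fixes \<epsilon> :: "'k::comm_ring_1"
  assumes "\<epsilon> * \<epsilon> = 1"
  shows "sign_power \<epsilon> (m + n) = sign_power \<epsilon> m * sign_power \<epsilon> n"
    "sign_power \<epsilon> (m - n) = sign_power \<epsilon> m * sign_power \<epsilon> n"
  using assms by (auto simp: sign_power_parity[OF assms])

lemma sign_power_square:
  fixes \<epsilon> :: "'k::comm_ring_1"
  assumes "\<epsilon> * \<epsilon> = 1"
  shows "sign_power \<epsilon> n * sign_power \<epsilon> n = 1" "sign_power \<epsilon> n * (sign_power \<epsilon> n * x) = x"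
  using assms by (auto simp: sign_power_parity[OF assms] mult.assoc[symmetric])

definition circle_exponent :: "weight \<Rightarrow> stacked \<Rightarrow> orientation \<Rightarrow> vertex set \<Rightarrow> int" where
  "circle_exponent \<xi> D \<nu> C = (circle_width \<xi> D C - 2) div 4 * circle_pos \<xi> C +
     (if clockwise \<nu> C then circle_pos \<xi> C else 0)"

definition exponent :: "weight \<Rightarrow> stacked \<Rightarrow> orientation \<Rightarrow> int" where
  "exponent \<xi> D \<nu> = (\<Sum>C \<in> circles \<xi> D. circle_exponent \<xi> D \<nu> C)"

text \<open>For a merge the three quotients \<open>(d - 2)/4\<close> sum to \<open>1 + s\<close>
  modulo 2, and for unnested circles each of them is weighted by \<open>p + 1\<close>. This product
  cancels that contribution.\<close>

definition saddle_exponent :: "weight \<Rightarrow> int \<times> int \<Rightarrow> int" where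
  "saddle_exponent \<xi> \<gamma> = (pos \<xi> (fst \<gamma>) + 1) * (1 + saddle_width \<xi> \<gamma>)"

context surgery_diagram
begin

lemma arc_width_gamma: "arc_width \<xi> (i, j) = 2 * saddle_width \<xi> (i, j) - 1"
  using odd_width[of "(i, j)"] gamma by (auto simp: saddle_width_def elim!: oddE)

lemma width_quarter:
  "circle_width \<xi> D C1 = 4 * ((circle_width \<xi> D C1 - 2) div 4) + 2"
  "circle_width \<xi> D C2 = 4 * ((circle_width \<xi> D C2 - 2) div 4) + 2"
  "circle_width \<xi> D' Ci = 4 * ((circle_width \<xi> D' Ci - 2) div 4) + 2"
  "circle_width \<xi> D' Cj = 4 * ((circle_width \<xi> D' Cj - 2) div 4) + 2"
  using circle_width_mod_4[OF gamma_V(1)[of Lower]] circle_width_mod_4[OF gamma_V(1)[of Upper]]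
    after.circle_width_mod_4[OF gamma_V(1)[of Lower]] after.circle_width_mod_4[OF gamma_V(2)[of Lower]]
  by simp_all

text \<open>With \<open>W = W1 + W2 + 1 - s\<close> and the parities of \<open>merge_parity\<close>,
  widths and saddle together contribute 0 for unnested circles and \<open>1 + W_in + s\<close> for
  nested ones, the exponent in the nested rule. What remains are the \<open>t\<close> of the
  clockwise circles.\<close>

lemma merge_coeff_twist:
  fixes \<epsilon> :: "'k::comm_ring_1"
  assumes e: "\<epsilon> * \<epsilon> = 1" and ne: "C1 \<noteq> C2"
  shows "merge_coeff \<alpha> \<epsilon> \<xi> D (i, j) C1 C2 Ci \<nu> \<nu>' =
    sign_power \<epsilon> (circle_exponent \<xi> D \<nu> C1 + circle_exponent \<xi> D \<nu> C2 + circle_exponent \<xi> D' \<nu>' Ci +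
      saddle_exponent \<xi> (i, j)) * merge_coeff \<alpha> 1 \<xi> D (i, j) C1 C2 Ci \<nu> \<nu>'"
proof -
  define W1 where "W1 = (circle_width \<xi> D C1 - 2) div 4"
  define W2 where "W2 = (circle_width \<xi> D C2 - 2) div 4"
  define W where "W = (circle_width \<xi> D' Ci - 2) div 4"
  define s where "s = saddle_width \<xi> (i, j)"
  define t1 where "t1 = circle_pos \<xi> C1"
  define t2 where "t2 = circle_pos \<xi> C2"
  define t where "t = circle_pos \<xi> Ci"
  define p where "p = pos \<xi> i"
  have W: "W = W1 + W2 + 1 - s"
    using circle_width_merge[OF ne] width_quarter arc_width_gamma
    unfolding W1_def[symmetric] W2_def[symmetric] W_def[symmetric] s_def[symmetric] by linarith
  note par = merge_parity[OF ne, folded t1_def t2_def t_def p_def]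
  let ?b = "(clockwise \<nu> C1, clockwise \<nu> C2, clockwise \<nu>' Ci)"
  \<comment> \<open>All exponents of \<open>\<epsilon>\<close> in the rule are collected here. For
    two clockwise circles \<open>t1 + t2\<close> stands for the sum of \<open>t - t1\<close> and
    \<open>t - t2\<close>, which has the same parity.\<close>
  define N where "N = (if circle_inside C1 C2 then 1 + W1 + s else if circle_inside C2 C1 then 1 + W2 + s else 0) +
    (case ?b of (True, False, True) \<Rightarrow> t - t1 | (False, True, True) \<Rightarrow> t - t2
      | (True, True, False) \<Rightarrow> t1 + t2 | _ \<Rightarrow> 0)"
  define E where "E = circle_exponent \<xi> D \<nu> C1 + circle_exponent \<xi> D \<nu> C2 + circle_exponent \<xi> D' \<nu>' Ci +
      saddle_exponent \<xi> (i, j)"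
  have "merge_coeff \<alpha> \<epsilon> \<xi> D (i, j) C1 C2 Ci \<nu> \<nu>' =
      sign_power \<epsilon> N * merge_coeff \<alpha> 1 \<xi> D (i, j) C1 C2 Ci \<nu> \<nu>'"
    unfolding merge_coeff_def Let_def nesting_sign_def W1_def[symmetric] W2_def[symmetric] s_def[symmetric]
      t1_def[symmetric] t2_def[symmetric] t_def[symmetric] N_def
    by (cases "clockwise \<nu> C1"; cases "clockwise \<nu> C2"; cases "clockwise \<nu>' Ci")
      (simp_all add: sign_power_add[OF e] sign_power_square[OF e] ac_simps)
  moreover have "even N \<longleftrightarrow> even E" if "?b \<in> {(False, False, False), (True, False, True), (False, True, True), (True, True, False)}"
    using that par
    unfolding N_def E_def circle_exponent_def saddle_exponent_def fst_conv
      W1_def[symmetric] W2_def[symmetric] W_def[symmetric] s_def[symmetric]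
      t1_def[symmetric] t2_def[symmetric] t_def[symmetric] p_def[symmetric] W
    by (cases "circle_inside C1 C2"; cases "circle_inside C2 C1"; elim insertE emptyE) (simp_all, argo+)
  moreover have "merge_coeff \<alpha> 1 \<xi> D (i, j) C1 C2 Ci \<nu> \<nu>' = 0"
    if "?b \<notin> {(False, False, False), (True, False, True), (False, True, True), (True, True, False)}"
    using that unfolding merge_coeff_def Let_def by (auto split: bool.split)
  ultimately show ?thesis
    unfolding E_def[symmetric] by (metis mult_zero_right sign_power_parity[OF e])
qed

text \<open>The balance is as for a merge, now with \<open>W = Wi + Wj + s\<close>, but it is off by
  one in all four cases of the rule. This is the origin of the \<open>\<epsilon>\<close> in the
  factor \<open>\<epsilon> * \<omega>\<close> of a split.\<close>

lemma split_coeff_twist: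
  fixes \<epsilon> :: "'k::comm_ring_1"
  assumes e: "\<epsilon> * \<epsilon> = 1" and eq: "C1 = C2"
  shows "split_coeff \<alpha> \<epsilon> \<omega> \<xi> D' (i, j) C1 Ci Cj \<nu> \<nu>' =
    sign_power \<epsilon> (circle_exponent \<xi> D \<nu> C1 + circle_exponent \<xi> D' \<nu>' Ci + circle_exponent \<xi> D' \<nu>' Cj +
      saddle_exponent \<xi> (i, j)) * (\<epsilon> * \<omega>) * split_coeff \<alpha> 1 1 \<xi> D' (i, j) C1 Ci Cj \<nu> \<nu>'"
proof -
  define W where "W = (circle_width \<xi> D C1 - 2) div 4"
  define Wi where "Wi = (circle_width \<xi> D' Ci - 2) div 4"
  define Wj where "Wj = (circle_width \<xi> D' Cj - 2) div 4"
  define s where "s = saddle_width \<xi> (i, j)"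
  define t where "t = circle_pos \<xi> C1"
  define ti where "ti = circle_pos \<xi> Ci"
  define tj where "tj = circle_pos \<xi> Cj"
  define p where "p = pos \<xi> i"
  define p' where "p' = pos \<xi> j"
  have W: "W = Wi + Wj + s"
    using circle_width_split[OF eq] width_quarter arc_width_gamma
    unfolding W_def[symmetric] Wi_def[symmetric] Wj_def[symmetric] s_def[symmetric] by linarith
  note par = split_parity[OF eq, folded t_def ti_def tj_def p_def] odd_gamma[folded p_def p'_def]
  let ?b = "(clockwise \<nu> C1, clockwise \<nu>' Ci, clockwise \<nu>' Cj)"
  define N where "N = (if circle_inside Ci Cj then
      Wi + (case ?b of (False, False, True) \<Rightarrow> 1 | (True, False, False) \<Rightarrow> 1 | _ \<Rightarrow> 0)
    else if circle_inside Cj Ci then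
      Wj + (case ?b of (False, True, False) \<Rightarrow> 1 | (True, False, False) \<Rightarrow> 1 | _ \<Rightarrow> 0)
    else (case ?b of (False, True, False) \<Rightarrow> ti - p + s | (False, False, True) \<Rightarrow> 1 + (tj - p') + s
      | (True, True, True) \<Rightarrow> t - tj + (ti - p) + s | (True, False, False) \<Rightarrow> 1 + t - p' + s | _ \<Rightarrow> 0))"
  define E where "E = circle_exponent \<xi> D \<nu> C1 + circle_exponent \<xi> D' \<nu>' Ci + circle_exponent \<xi> D' \<nu>' Cj +
      saddle_exponent \<xi> (i, j)"
  have 1: "split_coeff \<alpha> \<epsilon> \<omega> \<xi> D' (i, j) C1 Ci Cj \<nu> \<nu>' =
      sign_power \<epsilon> N * \<omega> * split_coeff \<alpha> 1 1 \<xi> D' (i, j) C1 Ci Cj \<nu> \<nu>'"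
    unfolding split_coeff_def Let_def nesting_sign_def fst_conv snd_conv
      Wi_def[symmetric] Wj_def[symmetric] s_def[symmetric]
      t_def[symmetric] ti_def[symmetric] tj_def[symmetric] p_def[symmetric] p'_def[symmetric] N_def
    by (cases "clockwise \<nu> C1"; cases "clockwise \<nu>' Ci"; cases "clockwise \<nu>' Cj")
      (simp_all add: sign_power_add[OF e] sign_power_square[OF e] ac_simps)
  have "even N \<longleftrightarrow> odd E"
    if "?b \<in> {(False, True, False), (False, False, True), (True, True, True), (True, False, False)}"
    using that par
    unfolding N_def E_def circle_exponent_def saddle_exponent_def fst_conv
      W_def[symmetric] Wi_def[symmetric] Wj_def[symmetric] s_def[symmetric]
      t_def[symmetric] ti_def[symmetric] tj_def[symmetric] p_def[symmetric] p'_def[symmetric] W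
    by (cases "circle_inside Ci Cj"; cases "circle_inside Cj Ci"; elim insertE emptyE) (simp_all, argo+)
  then have 2: "sign_power \<epsilon> N = sign_power \<epsilon> E * \<epsilon>"
    if "?b \<in> {(False, True, False), (False, False, True), (True, True, True), (True, False, False)}"
    using that e by (simp add: sign_power_parity[OF e])
  have 3: "split_coeff \<alpha> 1 1 \<xi> D' (i, j) C1 Ci Cj \<nu> \<nu>' = 0"
    if "?b \<notin> {(False, True, False), (False, False, True), (True, True, True), (True, False, False)}"
    using that unfolding split_coeff_def Let_def by (auto split: bool.split)
  show ?thesis
  proof (cases "?b \<in> {(False, True, False), (False, False, True), (True, True, True), (True, False, False)}")
    case True
    then show ?thesis using 1 2 unfolding E_def[symmetric] by (simp only: mult.assoc)
  next
    case False
    then show ?thesis using 1 3[OF False] by (simp only: mult_zero_right)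
  qed
qed

text \<open>The exponents before and after are added instead of subtracted, since a sign is its own
  inverse. Circles away from the saddle occur in both with the same value and cancel modulo
  2.\<close>

lemma surgery_coeff_twist:
  fixes \<epsilon> :: "'k::comm_ring_1"
  assumes e: "\<epsilon> * \<epsilon> = 1"
  shows "surgery_coeff \<alpha> \<epsilon> \<omega> \<xi> D (i, j) \<nu> \<nu>' =
    sign_power \<epsilon> (exponent \<xi> D \<nu> + exponent \<xi> D' \<nu>' + saddle_exponent \<xi> (i, j)) *
    (if C1 = C2 then \<epsilon> * \<omega> else 1) * surgery_coeff \<alpha> 1 1 \<xi> D (i, j) \<nu> \<nu>'"
proof (cases "\<exists>v. v \<notin> C1 \<union> C2 \<and> label \<nu> v \<noteq> label \<nu>' v")
  case True
  then show ?thesis by (simp add: surgery_coeff_def Let_def)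
next
  case False
  have "circle_exponent \<xi> D' \<nu>' C = circle_exponent \<xi> D \<nu> C" if "C \<in> rest" for C
  proof -
    have "clockwise \<nu>' C = clockwise \<nu> C"
      using False rest_disjoint[OF that] unfolding clockwise_def by fastforce
    then show ?thesis
      by (simp add: circle_exponent_def circle_width_rest[OF that])
  qed
  then have R: "sum (circle_exponent \<xi> D' \<nu>') rest = sum (circle_exponent \<xi> D \<nu>) rest"
    by (rule sum.cong[OF refl])
  have fin: "finite {C1, C2}" "finite {Ci, Cj}" "{C1, C2} \<inter> rest = {}" "{Ci, Cj} \<inter> rest = {}"
    using not_in_rest by auto
  have sums: "exponent \<xi> D \<nu> = sum (circle_exponent \<xi> D \<nu>) {C1, C2} + sum (circle_exponent \<xi> D \<nu>) rest"
    "exponent \<xi> D' \<nu>' = sum (circle_exponent \<xi> D' \<nu>') {Ci, Cj} + sum (circle_exponent \<xi> D \<nu>) rest"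
    unfolding exponent_def circles_eq
    using sum.union_disjoint[OF fin(1) finite_rest fin(3), of "circle_exponent \<xi> D \<nu>"]
      sum.union_disjoint[OF fin(2) finite_rest fin(4), of "circle_exponent \<xi> D' \<nu>'"] R
    by (simp_all only:)
  have *: "sign_power \<epsilon> (exponent \<xi> D \<nu> + exponent \<xi> D' \<nu>' + saddle_exponent \<xi> (i, j)) =
    sign_power \<epsilon> (sum (circle_exponent \<xi> D \<nu>) {C1, C2} + sum (circle_exponent \<xi> D' \<nu>') {Ci, Cj} +
      saddle_exponent \<xi> (i, j))"
    unfolding sign_power_parity[OF e] sums by simp
  show ?thesis
  proof (cases "C1 = C2")
    case True
    then show ?thesis
      unfolding surgery_coeff_def Let_def * fst_conv snd_conv if_not_P[OF False]
      using split_circles split_coeff_twist[OF e True]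
      by (simp add: add.assoc)
  next
    case ne: False
    then show ?thesis
      unfolding surgery_coeff_def Let_def * fst_conv snd_conv if_not_P[OF False]
      using merge_circles merge_coeff_twist[OF e ne]
      by (simp add: add.assoc)
  qed
qed

end

section \<open>Iterated surgeries\<close>

text \<open>\<open>K\<close> may exceed the support, so that elements with different supports can be
  compared over one index set. Finiteness enters the condition because a sum over an infinite set is
  0.\<close>

lemma lookup_surgery:
  assumes "finite K" "keys f \<subseteq> K"
  shows "lookup (surgery \<alpha> \<epsilon> \<omega> \<xi> D \<gamma> f) \<nu>' =
    (if finite (orientations \<xi> (surgered D \<gamma>)) \<and> \<nu>' \<in> orientations \<xi> (surgered D \<gamma>)
     then \<Sum>\<nu>\<in>K. lookup f \<nu> * surgery_coeff \<alpha> \<epsilon> \<omega> \<xi> D \<gamma> \<nu> \<nu>' else 0)"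
proof (cases "finite (orientations \<xi> (surgered D \<gamma>))")
  case True
  have "lookup (surgery \<alpha> \<epsilon> \<omega> \<xi> D \<gamma> f) \<nu>' =
      (\<Sum>\<nu>\<in>keys f. \<Sum>\<nu>''\<in>orientations \<xi> (surgered D \<gamma>).
        if \<nu>'' = \<nu>' then lookup f \<nu> * surgery_coeff \<alpha> \<epsilon> \<omega> \<xi> D \<gamma> \<nu> \<nu>'' else 0)"
    by (simp add: surgery_def lookup_sum lookup_single when_def)
  also have "\<dots> = (\<Sum>\<nu>\<in>keys f. if \<nu>' \<in> orientations \<xi> (surgered D \<gamma>)
      then lookup f \<nu> * surgery_coeff \<alpha> \<epsilon> \<omega> \<xi> D \<gamma> \<nu> \<nu>' else 0)"
    using True by simp
  also have "\<dots> = (\<Sum>\<nu>\<in>K. if \<nu>' \<in> orientations \<xi> (surgered D \<gamma>)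
      then lookup f \<nu> * surgery_coeff \<alpha> \<epsilon> \<omega> \<xi> D \<gamma> \<nu> \<nu>' else 0)"
    using assms by (intro sum.mono_neutral_left) (auto simp: in_keys_iff)
  finally show ?thesis using True by simp
qed (simp add: surgery_def)

lemma surgery_step_Suc:
  "(surgery_step \<alpha> \<epsilon> \<omega> \<xi> ^^ Suc n) (D, f) =
    (surgery_step \<alpha> \<epsilon> \<omega> \<xi> ^^ n) (surgered D (next_pair D), surgery \<alpha> \<epsilon> \<omega> \<xi> D (next_pair D) f)"
  by (simp add: funpow_swap1 surgery_step_def)

definition completed :: "weight \<Rightarrow> stacked \<Rightarrow> stacked" where
  "completed \<xi> D = D\<lparr>middle := {}, verticals := stars \<xi>\<rparr>"

lemma completed_surgered [simp]: "completed \<xi> (surgered D \<gamma>) = completed \<xi> D"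
  by (simp add: completed_def surgered_def)

context stacked_diagram
begin

lemma completed_eq:
  assumes "middle D = {}"
  shows "completed \<xi> D = D"
proof -
  have "stars \<xi> - verticals D = {}"
    using mate_iff[OF mid] assms by auto
  then have "verticals D = stars \<xi>" using verts by auto
  then show ?thesis using assms by (simp add: completed_def)
qed

text \<open>The leftmost remaining arc is not enclosed, as an enclosing arc would start further
  left. So the description in \<open>next_pair\<close> has exactly this solution.\<close>

lemma connectable_next_pair:
  assumes "middle D \<noteq> {}"
  shows "connectable D (next_pair D)"
proof -
  have fin: "finite (fst ` middle D)" using finite_arcs by simp
  have "Min (fst ` middle D) \<in> fst ` middle D"
    using assms fin by (intro Min_in) auto
  then obtain \<gamma> where \<gamma>: "\<gamma> \<in> middle D" "fst \<gamma> = Min (fst ` middle D)" by auto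
  then have le: "fst \<gamma> \<le> fst \<gamma>'" if "\<gamma>' \<in> middle D" for \<gamma>'
    using that fin by simp
  have c: "connectable D \<gamma>"
    using \<gamma>(1) le unfolding connectable_def by force
  have "next_pair D = \<gamma>"
    unfolding next_pair_def
  proof (rule the_equality)
    show "connectable D \<gamma> \<and> (\<forall>\<gamma>'. connectable D \<gamma>' \<longrightarrow> fst \<gamma> \<le> fst \<gamma>')"
      using c le by (auto simp: connectable_def)
    fix \<gamma>' assume \<gamma>': "connectable D \<gamma>' \<and> (\<forall>\<gamma>''. connectable D \<gamma>'' \<longrightarrow> fst \<gamma>' \<le> fst \<gamma>'')"
    then have "fst \<gamma>' \<le> fst \<gamma>" using c by blast
    moreover have "\<gamma>' \<in> middle D" using \<gamma>' unfolding connectable_def by blast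
    ultimately have "\<gamma>' \<in> middle D" "fst \<gamma>' = fst \<gamma>"
      using le[of \<gamma>'] by auto
    then show "\<gamma>' = \<gamma>"
      using mate_eq(1)[OF mid] \<gamma>(1) by (metis prod.collapse)
  qed
  then show ?thesis using c by simp
qed

lemma surgery_diagram_next_pair:
  assumes "middle D \<noteq> {}"
  shows "surgery_diagram \<xi> D (fst (next_pair D)) (snd (next_pair D))"
  using connectable_next_pair[OF assms] by unfold_locales simp

end

lemma middle_surgered: "middle (surgered D \<gamma>) = middle D - {\<gamma>}"
  by (simp add: surgered_def)

lemma fst_iterated_surgery:
  assumes "stacked_diagram \<xi> D"
  shows "fst ((surgery_step \<alpha> \<epsilon> \<omega> \<xi> ^^ card (middle D)) (D, f)) = completed \<xi> D"
  using assms
proof (induction "card (middle D)" arbitrary: D f)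
  case 0
  then show ?case
    using stacked_diagram.completed_eq[of \<xi> D] stacked_diagram.finite_arcs(3)[of \<xi> D] by simp
next
  case (Suc n)
  then have ne: "middle D \<noteq> {}" by auto
  interpret surgery_diagram \<xi> D "fst (next_pair D)" "snd (next_pair D)"
    using stacked_diagram.surgery_diagram_next_pair[OF Suc.prems ne] .
  have "card (middle (surgered D (next_pair D))) = n"
    using gamma Suc.hyps(2) finite_arcs(3) by (simp add: middle_surgered)
  then show ?case
    using Suc.hyps(1)[of "surgered D (next_pair D)"] stacked_diagram_surgered
    unfolding Suc.hyps(2)[symmetric] surgery_step_Suc by simp
qed

lemma keys_surgery: "keys (surgery \<alpha> \<epsilon> \<omega> \<xi> D \<gamma> f) \<subseteq> orientations \<xi> (surgered D \<gamma>)"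
  using lookup_surgery[of "keys f" f \<alpha> \<epsilon> \<omega> \<xi> D \<gamma>] by (auto simp: in_keys_iff split: if_splits)

lemma keys_iterated_surgery:
  assumes "keys f \<subseteq> orientations \<xi> D"
  shows "keys (snd ((surgery_step \<alpha> \<epsilon> \<omega> \<xi> ^^ n) (D, f))) \<subseteq>
    orientations \<xi> (fst ((surgery_step \<alpha> \<epsilon> \<omega> \<xi> ^^ n) (D, f)))"
  using assms
proof (induction n arbitrary: D f)
  case (Suc n)
  show ?case unfolding surgery_step_Suc by (rule Suc.IH) (rule keys_surgery)
qed simp

text \<open>\<open>m\<close> counts the splits: they raise the number of circles by one, the other
  surgeries lower it by one, and this gives the first equation. \<open>\<kappa>\<close> accumulates
  the factors independent of the orientation, while the exponent of each intermediate diagram occurs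
  twice and cancels.\<close>

lemma iterated_surgery_twist:
  fixes \<epsilon> :: "'k::comm_ring_1"
  assumes e: "\<epsilon> * \<epsilon> = 1" and "stacked_diagram \<xi> D"
    and "\<And>\<nu>. lookup f \<nu> = \<kappa> * sign_power \<epsilon> (exponent \<xi> D \<nu>) * lookup g \<nu>"
  shows "\<exists>m. 2 * m + card (circles \<xi> D) = card (middle D) + card (circles \<xi> (completed \<xi> D)) \<and>
    (\<forall>\<nu>. lookup (snd ((surgery_step \<alpha> \<epsilon> \<omega> \<xi> ^^ card (middle D)) (D, f))) \<nu> =
      \<kappa> * sign_power \<epsilon> (sum (saddle_exponent \<xi>) (middle D)) * (\<epsilon> * \<omega>) ^ m *
      sign_power \<epsilon> (exponent \<xi> (completed \<xi> D) \<nu>) *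
      lookup (snd ((surgery_step \<alpha> 1 1 \<xi> ^^ card (middle D)) (D, g))) \<nu>)"
  using assms(2,3)
proof (induction "card (middle D)" arbitrary: D f g \<kappa>)
  case 0
  then have "middle D = {}"
    using stacked_diagram.finite_arcs(3)[of \<xi> D] by simp
  then show ?case
    using 0 stacked_diagram.completed_eq[of \<xi> D] by (intro exI[of _ 0]) simp
next
  case (Suc n)
  then have ne: "middle D \<noteq> {}" by auto
  interpret surgery_diagram \<xi> D "fst (next_pair D)" "snd (next_pair D)"
    using stacked_diagram.surgery_diagram_next_pair[OF Suc.prems(1) ne] .
  define \<gamma> where "\<gamma> = next_pair D"
  have \<gamma>: "\<gamma> \<in> middle D" "(fst (next_pair D), snd (next_pair D)) = \<gamma>"
    using gamma by (simp_all add: \<gamma>_def)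
  define D1 where "D1 = surgered D \<gamma>"
  define \<kappa>' where "\<kappa>' = \<kappa> * sign_power \<epsilon> (saddle_exponent \<xi> \<gamma>) * (if C1 = C2 then \<epsilon> * \<omega> else 1)"
  have mid1: "middle D1 = middle D - {\<gamma>}" by (simp add: D1_def middle_surgered)
  have n: "n = card (middle D1)"
    using \<gamma> Suc.hyps(2) finite_arcs(3) mid1 by simp
  have D1: "stacked_diagram \<xi> D1" using stacked_diagram_surgered \<gamma> by (simp add: D1_def)
  \<comment> \<open>The factor \<open>\<kappa>\<close> may annihilate entries, so both sums are
    compared over the support of \<open>g\<close> as far as possible.\<close>
  have keys: "keys f \<subseteq> keys g"
    using Suc.prems(2) by (auto simp: in_keys_iff)
  have "lookup (surgery \<alpha> \<epsilon> \<omega> \<xi> D \<gamma> f) \<nu>' =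
      \<kappa>' * sign_power \<epsilon> (exponent \<xi> D1 \<nu>') * lookup (surgery \<alpha> 1 1 \<xi> D \<gamma> g) \<nu>'" for \<nu>'
  proof -
    have "lookup f \<nu> * surgery_coeff \<alpha> \<epsilon> \<omega> \<xi> D \<gamma> \<nu> \<nu>' =
        \<kappa>' * sign_power \<epsilon> (exponent \<xi> D1 \<nu>') * (lookup g \<nu> * surgery_coeff \<alpha> 1 1 \<xi> D \<gamma> \<nu> \<nu>')"
      for \<nu>
      using surgery_coeff_twist[OF e, of \<alpha> \<omega> \<nu> \<nu>'] unfolding \<gamma>(2) Suc.prems(2) \<kappa>'_def D1_def
      by (simp add: sign_power_add[OF e] sign_power_square[OF e] ac_simps)
    then show ?thesis
      using lookup_surgery[OF finite_keys keys, where \<alpha> = \<alpha> and \<epsilon> = \<epsilon> and \<omega> = \<omega> and \<xi> = \<xi> and D = D and \<gamma> = \<gamma> and \<nu>' = \<nu>']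
        lookup_surgery[OF finite_keys order_refl, where f = g and \<alpha> = \<alpha> and \<epsilon> = 1 and \<omega> = 1 and \<xi> = \<xi> and D = D and \<gamma> = \<gamma> and \<nu>' = \<nu>']
      by (simp add: sum_distrib_left)
  qed
  from Suc.hyps(1)[OF n D1 this] obtain m where m:
    "2 * m + card (circles \<xi> D1) = n + card (circles \<xi> (completed \<xi> D))"
    "\<And>\<nu>. lookup (snd ((surgery_step \<alpha> \<epsilon> \<omega> \<xi> ^^ n) (D1, surgery \<alpha> \<epsilon> \<omega> \<xi> D \<gamma> f))) \<nu> =
      \<kappa>' * sign_power \<epsilon> (sum (saddle_exponent \<xi>) (middle D1)) * (\<epsilon> * \<omega>) ^ m *
      sign_power \<epsilon> (exponent \<xi> (completed \<xi> D) \<nu>) *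
      lookup (snd ((surgery_step \<alpha> 1 1 \<xi> ^^ n) (D1, surgery \<alpha> 1 1 \<xi> D \<gamma> g))) \<nu>"
    unfolding n[symmetric] by (auto simp: D1_def)
  have sum: "sum (saddle_exponent \<xi>) (middle D) = saddle_exponent \<xi> \<gamma> + sum (saddle_exponent \<xi>) (middle D1)"
    unfolding mid1 using \<gamma>(1) finite_arcs(3) by (simp add: sum.remove)
  define m' where "m' = (if C1 = C2 then Suc m else m)"
  have "2 * m' + card (circles \<xi> D) = card (middle D) + card (circles \<xi> (completed \<xi> D))"
    using m(1) card_circles Suc.hyps(2) \<gamma> unfolding m'_def D1_def by auto
  moreover have "\<kappa>' * sign_power \<epsilon> (sum (saddle_exponent \<xi>) (middle D1)) * (\<epsilon> * \<omega>) ^ m =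
      \<kappa> * sign_power \<epsilon> (sum (saddle_exponent \<xi>) (middle D)) * (\<epsilon> * \<omega>) ^ m'"
    unfolding sum sign_power_add[OF e] \<kappa>'_def m'_def by (simp add: ac_simps)
  ultimately show ?case
    using m(2) unfolding Suc.hyps(2)[symmetric] surgery_step_Suc \<gamma>_def[symmetric] D1_def[symmetric]
    by (intro exI[of _ m']) simp
qed


section \<open>Blocks\<close>

lemma same_block_outside:
  assumes "same_block \<xi> \<mu>"
  shows "stars \<mu> = stars \<xi>" "i \<notin> stars \<xi> \<Longrightarrow> \<mu> i = \<xi> i"
proof -
  obtain \<pi> where \<pi>: "\<pi> permutes stars \<xi>" "\<mu> = \<xi> \<circ> \<pi>"
    using assms by (auto simp: same_block_def)
  have "i \<in> stars \<mu> \<longleftrightarrow> \<pi> i \<in> stars \<xi>" for i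
    using \<pi>(2) by (auto simp: stars_def)
  then show "stars \<mu> = stars \<xi>"
    using permutes_in_image[OF \<pi>(1)] by auto
  show "i \<notin> stars \<xi> \<Longrightarrow> \<mu> i = \<xi> i"
    using \<pi> by (simp add: permutes_not_in)
qed

lemma same_block_refl: "same_block \<xi> \<xi>"
  unfolding same_block_def by (rule exI[of _ id]) (simp add: permutes_id)

lemma same_block_sym:
  assumes "same_block \<xi> \<mu>"
  shows "same_block \<mu> \<xi>"
proof -
  obtain \<pi> where \<pi>: "\<pi> permutes stars \<xi>" "\<mu> = \<xi> \<circ> \<pi>"
    using assms by (auto simp: same_block_def)
  then have "\<xi> = \<mu> \<circ> inv_into UNIV \<pi>"
    by (simp add: comp_assoc permutes_inv_o)
  then show ?thesis
    unfolding same_block_def same_block_outside(1)[OF assms] using permutes_inv[OF \<pi>(1)] by blast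
qed

lemma same_block_trans:
  assumes "same_block \<xi> \<mu>" "same_block \<mu> \<eta>"
  shows "same_block \<xi> \<eta>"
proof -
  obtain \<pi> \<rho> where "\<pi> permutes stars \<xi>" "\<mu> = \<xi> \<circ> \<pi>" "\<rho> permutes stars \<xi>" "\<eta> = \<mu> \<circ> \<rho>"
    using assms same_block_outside(1)[OF assms(1)] by (auto simp: same_block_def)
  then show ?thesis
    unfolding same_block_def by (intro exI[of _ "\<pi> \<circ> \<rho>"]) (simp add: permutes_compose comp_assoc)
qed

lemma same_block_Cross:
  assumes "same_block \<xi> \<mu>"
  shows "\<mu> i = Cross \<longleftrightarrow> \<xi> i = Cross"
proof (cases "i \<in> stars \<xi>")
  case True
  then have "i \<in> stars \<mu>" using same_block_outside(1)[OF assms] by simp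
  then show ?thesis using True by (auto simp: stars_def)
qed (use same_block_outside(2)[OF assms] in simp)

lemma same_block_pos:
  assumes "same_block \<xi> \<mu>"
  shows "pos \<mu> = pos \<xi>"
  by (rule ext) (simp add: pos_def same_block_outside(1)[OF assms] same_block_Cross[OF assms])

text \<open>A product is computed with the middle weight representing the block, whereas
  \<open>normalizer\<close> uses the weight of the cup diagram; the two have to give the same
  exponents.\<close>

lemma exponent_cong:
  assumes "same_block \<xi> \<mu>"
  shows "exponent \<mu> = exponent \<xi>" "saddle_exponent \<mu> = saddle_exponent \<xi>" "circles \<mu> = circles \<xi>"
proof -
  have w: "arc_width \<mu> = arc_width \<xi>" by (rule ext) (simp add: arc_width_def same_block_pos[OF assms])
  show s: "saddle_exponent \<mu> = saddle_exponent \<xi>"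
    by (rule ext) (simp add: saddle_exponent_def saddle_width_def w same_block_pos[OF assms])
  show c: "circles \<mu> = circles \<xi>"
    by (rule ext) (simp add: circles_def vertices_def same_block_outside(1)[OF assms])
  have p: "circle_pos \<mu> = circle_pos \<xi>" by (rule ext) (simp add: circle_pos_def same_block_pos[OF assms])
  show "exponent \<mu> = exponent \<xi>"
    by (intro ext)
      (simp add: exponent_def circle_exponent_def circle_width_def p w c cong: if_cong)
qed

section \<open>Diagrams without middle part\<close>

text \<open>An ordinary circle diagram written as a stacked one, with a vertical line at every star.
  The surgery procedure ends in this form.\<close>

definition closed_diagram :: "weight \<Rightarrow> weight \<Rightarrow> stacked" where
  "closed_diagram \<xi> \<mu> =
    \<lparr>lower_cups = cups \<xi>, middle = {}, verticals = stars \<xi>, upper_caps = cups \<mu>\<rparr>"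

definition product_diagram :: "weight \<Rightarrow> weight \<Rightarrow> weight \<Rightarrow> stacked" where
  "product_diagram \<xi> \<mu> \<eta> =
    \<lparr>lower_cups = cups \<xi>, middle = cups \<mu>, verticals = {}, upper_caps = cups \<eta>\<rparr>"

text \<open>Circles of an ordinary circle diagram as subsets of a single line; they link diagrams in
  which a vertex of the circle occurs once and twice.\<close>

definition component :: "arcs \<Rightarrow> arcs \<Rightarrow> int \<Rightarrow> int set" where
  "component A B x = {y. (x, y) \<in> (A \<union> A\<inverse> \<union> (B \<union> B\<inverse>))\<^sup>*}"

lemma component_refl: "x \<in> component A B x"
  by (simp add: component_def)

lemma component_mate:
  assumes "nc_matching S A" "nc_matching S B" "x \<in> S" "y \<in> component A B x"
  shows "y \<in> S" "mate A y \<in> component A B x" "mate B y \<in> component A B x"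
proof -
  have R: "(x, y) \<in> (A \<union> A\<inverse> \<union> (B \<union> B\<inverse>))\<^sup>*" using assms(4) by (simp add: component_def)
  then show y: "y \<in> S"
    by (induction rule: rtrancl_induct) (use assms nc_matchingD in blast)+
  have "(y, mate A y) \<in> A \<union> A\<inverse> \<union> (B \<union> B\<inverse>)" "(y, mate B y) \<in> A \<union> A\<inverse> \<union> (B \<union> B\<inverse>)"
    using mate_iff[OF assms(1) y] mate_iff[OF assms(2) y] by blast+
  then show "mate A y \<in> component A B x" "mate B y \<in> component A B x"
    using R unfolding component_def by (simp_all add: rtrancl_into_rtrancl)
qed

lemma component_induct:
  assumes "nc_matching S A" "nc_matching S B" "x \<in> S" "y \<in> component A B x"
    and "P x" "\<And>y. y \<in> S \<Longrightarrow> P y \<Longrightarrow> P (mate A y) \<and> P (mate B y)"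
  shows "P y"
proof -
  have "(x, y) \<in> (A \<union> A\<inverse> \<union> (B \<union> B\<inverse>))\<^sup>*" using assms(4) by (simp add: component_def)
  then have "y \<in> S \<and> P y"
  proof (induction rule: rtrancl_induct)
    case (step y z)
    have "z = mate A y \<or> z = mate B y"
      using step(2,3) mate_iff[OF assms(1)] mate_iff[OF assms(2)] by blast
    then show ?case using step(3) assms(6) mate_props(1)[OF assms(1)] mate_props(1)[OF assms(2)] by blast
  qed (use assms in simp)
  then show ?thesis by simp
qed

locale block =
  fixes \<xi> :: weight
  assumes wt: "is_weight \<xi>"
begin

definition member :: "weight \<Rightarrow> bool" where
  "member \<mu> \<longleftrightarrow> balanced_weight \<mu> \<and> same_block \<xi> \<mu>"

lemma member_matching: "member \<mu> \<Longrightarrow> nc_matching (stars \<xi>) (cups \<mu>)"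
  using nc_matching_cups same_block_outside(1) unfolding member_def by metis

lemma member_odd: "member \<mu> \<Longrightarrow> \<gamma> \<in> cups \<mu> \<Longrightarrow> odd (arc_width \<xi> \<gamma>)"
  using odd_arc_width[OF wt member_matching] .

lemma stacked_product:
  "member \<zeta> \<Longrightarrow> member \<mu> \<Longrightarrow> member \<eta> \<Longrightarrow> stacked_diagram \<xi> (product_diagram \<zeta> \<mu> \<eta>)"
  using finite_stars[OF wt] member_matching member_odd
  by unfold_locales (auto simp: product_diagram_def)

lemma stacked_closed:
  assumes "member \<zeta>" "member \<mu>"
  shows "stacked_diagram \<xi> (closed_diagram \<zeta> \<mu>)"
proof -
  have "stars \<zeta> = stars \<xi>" using assms same_block_outside(1) by (simp add: member_def)
  then show ?thesis
    using finite_stars[OF wt] member_matching member_odd assms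
    by unfold_locales (auto simp: closed_diagram_def nc_matching_def)
qed

lemma completed_product:
  "member \<zeta> \<Longrightarrow> completed \<xi> (product_diagram \<zeta> \<mu> \<eta>) = closed_diagram \<zeta> \<eta>"
  using same_block_outside(1)[of \<xi> \<zeta>] by (simp add: completed_def product_diagram_def closed_diagram_def member_def)

lemma circle_closed_diagram:
  assumes m: "member \<zeta>" "member \<mu>" and x: "x \<in> stars \<xi>"
  shows "circle (closed_diagram \<zeta> \<mu>) (l, x) = UNIV \<times> component (cups \<zeta>) (cups \<mu>) x"
proof -
  let ?D = "closed_diagram \<zeta> \<mu>" and ?X = "component (cups \<zeta>) (cups \<mu>) x"
  interpret stacked_diagram \<xi> ?D using stacked_closed m .
  note nc = member_matching[OF m(1)] member_matching[OF m(2)]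
  have v: "verticals ?D = stars \<xi>" "lower_cups ?D = cups \<zeta>" "upper_caps ?D = cups \<mu>"
    using m same_block_outside(1) by (simp_all add: closed_diagram_def member_def)
  have out: "outer ?D (k, y) \<in> {k} \<times> {mate (cups \<zeta>) y, mate (cups \<mu>) y}" for k y
    by (cases k) (simp_all add: v)
  have xV: "(l, x) \<in> V" using x by (simp add: vertices_def)
  have "closed_in \<xi> ?D (UNIV \<times> ?X)"
    unfolding closed_in_def image_subset_iff
  proof (intro conjI ballI)
    show "UNIV \<times> ?X \<subseteq> vertices \<xi>"
      using component_mate(1)[OF nc x] by (auto simp: vertices_def)
    fix w :: vertex assume w: "w \<in> UNIV \<times> ?X"
    then show "outer ?D w \<in> UNIV \<times> ?X"
      using out[of "fst w" "snd w"] component_mate[OF nc x, of "snd w"] by auto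
    show "inner ?D w \<in> UNIV \<times> ?X"
      using w component_mate(1)[OF nc x, of "snd w"] v by (cases w) auto
  qed
  then have "circle ?D (l, x) \<subseteq> UNIV \<times> ?X"
    by (rule circle_least) (simp add: component_refl)
  moreover have "UNIV \<times> {y} \<subseteq> circle ?D (l, x)" if "y \<in> ?X" for y
    using nc x that
  proof (rule component_induct)
    note cl = closed_circle[OF xV]
    have flip: "(flip k, y) \<in> circle ?D (l, x)" if "(k, y) \<in> circle ?D (l, x)" "y \<in> stars \<xi>" for k y
      using closed_in_iff(2)[OF cl, of "(k, y)"] that v by (auto simp: vertices_def)
    have both: "UNIV \<times> {y} \<subseteq> circle ?D (l, x)" if "(k, y) \<in> circle ?D (l, x)" "y \<in> stars \<xi>" for k y
    proof
      fix w :: vertex assume "w \<in> UNIV \<times> {y}"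
      then have "w = (k, y) \<or> w = (flip k, y)" by (cases w; cases "fst w"; cases k) auto
      then show "w \<in> circle ?D (l, x)" using that flip by auto
    qed
    show "UNIV \<times> {x} \<subseteq> circle ?D (l, x)" using both[OF circle_refl x] .
    fix y assume y: "y \<in> stars \<xi>" "UNIV \<times> {y} \<subseteq> circle ?D (l, x)"
    have "(Lower, mate (cups \<zeta>) y) \<in> circle ?D (l, x)" "(Upper, mate (cups \<mu>) y) \<in> circle ?D (l, x)"
      using closed_in_iff(1)[OF cl, of "(Lower, y)"] closed_in_iff(1)[OF cl, of "(Upper, y)"] y v
      by (auto simp: vertices_def)
    then show "UNIV \<times> {mate (cups \<zeta>) y} \<subseteq> circle ?D (l, x) \<and> UNIV \<times> {mate (cups \<mu>) y} \<subseteq> circle ?D (l, x)"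
      using both mate_props(1)[OF nc(1) y(1)] mate_props(1)[OF nc(2) y(1)] by blast
  qed
  ultimately show ?thesis by auto
qed

text \<open>Before any surgery no edge joins the two lines, so the circles are those of the two
  factors.\<close>

lemma circle_product_diagram:
  assumes m: "member \<zeta>" "member \<mu>" "member \<eta>" and x: "x \<in> stars \<xi>"
  shows "circle (product_diagram \<zeta> \<mu> \<eta>) (Lower, x) = {Lower} \<times> component (cups \<zeta>) (cups \<mu>) x"
    "circle (product_diagram \<zeta> \<mu> \<eta>) (Upper, x) = {Upper} \<times> component (cups \<mu>) (cups \<eta>) x"
proof -
  let ?D = "product_diagram \<zeta> \<mu> \<eta>"
  interpret stacked_diagram \<xi> ?D using stacked_product m .
  have D: "verticals ?D = {}" "lower_cups ?D = cups \<zeta>" "middle ?D = cups \<mu>" "upper_caps ?D = cups \<eta>"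
    by (simp_all add: product_diagram_def)
  \<comment> \<open>The two steps are compared as an unordered pair because \<open>outer\<close>
    follows the first matching on the lower line but the second one on the upper line.\<close>
  have gen: "circle ?D (l, x) = {l} \<times> component A B x"
    if nc: "nc_matching (stars \<xi>) A" "nc_matching (stars \<xi>) B"
      and AB: "\<And>y. {outer ?D (l, y), inner ?D (l, y)} = {(l, mate A y), (l, mate B y)}" for l A B
  proof -
    let ?X = "component A B x"
    have ab: "outer ?D (l, y) \<in> {(l, mate A y), (l, mate B y)}" "inner ?D (l, y) \<in> {(l, mate A y), (l, mate B y)}"
      "(l, mate A y) \<in> {outer ?D (l, y), inner ?D (l, y)}" "(l, mate B y) \<in> {outer ?D (l, y), inner ?D (l, y)}" for y
      using AB[of y] by blast+
    have xV: "(l, x) \<in> V" using x by (simp add: vertices_def)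
    note cl = closed_circle[OF xV]
    have "closed_in \<xi> ?D ({l} \<times> ?X)"
      unfolding closed_in_def image_subset_iff
    proof (intro conjI ballI)
      show "{l} \<times> ?X \<subseteq> vertices \<xi>"
        using component_mate(1)[OF nc x] by (auto simp: vertices_def)
      fix w assume "w \<in> {l} \<times> ?X"
      then obtain y where "w = (l, y)" "y \<in> ?X" by auto
      then show "outer ?D w \<in> {l} \<times> ?X" "inner ?D w \<in> {l} \<times> ?X"
        using ab(1,2)[of y] component_mate(2,3)[OF nc x, of y] by (auto simp del: inner.simps)
    qed
    then have "circle ?D (l, x) \<subseteq> {l} \<times> ?X"
      by (rule circle_least) (simp add: component_refl)
    moreover have "(l, y) \<in> circle ?D (l, x)" if "y \<in> ?X" for y
      using nc x that
    proof (rule component_induct)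
      show "(l, x) \<in> circle ?D (l, x)" by (rule circle_refl)
      fix y assume y: "y \<in> stars \<xi>" "(l, y) \<in> circle ?D (l, x)"
      have "(l, y) \<in> V" using y by (simp add: vertices_def)
      then have "outer ?D (l, y) \<in> circle ?D (l, x)" "inner ?D (l, y) \<in> circle ?D (l, x)"
        using closed_in_iff[OF cl, of "(l, y)"] y(2) by blast+
      then show "(l, mate A y) \<in> circle ?D (l, x) \<and> (l, mate B y) \<in> circle ?D (l, x)"
        using ab(3,4)[of y] by (auto simp del: inner.simps)
    qed
    ultimately show ?thesis by auto
  qed
  show "circle ?D (Lower, x) = {Lower} \<times> component (cups \<zeta>) (cups \<mu>) x"
    by (rule gen) (use m member_matching D in auto)
  show "circle ?D (Upper, x) = {Upper} \<times> component (cups \<mu>) (cups \<eta>) x"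
    by (rule gen) (use m member_matching D in auto)
qed

definition components :: "weight \<Rightarrow> weight \<Rightarrow> int set set" where
  "components \<zeta> \<mu> = component (cups \<zeta>) (cups \<mu>) ` stars \<xi>"

lemma components:
  assumes "member \<zeta>" "member \<mu>" "X \<in> components \<zeta> \<mu>"
  shows "finite X" "X \<noteq> {}"
proof -
  obtain x where x: "x \<in> stars \<xi>" "X = component (cups \<zeta>) (cups \<mu>) x"
    using assms(3) by (auto simp: components_def)
  then have "X \<subseteq> stars \<xi>"
    using component_mate(1)[OF member_matching[OF assms(1)] member_matching[OF assms(2)]] by blast
  then show "finite X" using finite_stars(1)[OF wt] finite_subset by blast
  show "X \<noteq> {}" using x component_refl by auto
qed

lemma UNIV_line: "(UNIV :: line set) = {Lower, Upper}"
  using line.exhaust by auto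

lemma circles_closed_diagram:
  assumes "member \<zeta>" "member \<mu>"
  shows "circles \<xi> (closed_diagram \<zeta> \<mu>) = (\<lambda>X. UNIV \<times> X) ` components \<zeta> \<mu>"
proof -
  have "circles \<xi> (closed_diagram \<zeta> \<mu>) = (\<lambda>x. UNIV \<times> component (cups \<zeta>) (cups \<mu>) x) ` snd ` vertices \<xi>"
    unfolding circles_def image_image using circle_closed_diagram[OF assms]
    by (intro image_cong refl) (auto simp: vertices_def)
  then show ?thesis by (simp add: vertices_def components_def image_image)
qed

lemma circles_product_diagram:
  assumes "member \<zeta>" "member \<mu>" "member \<eta>"
  shows "circles \<xi> (product_diagram \<zeta> \<mu> \<eta>) =
    (\<lambda>X. {Lower} \<times> X) ` components \<zeta> \<mu> \<union> (\<lambda>X. {Upper} \<times> X) ` components \<mu> \<eta>"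
proof -
  have "vertices \<xi> = Pair Lower ` stars \<xi> \<union> Pair Upper ` stars \<xi>"
    unfolding vertices_def UNIV_line by auto
  then have "circles \<xi> (product_diagram \<zeta> \<mu> \<eta>) =
    (\<lambda>x. circle (product_diagram \<zeta> \<mu> \<eta>) (Lower, x)) ` stars \<xi> \<union>
    (\<lambda>x. circle (product_diagram \<zeta> \<mu> \<eta>) (Upper, x)) ` stars \<xi>"
    by (simp add: circles_def image_Un image_image)
  also have "\<dots> = (\<lambda>x. {Lower} \<times> component (cups \<zeta>) (cups \<mu>) x) ` stars \<xi> \<union>
      (\<lambda>x. {Upper} \<times> component (cups \<mu>) (cups \<eta>) x) ` stars \<xi>"
    using circle_product_diagram[OF assms] by simp
  finally show ?thesis by (simp add: components_def image_image)
qed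

lemma inj_Times: "L \<noteq> {} \<Longrightarrow> inj_on (\<lambda>X. L \<times> X) \<X>"
  by (rule inj_onI) (auto simp: times_eq_iff)

lemma finite_components: "finite (components \<zeta> \<mu>)"
  unfolding components_def using finite_stars[OF wt] by simp

lemma product_parts_disjoint:
  assumes "member \<zeta>" "member \<mu>" "member \<eta>"
  shows "(\<lambda>X. {Lower} \<times> X) ` components \<zeta> \<mu> \<inter> (\<lambda>X. {Upper} \<times> X) ` components \<mu> \<eta> = {}"
  using components(2)[OF assms(1,2)] by blast

lemma card_circles_product:
  assumes "member \<zeta>" "member \<mu>" "member \<eta>"
  shows "card (circles \<xi> (product_diagram \<zeta> \<mu> \<eta>)) =
    card (circles \<xi> (closed_diagram \<zeta> \<mu>)) + card (circles \<xi> (closed_diagram \<mu> \<eta>))"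
  unfolding circles_product_diagram[OF assms] circles_closed_diagram[OF assms(1,2)] circles_closed_diagram[OF assms(2,3)]
  by (subst card_Un_disjoint) (simp_all add: finite_components product_parts_disjoint[OF assms] card_image inj_Times)

text \<open>\<open>UNIV \<times> X\<close> contains each vertex twice, but the exponent sees only
  arcs and the rightmost vertex. The middle arcs of the product serve as caps of the first factor
  and as cups of the second.\<close>

lemma circle_exponent_product:
  assumes m: "member \<zeta>" "member \<mu>" "member \<eta>"
  shows "X \<in> components \<zeta> \<mu> \<Longrightarrow> circle_exponent \<xi> (product_diagram \<zeta> \<mu> \<eta>) (\<nu>, \<nu>') ({Lower} \<times> X) =
      circle_exponent \<xi> (closed_diagram \<zeta> \<mu>) (\<nu>, \<nu>) (UNIV \<times> X)"
    "X \<in> components \<mu> \<eta> \<Longrightarrow> circle_exponent \<xi> (product_diagram \<zeta> \<mu> \<eta>) (\<nu>, \<nu>') ({Upper} \<times> X) =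
      circle_exponent \<xi> (closed_diagram \<mu> \<eta>) (\<nu>', \<nu>') (UNIV \<times> X)"
proof -
  have r: "rightmost (L \<times> X) = Max X" if "L \<noteq> {}" for L and X :: "int set"
    using that by (simp add: rightmost_def)
  have cw1: "clockwise (\<nu>, \<nu>') ({Lower} \<times> X) \<longleftrightarrow> \<nu> (Max X) = Down" if "finite X" "X \<noteq> {}" for X
    using Max_in[OF that] by (auto simp: clockwise_def r)
  have cw2: "clockwise (\<nu>, \<nu>') ({Upper} \<times> X) \<longleftrightarrow> \<nu>' (Max X) = Down" if "finite X" "X \<noteq> {}" for X
    using Max_in[OF that] by (auto simp: clockwise_def r)
  have cw: "clockwise (\<nu>, \<nu>) (UNIV \<times> X) \<longleftrightarrow> \<nu> (Max X) = Down" if "finite X" "X \<noteq> {}" for X \<nu>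
    using Max_in[OF that] by (auto simp: clockwise_def r UNIV_line)
  show "X \<in> components \<zeta> \<mu> \<Longrightarrow> circle_exponent \<xi> (product_diagram \<zeta> \<mu> \<eta>) (\<nu>, \<nu>') ({Lower} \<times> X) =
      circle_exponent \<xi> (closed_diagram \<zeta> \<mu>) (\<nu>, \<nu>) (UNIV \<times> X)"
    using components[OF m(1,2), of X] cw1[of X] cw[of X \<nu>]
    by (simp add: circle_exponent_def circle_pos_def r circle_width_def product_diagram_def closed_diagram_def)
  show "X \<in> components \<mu> \<eta> \<Longrightarrow> circle_exponent \<xi> (product_diagram \<zeta> \<mu> \<eta>) (\<nu>, \<nu>') ({Upper} \<times> X) =
      circle_exponent \<xi> (closed_diagram \<mu> \<eta>) (\<nu>', \<nu>') (UNIV \<times> X)"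
    using components[OF m(2,3), of X] cw2[of X] cw[of X \<nu>']
    by (simp add: circle_exponent_def circle_pos_def r circle_width_def product_diagram_def closed_diagram_def)
qed

lemma exponent_product:
  assumes m: "member \<zeta>" "member \<mu>" "member \<eta>"
  shows "exponent \<xi> (product_diagram \<zeta> \<mu> \<eta>) (\<nu>, \<nu>') =
    exponent \<xi> (closed_diagram \<zeta> \<mu>) (\<nu>, \<nu>) + exponent \<xi> (closed_diagram \<mu> \<eta>) (\<nu>', \<nu>')"
  unfolding exponent_def circles_product_diagram[OF m] circles_closed_diagram[OF m(1,2)] circles_closed_diagram[OF m(2,3)]
  by (subst sum.union_disjoint)
    (simp_all add: finite_components product_parts_disjoint[OF m] sum.reindex inj_Times circle_exponent_product[OF m])

end

section \<open>Products of diagrams\<close>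

text \<open>The reference weight that trivializes the split cocycle. The choice depends on the block
  only, so all factors of a product share it.\<close>

definition base_weight :: "weight \<Rightarrow> weight" where
  "base_weight \<xi> = (SOME \<zeta>. balanced_weight \<zeta> \<and> same_block \<xi> \<zeta>)"

definition circle_number :: "weight \<Rightarrow> weight \<Rightarrow> nat" where
  "circle_number \<xi> \<mu> = card (circles \<xi> (closed_diagram \<xi> \<mu>))"

text \<open>The number of splits in a product with outer weights \<open>\<xi>\<close> and
  \<open>base_weight \<xi>\<close> and middle weight \<open>\<mu>\<close>. Within a block, truncated
  subtraction and halving are exact by the lemma of the same name.\<close>

definition split_number :: "weight \<Rightarrow> weight \<Rightarrow> nat" where
  "split_number \<xi> \<mu> = (let \<zeta> = base_weight \<xi> in
     (card (cups \<mu>) + circle_number \<xi> \<zeta> - circle_number \<xi> \<mu> - circle_number \<mu> \<zeta>) div 2)"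

text \<open>The saddles belong to the right-hand weight: a product uses up those of the middle
  weight, recorded by the first factor, while the second factor and the result share those of the
  last weight.\<close>

fun normalizer :: "'k::comm_ring_1 \<Rightarrow> 'k \<Rightarrow> diagram \<Rightarrow> 'k" where
  "normalizer \<epsilon> \<omega> (\<xi>, \<nu>, \<mu>) = sign_power \<epsilon> (sum (saddle_exponent \<xi>) (cups \<mu>)) *
     (\<epsilon> * \<omega>) ^ split_number \<xi> \<mu> * sign_power \<epsilon> (exponent \<xi> (closed_diagram \<xi> \<mu>) (\<nu>, \<nu>))"

lemma normalizer_inverse:
  fixes \<epsilon> :: "'k::comm_ring_1"
  assumes "\<epsilon> * \<epsilon> = 1" "\<omega> * \<omega>' = 1"
  shows "normalizer \<epsilon> \<omega> X * normalizer \<epsilon> \<omega>' X = 1"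
proof -
  have "(\<epsilon> * \<omega>) ^ n * (\<epsilon> * \<omega>') ^ n = 1" for n
    unfolding power_mult_distrib[symmetric] using assms by (metis mult.assoc mult.left_commute mult_1 power_one)
  moreover obtain \<xi> \<nu> \<mu> where X: "X = (\<xi>, \<nu>, \<mu>)" by (cases X)
  ultimately have p: "(\<epsilon> * \<omega>) ^ split_number \<xi> \<mu> * (\<epsilon> * \<omega>') ^ split_number \<xi> \<mu> = 1" by blast
  have a: "a * b * c * (a * b' * c) = a * a * (c * c) * (b * b')" for a b b' c :: 'k
    by (simp add: ac_simps)
  show ?thesis
    unfolding X normalizer.simps a sign_power_square[OF assms(1)] by (simp add: p)
qed

lemma base_weight:
  assumes "balanced_weight \<xi>"
  shows "balanced_weight (base_weight \<xi>)" "same_block \<xi> (base_weight \<xi>)"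
  using someI[of "\<lambda>\<zeta>. balanced_weight \<zeta> \<and> same_block \<xi> \<zeta>" \<xi>] assms same_block_refl
  unfolding base_weight_def by blast+

lemma base_weight_cong:
  assumes "same_block \<xi> \<mu>"
  shows "base_weight \<mu> = base_weight \<xi>"
proof -
  have "same_block \<mu> \<zeta> \<longleftrightarrow> same_block \<xi> \<zeta>" for \<zeta>
    using assms same_block_sym same_block_trans by blast
  then show ?thesis by (simp add: base_weight_def)
qed

context block
begin

lemma member_circles: "member \<mu> \<Longrightarrow> circles \<mu> = circles \<xi>"
  unfolding member_def using exponent_cong(3) by blast

lemma member_circle_number: "member \<mu> \<Longrightarrow> circle_number \<mu> \<eta> = card (circles \<xi> (closed_diagram \<mu> \<eta>))"
  by (simp add: circle_number_def member_circles)

lemma member_card_cups: "member \<mu> \<Longrightarrow> 2 * card (cups \<mu>) = card (stars \<xi>)"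
  using nc_matching_card[OF member_matching finite_stars(1)[OF wt]] by simp

lemma member_base:
  assumes "member \<mu>"
  shows "member (base_weight \<mu>)" "base_weight \<mu> = base_weight \<xi>"
proof -
  show "member (base_weight \<mu>)"
    using assms base_weight[of \<mu>] same_block_trans unfolding member_def by blast
  show "base_weight \<mu> = base_weight \<xi>"
    using assms base_weight_cong by (simp add: member_def)
qed

lemma product_diagram_simps:
  "middle (product_diagram \<zeta> \<mu> \<eta>) = cups \<mu>"
  by (simp add: product_diagram_def)

lemma product_twist:
  fixes \<epsilon> :: "'k::comm_ring_1"
  assumes e: "\<epsilon> * \<epsilon> = 1" and m: "member \<zeta>" "member \<mu>" "member \<eta>"
    and f: "\<And>\<nu>. lookup f \<nu> = \<kappa> * sign_power \<epsilon> (exponent \<xi> (product_diagram \<zeta> \<mu> \<eta>) \<nu>) * lookup g \<nu>"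
  obtains n where
    "2 * n + circle_number \<zeta> \<mu> + circle_number \<mu> \<eta> = card (cups \<mu>) + circle_number \<zeta> \<eta>"
    "\<And>\<nu>. lookup (snd ((surgery_step \<alpha> \<epsilon> \<omega> \<xi> ^^ card (cups \<mu>)) (product_diagram \<zeta> \<mu> \<eta>, f))) \<nu> =
      \<kappa> * sign_power \<epsilon> (sum (saddle_exponent \<xi>) (cups \<mu>)) * (\<epsilon> * \<omega>) ^ n *
      sign_power \<epsilon> (exponent \<xi> (closed_diagram \<zeta> \<eta>) \<nu>) *
      lookup (snd ((surgery_step \<alpha> 1 1 \<xi> ^^ card (cups \<mu>)) (product_diagram \<zeta> \<mu> \<eta>, g))) \<nu>"
  using iterated_surgery_twist[OF e stacked_product[OF m] f, of \<alpha> \<omega>]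
  unfolding product_diagram_simps completed_product[OF m(1)] card_circles_product[OF m]
    member_circle_number[OF m(1)] member_circle_number[OF m(2)] by (auto simp: add.assoc)

lemma split_number:
  assumes m: "member \<zeta>" "member \<mu>"
  shows "2 * split_number \<zeta> \<mu> + circle_number \<zeta> \<mu> + circle_number \<mu> (base_weight \<xi>) =
    card (cups \<mu>) + circle_number \<zeta> (base_weight \<xi>)"
proof -
  have b: "member (base_weight \<xi>)" "base_weight \<zeta> = base_weight \<xi>"
    using member_base[OF m(1)] by auto
  obtain n where n: "2 * n + circle_number \<zeta> \<mu> + circle_number \<mu> (base_weight \<xi>) =
      card (cups \<mu>) + circle_number \<zeta> (base_weight \<xi>)"
    \<comment> \<open>Only the count of splits is wanted, so the twist is instantiated over the
      integers with trivial sign and zero elements.\<close>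
    by (rule product_twist[of "1::int" \<zeta> \<mu> "base_weight \<xi>" 0 1 0, OF _ m b(1)]) simp_all
  have "card (cups \<mu>) + circle_number \<zeta> (base_weight \<xi>) - circle_number \<zeta> \<mu> - circle_number \<mu> (base_weight \<xi>) = 2 * n"
    unfolding n[symmetric] by linarith
  then have "split_number \<zeta> \<mu> = n"
    unfolding split_number_def Let_def b(2) by (simp only:)
  then show ?thesis using n by (simp only:)
qed

text \<open>The cocycle identity. After inserting the three equations for
  \<open>split_number\<close>, the circle numbers cancel, those with the base weight as well as the
  others.\<close>

lemma split_number_add:
  assumes m: "member \<zeta>" "member \<mu>" "member \<eta>"
    and n: "2 * n + circle_number \<zeta> \<mu> + circle_number \<mu> \<eta> = card (cups \<mu>) + circle_number \<zeta> \<eta>"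
  shows "n + split_number \<zeta> \<eta> = split_number \<zeta> \<mu> + split_number \<mu> \<eta>"
  using split_number[OF m(1,2)] split_number[OF m(2,3)] split_number[OF m(1,3)] n
    member_card_cups[OF m(2)] member_card_cups[OF m(3)] by linarith

end

section \<open>Structure constants of the arc algebra\<close>

lemma oriented_diagramsD:
  assumes "(\<zeta>, \<nu>, \<mu>) \<in> oriented_diagrams"
  shows "balanced_weight \<zeta>" "balanced_weight \<mu>" "balanced_block \<zeta>" "same_block \<zeta> \<mu>" "same_block \<zeta> \<nu>"
    "oriented_arcs (cups \<zeta>) \<nu>" "oriented_arcs (cups \<mu>) \<nu>"
  using assms by (auto simp: oriented_diagrams_def)

text \<open>The block is represented by the weight in the middle, as in the definition of the product.\<close>

lemma product_members:
  assumes "(\<zeta>, \<nu>, \<mu>) \<in> oriented_diagrams" "(\<mu>, \<nu>', \<eta>) \<in> oriented_diagrams"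
  shows "block \<mu>" "block.member \<mu> \<zeta>" "block.member \<mu> \<mu>" "block.member \<mu> \<eta>"
proof -
  note d = oriented_diagramsD[OF assms(1)] oriented_diagramsD[OF assms(2)]
  show b: "block \<mu>" using d(2) by unfold_locales (simp add: balanced_weight_def)
  show "block.member \<mu> \<zeta>" "block.member \<mu> \<mu>" "block.member \<mu> \<eta>"
    using d same_block_sym same_block_refl by (simp_all add: block.member_def[OF b])
qed

definition product_run :: "'k::comm_ring_1 \<Rightarrow> 'k \<Rightarrow> 'k \<Rightarrow> weight \<Rightarrow> weight \<Rightarrow> weight \<Rightarrow> weight \<Rightarrow> weight \<Rightarrow>
    (orientation \<Rightarrow>\<^sub>0 'k)" where
  "product_run \<alpha> \<epsilon> \<omega> \<zeta> \<nu> \<mu> \<nu>' \<eta> = snd ((surgery_step \<alpha> \<epsilon> \<omega> \<mu> ^^ card (cups \<mu>))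
     (product_diagram \<zeta> \<mu> \<eta>, single (\<nu>, \<nu>') 1))"

text \<open>At the end every star carries a vertical line, which forces equal labels on both lines;
  off the stars the block prescribes the labels. So the collapse to a single line loses nothing and
  never adds two terms.\<close>

lemma keys_product_run:
  assumes "(\<zeta>, \<nu>, \<mu>) \<in> oriented_diagrams" "(\<mu>, \<nu>', \<eta>) \<in> oriented_diagrams"
    and "(\<nu>1, \<nu>2) \<in> keys (product_run \<alpha> \<epsilon> \<omega> \<zeta> \<nu> \<mu> \<nu>' \<eta>)"
  shows "\<nu>2 = \<nu>1" "(\<zeta>, \<nu>1, \<eta>) \<in> oriented_diagrams"
proof -
  note d = oriented_diagramsD[OF assms(1)] oriented_diagramsD[OF assms(2)]
  interpret block \<mu> using product_members[OF assms(1,2)] by simp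
  note m = product_members[OF assms(1,2)]
  have \<mu>\<zeta>: "same_block \<mu> \<zeta>" using d(4) same_block_sym by blast
  have "(\<nu>, \<nu>') \<in> orientations \<mu> (product_diagram \<zeta> \<mu> \<eta>)"
    using d same_block_trans[OF \<mu>\<zeta>] by (auto simp: orientations_def product_diagram_def oriented_arcs_def)
  then have "keys (product_run \<alpha> \<epsilon> \<omega> \<zeta> \<nu> \<mu> \<nu>' \<eta>) \<subseteq> orientations \<mu> (closed_diagram \<zeta> \<eta>)"
    using keys_iterated_surgery[of "single (\<nu>, \<nu>') 1" \<mu> "product_diagram \<zeta> \<mu> \<eta>" "card (cups \<mu>)" \<alpha> \<epsilon> \<omega>]
      fst_iterated_surgery[OF stacked_product[OF m(2,3,4)], of \<alpha> \<epsilon> \<omega> "single (\<nu>, \<nu>') 1"]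
    unfolding product_run_def product_diagram_simps completed_product[OF m(2)] by (auto split: if_splits)
  then have o: "(\<nu>1, \<nu>2) \<in> orientations \<mu> (closed_diagram \<zeta> \<eta>)" using assms(3) by blast
  then have sb: "same_block \<mu> \<nu>1" "same_block \<mu> \<nu>2" by (auto simp: orientations_def)
  show eq: "\<nu>2 = \<nu>1"
  proof
    fix i show "\<nu>2 i = \<nu>1 i"
    proof (cases "i \<in> stars \<mu>")
      case True
      then show ?thesis using o same_block_outside(1)[OF \<mu>\<zeta>] by (auto simp: orientations_def closed_diagram_def)
    next
      case False
      then show ?thesis using same_block_outside(2)[OF sb(1)] same_block_outside(2)[OF sb(2)] by simp
    qed
  qed
  show "(\<zeta>, \<nu>1, \<eta>) \<in> oriented_diagrams"
    using o eq d same_block_trans[OF d(4)] sb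
    by (auto simp: oriented_diagrams_def orientations_def closed_diagram_def oriented_arcs_def)
qed

lemma lookup_diagram_mult:
  assumes "(\<zeta>, \<nu>, \<mu>) \<in> oriented_diagrams" "(\<mu>, \<nu>', \<eta>) \<in> oriented_diagrams"
  shows "lookup (diagram_mult \<alpha> \<epsilon> \<omega> (\<zeta>, \<nu>, \<mu>) (\<mu>, \<nu>', \<eta>)) (a, b, c) =
    (if a = \<zeta> \<and> c = \<eta> then lookup (product_run \<alpha> \<epsilon> \<omega> \<zeta> \<nu> \<mu> \<nu>' \<eta>) (b, b) else 0)"
proof -
  let ?F = "product_run \<alpha> \<epsilon> \<omega> \<zeta> \<nu> \<mu> \<nu>' \<eta>"
  have eq: "diagram_mult \<alpha> \<epsilon> \<omega> (\<zeta>, \<nu>, \<mu>) (\<mu>, \<nu>', \<eta>) =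
      (\<Sum>(\<nu>1, \<nu>2) \<in> keys ?F. single (\<zeta>, \<nu>1, \<eta>) (lookup ?F (\<nu>1, \<nu>2)))"
    by (simp add: product_run_def product_diagram_def Let_def)
  have "lookup (diagram_mult \<alpha> \<epsilon> \<omega> (\<zeta>, \<nu>, \<mu>) (\<mu>, \<nu>', \<eta>)) (a, b, c) =
      (\<Sum>p \<in> keys ?F. if p = (b, b) then (if a = \<zeta> \<and> c = \<eta> then lookup ?F (b, b) else 0) else 0)"
    unfolding eq lookup_sum
  proof (rule sum.cong)
    fix p assume p: "p \<in> keys ?F"
    obtain \<nu>1 \<nu>2 where p': "p = (\<nu>1, \<nu>2)" by force
    then have "p = (\<nu>1, \<nu>1)" using keys_product_run(1)[OF assms] p by auto
    then show "lookup (case p of (\<nu>1, \<nu>2) \<Rightarrow> single (\<zeta>, \<nu>1, \<eta>) (lookup ?F (\<nu>1, \<nu>2))) (a, b, c) =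
        (if p = (b, b) then (if a = \<zeta> \<and> c = \<eta> then lookup ?F (b, b) else 0) else 0)"
      by (auto simp: lookup_single when_def)
  qed simp
  also have "\<dots> = (if a = \<zeta> \<and> c = \<eta> then lookup ?F (b, b) else 0)"
    by (auto simp: in_keys_iff)
  finally show ?thesis .
qed

lemma keys_diagram_mult:
  assumes "X \<in> oriented_diagrams" "Y \<in> oriented_diagrams"
  shows "keys (diagram_mult \<alpha> \<epsilon> \<omega> X Y) \<subseteq> oriented_diagrams"
proof -
  obtain \<zeta> \<nu> \<mu> \<mu>' \<nu>' \<eta> where XY: "X = (\<zeta>, \<nu>, \<mu>)" "Y = (\<mu>', \<nu>', \<eta>)" by (metis surj_pair)
  show ?thesis
  proof (cases "\<mu> = \<mu>'")
    case True
    show ?thesis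
    proof
      fix Z assume Z: "Z \<in> keys (diagram_mult \<alpha> \<epsilon> \<omega> X Y)"
      obtain a b c where abc: "Z = (a, b, c)" by (metis surj_pair)
      then have "a = \<zeta>" "c = \<eta>" "(b, b) \<in> keys (product_run \<alpha> \<epsilon> \<omega> \<zeta> \<nu> \<mu> \<nu>' \<eta>)"
        using Z lookup_diagram_mult[of \<zeta> \<nu> \<mu> \<nu>' \<eta> \<alpha> \<epsilon> \<omega> a b c] assms True
        unfolding XY by (auto simp: in_keys_iff split: if_splits simp del: diagram_mult.simps)
      then show "Z \<in> oriented_diagrams"
        using keys_product_run(2)[of \<zeta> \<nu> \<mu> \<nu>' \<eta> b b] assms True abc XY by blast
    qed
  qed (simp add: XY)
qed

text \<open>The exponents of the two factors add up to that of the starting diagram,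
  \<open>normalizer\<close> of \<open>Z\<close> removes that of the final diagram, and
  \<open>split_number_add\<close> converts the number of splits.\<close>

lemma diagram_mult_twist:
  fixes \<epsilon> :: "'k::comm_ring_1"
  assumes e: "\<epsilon> * \<epsilon> = 1" and "X \<in> oriented_diagrams" "Y \<in> oriented_diagrams"
  shows "lookup (diagram_mult \<alpha> \<epsilon> \<omega> X Y) Z * normalizer \<epsilon> \<omega> Z =
    normalizer \<epsilon> \<omega> X * normalizer \<epsilon> \<omega> Y * lookup (diagram_mult \<alpha> 1 1 X Y) Z"
proof -
  obtain \<zeta> \<nu> \<mu> \<mu>' \<nu>' \<eta> a b c where XYZ: "X = (\<zeta>, \<nu>, \<mu>)" "Y = (\<mu>', \<nu>', \<eta>)" "Z = (a, b, c)"
    by (metis surj_pair)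
  show ?thesis
  proof (cases "\<mu>' = \<mu> \<and> a = \<zeta> \<and> c = \<eta>")
    case True
    then have XYZ: "X = (\<zeta>, \<nu>, \<mu>)" "Y = (\<mu>, \<nu>', \<eta>)" "Z = (\<zeta>, b, \<eta>)" using XYZ by auto
    have o: "(\<zeta>, \<nu>, \<mu>) \<in> oriented_diagrams" "(\<mu>, \<nu>', \<eta>) \<in> oriented_diagrams" using assms XYZ by auto
    interpret block \<mu> using product_members[OF o] by simp
    note m = product_members(2-4)[OF o]
    let ?x = "\<lambda>\<zeta> \<eta> \<nu>. sign_power \<epsilon> (exponent \<mu> (closed_diagram \<zeta> \<eta>) (\<nu>, \<nu>))"
    let ?s = "\<lambda>\<eta>. sign_power \<epsilon> (sum (saddle_exponent \<mu>) (cups \<eta>))"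
    define \<kappa> where "\<kappa> = ?x \<zeta> \<mu> \<nu> * ?x \<mu> \<eta> \<nu>'"
    have \<kappa>: "\<kappa> = sign_power \<epsilon> (exponent \<mu> (product_diagram \<zeta> \<mu> \<eta>) (\<nu>, \<nu>'))"
      unfolding \<kappa>_def exponent_product[OF m] sign_power_add[OF e] ..
    \<comment> \<open>The sign of the initial orientation squares to 1, so with this sign as
      \<open>\<kappa>\<close> the starting element is its own twist.\<close>
    have single: "lookup (single (\<nu>, \<nu>') 1) \<rho> =
        \<kappa> * sign_power \<epsilon> (exponent \<mu> (product_diagram \<zeta> \<mu> \<eta>) \<rho>) * lookup (single (\<nu>, \<nu>') 1) \<rho>" for \<rho>
      by (simp add: lookup_single when_def \<kappa> sign_power_square[OF e])
    obtain n where n: "2 * n + circle_number \<zeta> \<mu> + circle_number \<mu> \<eta> = card (cups \<mu>) + circle_number \<zeta> \<eta>"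
      "\<And>\<rho>. lookup (product_run \<alpha> \<epsilon> \<omega> \<zeta> \<nu> \<mu> \<nu>' \<eta>) \<rho> =
        \<kappa> * ?s \<mu> * (\<epsilon> * \<omega>) ^ n * sign_power \<epsilon> (exponent \<mu> (closed_diagram \<zeta> \<eta>) \<rho>) *
        lookup (product_run \<alpha> 1 1 \<zeta> \<nu> \<mu> \<nu>' \<eta>) \<rho>"
      unfolding product_run_def using product_twist[OF e m single] by metis
    have nX: "normalizer \<epsilon> \<omega> X = ?s \<mu> * (\<epsilon> * \<omega>) ^ split_number \<zeta> \<mu> * ?x \<zeta> \<mu> \<nu>"
      and nY: "normalizer \<epsilon> \<omega> Y = ?s \<eta> * (\<epsilon> * \<omega>) ^ split_number \<mu> \<eta> * ?x \<mu> \<eta> \<nu>'"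
      and nZ: "normalizer \<epsilon> \<omega> Z = ?s \<eta> * (\<epsilon> * \<omega>) ^ split_number \<zeta> \<eta> * ?x \<zeta> \<eta> b"
      using m(1) exponent_cong(1,2)[of \<mu> \<zeta>] by (simp_all add: XYZ member_def)
    have p: "(\<epsilon> * \<omega>) ^ n * (\<epsilon> * \<omega>) ^ split_number \<zeta> \<eta> = (\<epsilon> * \<omega>) ^ split_number \<zeta> \<mu> * (\<epsilon> * \<omega>) ^ split_number \<mu> \<eta>"
      unfolding power_add[symmetric] split_number_add[OF m n(1)] ..
    let ?r = "lookup (product_run \<alpha> 1 1 \<zeta> \<nu> \<mu> \<nu>' \<eta>) (b, b)"
    have "lookup (product_run \<alpha> \<epsilon> \<omega> \<zeta> \<nu> \<mu> \<nu>' \<eta>) (b, b) * normalizer \<epsilon> \<omega> Z =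
        \<kappa> * ?s \<mu> * ?s \<eta> * ((\<epsilon> * \<omega>) ^ n * (\<epsilon> * \<omega>) ^ split_number \<zeta> \<eta>) * (?x \<zeta> \<eta> b * ?x \<zeta> \<eta> b) * ?r"
      unfolding n(2) nZ by (simp only: ac_simps)
    also have "\<dots> = normalizer \<epsilon> \<omega> X * normalizer \<epsilon> \<omega> Y * ?r"
      unfolding p sign_power_square[OF e] nX nY \<kappa>_def by (simp only: ac_simps mult_1_left)
    finally show ?thesis
      unfolding XYZ lookup_diagram_mult[OF o] by (simp del: normalizer.simps)
  next
    case False
    have "lookup (diagram_mult \<alpha>' \<epsilon>' \<omega>' X Y) Z = 0" for \<alpha>' \<epsilon>' \<omega>' :: 'k
    proof (cases "\<mu>' = \<mu>")
      case True
      then have "(\<mu>, \<nu>', \<eta>) \<in> oriented_diagrams" "(\<zeta>, \<nu>, \<mu>) \<in> oriented_diagrams" using assms XYZ by auto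
      then show ?thesis
        using lookup_diagram_mult[of \<zeta> \<nu> \<mu> \<nu>' \<eta> \<alpha>' \<epsilon>' \<omega>' a b c] False True XYZ
        by (auto simp del: diagram_mult.simps)
    qed (simp add: XYZ)
    then show ?thesis by simp
  qed
qed

section \<open>Change of rings\<close>

locale ring_hom_1 =
  fixes h :: "'s::comm_ring_1 \<Rightarrow> 'k::comm_ring_1"
  assumes hom: "is_ring_hom h"
begin

lemma hom_simps [simp]:
  "h 1 = 1" "h (x + y) = h x + h y" "h (x * y) = h x * h y" "h 0 = 0" "h (- x) = - h x" "h (x - y) = h x - h y"
  "h (x ^ n) = h x ^ n" "h (sum g A) = sum (\<lambda>i. h (g i)) A"
proof -
  show 1: "h 1 = 1" "h (x + y) = h x + h y" "h (x * y) = h x * h y" for x y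
    using hom by (auto simp: is_ring_hom_def)
  show 0: "h 0 = 0" using 1(2)[of 0 0] by simp
  show neg: "h (- x) = - h x" for x
    using 1(2)[of x "- x"] 0 by (simp add: eq_neg_iff_add_eq_0 add.commute)
  show "h (x - y) = h x - h y" using 1(2)[of x "- y"] neg by simp
  show "h (x ^ n) = h x ^ n" by (induction n) (simp_all add: 1)
  show "h (sum g A) = sum (\<lambda>i. h (g i)) A"
    by (induction A rule: infinite_finite_induct) (simp_all add: 0 1)
qed

lemma hom_sign_power [simp]: "h (sign_power \<epsilon> n) = sign_power (h \<epsilon>) n"
  by (simp add: sign_power_def)

lemma hom_surgery_coeff:
  "surgery_coeff (h \<alpha>) (h \<epsilon>) (h \<omega>) \<xi> D \<gamma> \<nu> \<nu>' = h (surgery_coeff \<alpha> \<epsilon> \<omega> \<xi> D \<gamma> \<nu> \<nu>')"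
proof -
  have "merge_coeff (h \<alpha>) (h \<epsilon>) \<xi> D \<gamma> C1 C2 C \<nu> \<nu>' = h (merge_coeff \<alpha> \<epsilon> \<xi> D \<gamma> C1 C2 C \<nu> \<nu>')" for C1 C2 C
    unfolding merge_coeff_def Let_def nesting_sign_def
    by (cases "clockwise \<nu> C1"; cases "clockwise \<nu> C2"; cases "clockwise \<nu>' C") simp_all
  moreover have "split_coeff (h \<alpha>) (h \<epsilon>) (h \<omega>) \<xi> D' \<gamma> C Ci Cj \<nu> \<nu>' = h (split_coeff \<alpha> \<epsilon> \<omega> \<xi> D' \<gamma> C Ci Cj \<nu> \<nu>')" for D' C Ci Cj
    unfolding split_coeff_def Let_def nesting_sign_def
    by (cases "clockwise \<nu> C"; cases "clockwise \<nu>' Ci"; cases "clockwise \<nu>' Cj") simp_all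
  ultimately show ?thesis
    unfolding surgery_coeff_def Let_def by (simp only: if_distrib[of h] hom_simps)
qed

lemma hom_iterated_surgery:
  assumes "\<And>\<nu>. lookup f \<nu> = h (lookup g \<nu>)"
  shows "lookup (snd ((surgery_step (h \<alpha>) (h \<epsilon>) (h \<omega>) \<xi> ^^ n) (D, f))) \<nu> =
    h (lookup (snd ((surgery_step \<alpha> \<epsilon> \<omega> \<xi> ^^ n) (D, g))) \<nu>)"
  using assms
proof (induction n arbitrary: D f g)
  case (Suc n)
  \<comment> \<open>\<open>h\<close> may kill coefficients, so the sums are taken over the larger
    support of \<open>g\<close>.\<close>
  have "keys f \<subseteq> keys g"
    using Suc.prems by (auto simp: in_keys_iff)
  note l = lookup_surgery[OF finite_keys this, where \<alpha> = "h \<alpha>" and \<epsilon> = "h \<epsilon>" and \<omega> = "h \<omega>" and \<xi> = \<xi>]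
    lookup_surgery[OF finite_keys order_refl, where f = g and \<alpha> = \<alpha> and \<epsilon> = \<epsilon> and \<omega> = \<omega> and \<xi> = \<xi>]
  show ?case
    unfolding surgery_step_Suc by (rule Suc.IH) (simp add: l Suc.prems hom_surgery_coeff)
qed simp

lemma hom_diagram_mult:
  assumes "X \<in> oriented_diagrams" "Y \<in> oriented_diagrams"
  shows "lookup (diagram_mult (h \<alpha>) (h \<epsilon>) (h \<omega>) X Y) Z =
    h (lookup (diagram_mult \<alpha> \<epsilon> \<omega> X Y) Z)"
proof -
  obtain \<zeta> \<nu> \<mu> \<mu>' \<nu>' \<eta> a b c where XYZ: "X = (\<zeta>, \<nu>, \<mu>)" "Y = (\<mu>', \<nu>', \<eta>)" "Z = (a, b, c)"
    by (metis surj_pair)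
  show ?thesis
  proof (cases "\<mu> = \<mu>'")
    case True
    have "lookup (product_run (h \<alpha>) (h \<epsilon>) (h \<omega>) \<zeta> \<nu> \<mu> \<nu>' \<eta>) (b, b) =
        h (lookup (product_run \<alpha> \<epsilon> \<omega> \<zeta> \<nu> \<mu> \<nu>' \<eta>) (b, b))"
      unfolding product_run_def by (rule hom_iterated_surgery) (simp add: lookup_single when_def)
    then show ?thesis
      using assms XYZ True by (simp add: lookup_diagram_mult del: diagram_mult.simps)
  qed (simp add: XYZ)
qed

end

section \<open>Arc algebras over varying rings\<close>

lemma lookup_scale [simp]: "lookup (scale c x) X = c * lookup x X"
  by (simp add: scale_def Poly_Mapping.map.rep_eq when_def)

lemma scale_simps [simp]:
  "scale c (x + y) = scale c x + scale c y" "scale c 0 = 0" "scale 0 x = 0" "scale 1 x = x"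
  by (rule poly_mapping_eqI; simp add: lookup_add algebra_simps)+

lemma scale_scale: "scale c (scale d x) = scale (c * d) x"
  by (rule poly_mapping_eqI) (simp add: mult.assoc)

lemma scale_add_left: "scale (c + d) x = scale c x + scale d x"
  by (rule poly_mapping_eqI) (simp add: lookup_add algebra_simps)

lemma scale_sum: "scale c (sum f I) = (\<Sum>i\<in>I. scale c (f i))"
  by (rule poly_mapping_eqI) (simp add: lookup_sum sum_distrib_left)

lemma keys_scale: "keys (scale c x) \<subseteq> keys x"
  by (auto simp: in_keys_iff)

lemma poly_mapping_eq_sum_single:
  assumes "finite F" "keys x \<subseteq> F"
  shows "x = (\<Sum>X\<in>F. scale (lookup x X) (single X (1::'k::comm_ring_1)))"
proof (rule poly_mapping_eqI)
  fix Y
  have "(\<Sum>X\<in>F. lookup x X * (1 when X = Y)) = (\<Sum>X\<in>F. if X = Y then lookup x Y else 0)"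
    by (rule sum.cong) (auto simp: when_def)
  also have "\<dots> = lookup x Y"
    using assms by (auto simp: in_keys_iff)
  finally show "lookup x Y =
      lookup (\<Sum>X\<in>F. scale (lookup x X) (single X 1)) Y"
    by (simp add: lookup_sum lookup_single)
qed

section \<open>Bilinearity of the product, and diagonal base change\<close>

definition product :: "'k::comm_ring_1 \<Rightarrow> 'k \<Rightarrow> 'k \<Rightarrow> (diagram \<Rightarrow>\<^sub>0 'k) \<Rightarrow> (diagram \<Rightarrow>\<^sub>0 'k) \<Rightarrow> (diagram \<Rightarrow>\<^sub>0 'k)" where
  "product \<alpha> \<epsilon> \<omega> = amult (arc_algebra \<alpha> \<epsilon> \<omega>)"

lemma arc_algebra_simps [simp]:
  "acarrier (arc_algebra \<alpha> \<epsilon> \<omega>) = {x. keys x \<subseteq> oriented_diagrams}"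
  "aadd (arc_algebra \<alpha> \<epsilon> \<omega>) = (+)" "ascale (arc_algebra \<alpha> \<epsilon> \<omega>) = scale"
  "amult (arc_algebra \<alpha> \<epsilon> \<omega>) = product \<alpha> \<epsilon> \<omega>"
  by (simp_all add: arc_algebra_def product_def)

lemma lookup_product:
  assumes "finite K" "finite L" "keys x \<subseteq> K" "keys y \<subseteq> L"
  shows "lookup (product \<alpha> \<epsilon> \<omega> x y) Z = (\<Sum>X\<in>K. \<Sum>Y\<in>L.
    lookup x X * lookup y Y * lookup (diagram_mult \<alpha> \<epsilon> \<omega> X Y) Z)"
proof -
  have "lookup (product \<alpha> \<epsilon> \<omega> x y) Z = (\<Sum>X\<in>keys x. \<Sum>Y\<in>keys y.
    lookup x X * lookup y Y * lookup (diagram_mult \<alpha> \<epsilon> \<omega> X Y) Z)"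
    by (simp add: product_def arc_algebra_def lookup_sum del: arc_algebra_simps)
  also have "\<dots> = (\<Sum>X\<in>keys x. \<Sum>Y\<in>L.
    lookup x X * lookup y Y * lookup (diagram_mult \<alpha> \<epsilon> \<omega> X Y) Z)"
    using assms by (intro sum.cong[OF refl] sum.mono_neutral_left) (auto simp: in_keys_iff)
  also have "\<dots> = (\<Sum>X\<in>K. \<Sum>Y\<in>L.
    lookup x X * lookup y Y * lookup (diagram_mult \<alpha> \<epsilon> \<omega> X Y) Z)"
    using assms by (intro sum.mono_neutral_left) (auto simp: in_keys_iff)
  finally show ?thesis .
qed

lemma product_add:
  "product \<alpha> \<epsilon> \<omega> (x + x') y = product \<alpha> \<epsilon> \<omega> x y + product \<alpha> \<epsilon> \<omega> x' y"
  "product \<alpha> \<epsilon> \<omega> x (y + y') = product \<alpha> \<epsilon> \<omega> x y + product \<alpha> \<epsilon> \<omega> x y'"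
proof -
  let ?K = "keys x \<union> keys x'" and ?L = "keys y \<union> keys y'"
  have K: "finite ?K" "keys x \<subseteq> ?K" "keys x' \<subseteq> ?K" "keys (x + x') \<subseteq> ?K"
    and L: "finite ?L" "keys y \<subseteq> ?L" "keys y' \<subseteq> ?L" "keys (y + y') \<subseteq> ?L"
    using keys_add[of x x'] keys_add[of y y'] by auto
  show "product \<alpha> \<epsilon> \<omega> (x + x') y = product \<alpha> \<epsilon> \<omega> x y + product \<alpha> \<epsilon> \<omega> x' y"
    by (rule poly_mapping_eqI)
      (simp add: lookup_add lookup_product[OF K(1) L(1) K(2) L(2)] lookup_product[OF K(1) L(1) K(3) L(2)]
        lookup_product[OF K(1) L(1) K(4) L(2)] algebra_simps sum.distrib)
  show "product \<alpha> \<epsilon> \<omega> x (y + y') = product \<alpha> \<epsilon> \<omega> x y + product \<alpha> \<epsilon> \<omega> x y'"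
    by (rule poly_mapping_eqI)
      (simp add: lookup_add lookup_product[OF K(1) L(1) K(2) L(2)] lookup_product[OF K(1) L(1) K(2) L(3)]
        lookup_product[OF K(1) L(1) K(2) L(4)] algebra_simps sum.distrib)
qed

lemma product_scale:
  "product \<alpha> \<epsilon> \<omega> (scale c x) (scale d y) = scale (c * d) (product \<alpha> \<epsilon> \<omega> x y)"
  by (rule poly_mapping_eqI)
    (simp add: lookup_product[OF finite_keys finite_keys keys_scale keys_scale]
      lookup_product[OF finite_keys finite_keys order_refl order_refl, where x = x and y = y] sum_distrib_left ac_simps)

lemma product_zero: "product \<alpha> \<epsilon> \<omega> 0 y = 0" "product \<alpha> \<epsilon> \<omega> x 0 = 0"
  using product_add(1)[of \<alpha> \<epsilon> \<omega> 0 0 y] product_add(2)[of \<alpha> \<epsilon> \<omega> x 0 0] by simp_all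

lemma product_sum:
  "product \<alpha> \<epsilon> \<omega> (sum f I) (sum g J) = (\<Sum>i\<in>I. \<Sum>j\<in>J. product \<alpha> \<epsilon> \<omega> (f i) (g j))"
proof -
  have 1: "product \<alpha> \<epsilon> \<omega> (sum f I) y = (\<Sum>i\<in>I. product \<alpha> \<epsilon> \<omega> (f i) y)" for y
    by (induction I rule: infinite_finite_induct) (simp_all add: product_zero product_add)
  have 2: "product \<alpha> \<epsilon> \<omega> x (sum g J) = (\<Sum>j\<in>J. product \<alpha> \<epsilon> \<omega> x (g j))" for x
    by (induction J rule: infinite_finite_induct) (simp_all add: product_zero product_add)
  show ?thesis by (simp only: 1, simp only: 2)
qed

lemma keys_sum_subset:
  assumes "\<And>i. i \<in> I \<Longrightarrow> keys (f i) \<subseteq> S"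
  shows "keys (sum f I) \<subseteq> S"
  using assms
proof (induction I rule: infinite_finite_induct)
  case (insert i I)
  then have "keys (f i) \<union> keys (sum f I) \<subseteq> S" by simp
  then show ?case using insert keys_add[of "f i" "sum f I"] by auto
qed simp_all

lemma keys_product:
  assumes "keys x \<subseteq> oriented_diagrams" "keys y \<subseteq> oriented_diagrams"
  shows "keys (product \<alpha> \<epsilon> \<omega> x y) \<subseteq> oriented_diagrams"
proof -
  have "keys (scale c (diagram_mult \<alpha> \<epsilon> \<omega> X Y)) \<subseteq> oriented_diagrams"
    if "X \<in> keys x" "Y \<in> keys y" for c X Y
    by (rule order_trans[OF keys_scale keys_diagram_mult]) (use that assms in auto)
  then show ?thesis
    unfolding product_def arc_algebra_def alg.simps by (intro keys_sum_subset)
qed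

definition rescale :: "(diagram \<Rightarrow> 'k::comm_ring_1) \<Rightarrow> (diagram \<Rightarrow>\<^sub>0 'k) \<Rightarrow> (diagram \<Rightarrow>\<^sub>0 'k)" where
  "rescale v x = (\<Sum>X\<in>keys x. single X (v X * lookup x X))"

lemma lookup_rescale [simp]: "lookup (rescale v x) X = v X * lookup x X"
proof -
  have "lookup (rescale v x) X =
      (\<Sum>Y\<in>keys x. if Y = X then v X * lookup x X else 0)"
    unfolding rescale_def lookup_sum by (rule sum.cong) (auto simp: lookup_single when_def)
  also have "\<dots> = v X * lookup x X"
    by (simp add: in_keys_iff)
  finally show ?thesis .
qed

lemma keys_rescale: "keys (rescale v x) \<subseteq> keys x"
  by (auto simp: in_keys_iff)

lemma rescale_linear:
  "rescale v (x + y) = rescale v x + rescale v y" "rescale v (scale c x) = scale c (rescale v x)"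
  by (rule poly_mapping_eqI; simp add: lookup_add algebra_simps)+

lemma rescale_product:
  assumes x: "keys x \<subseteq> oriented_diagrams" and y: "keys y \<subseteq> oriented_diagrams"
    and v: "\<And>X Y Z. X \<in> oriented_diagrams \<Longrightarrow> Y \<in> oriented_diagrams \<Longrightarrow>
      lookup (diagram_mult \<alpha> \<epsilon> \<omega> X Y) Z * v Z =
      v X * v Y * lookup (diagram_mult \<alpha> \<epsilon>' \<omega>' X Y) Z"
  shows "rescale v (product \<alpha> \<epsilon> \<omega> x y) = product \<alpha> \<epsilon>' \<omega>' (rescale v x) (rescale v y)"
proof (rule poly_mapping_eqI)
  fix Z
  have "v Z * (lookup x X * lookup y Y * lookup (diagram_mult \<alpha> \<epsilon> \<omega> X Y) Z) =
      v X * lookup x X * (v Y * lookup y Y) * lookup (diagram_mult \<alpha> \<epsilon>' \<omega>' X Y) Z"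
    if "X \<in> keys x" "Y \<in> keys y" for X Y
  proof -
    have "v Z * (lookup x X * lookup y Y * lookup (diagram_mult \<alpha> \<epsilon> \<omega> X Y) Z) =
        lookup x X * lookup y Y * (lookup (diagram_mult \<alpha> \<epsilon> \<omega> X Y) Z * v Z)"
      by (simp only: ac_simps)
    also have "\<dots> = v X * lookup x X * (v Y * lookup y Y) *
        lookup (diagram_mult \<alpha> \<epsilon>' \<omega>' X Y) Z"
      using that x y by (subst v) (auto simp: ac_simps)
    finally show ?thesis .
  qed
  then show "lookup (rescale v (product \<alpha> \<epsilon> \<omega> x y)) Z =
      lookup (product \<alpha> \<epsilon>' \<omega>' (rescale v x) (rescale v y)) Z"
    by (simp add: lookup_product[OF finite_keys finite_keys keys_rescale keys_rescale]
        lookup_product[OF finite_keys finite_keys order_refl order_refl, where x = x and y = y] sum_distrib_left)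
qed

section \<open>Scalar extension\<close>

locale scalar_extension_hom = ring_hom_1 h for h :: "'s::comm_ring_1 \<Rightarrow> 'k::comm_ring_1" +
  fixes \<alpha> \<epsilon> \<omega> :: 's
begin

abbreviation "A \<equiv> arc_algebra \<alpha> \<epsilon> \<omega>"
abbreviation "G \<equiv> tensor_free A :: ((diagram \<Rightarrow>\<^sub>0 's) \<times> 'k \<Rightarrow>\<^sub>0 int) monoid"
abbreviation "N \<equiv> tensor_null h A"
abbreviation "bmult \<equiv> product (h \<alpha>) (h \<epsilon>) (h \<omega>)"

lemma lookup_map_h [simp]: "lookup (Poly_Mapping.map h a) X = h (lookup a X)"
  by (simp add: Poly_Mapping.map.rep_eq when_def)

lemma map_h_linear:
  "Poly_Mapping.map h (a + b) = Poly_Mapping.map h a + Poly_Mapping.map h b"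
  "Poly_Mapping.map h (scale s a) = scale (h s) (Poly_Mapping.map h a)"
  "Poly_Mapping.map h (single X 1) = single X 1"
  by (rule poly_mapping_eqI; simp add: lookup_add lookup_single when_def)+

lemma keys_map_h: "keys (Poly_Mapping.map h a) \<subseteq> keys a"
  by (auto simp: in_keys_iff)

lemma map_h_product:
  assumes "keys a \<subseteq> oriented_diagrams" "keys b \<subseteq> oriented_diagrams"
  shows "Poly_Mapping.map h (product \<alpha> \<epsilon> \<omega> a b) = bmult (Poly_Mapping.map h a) (Poly_Mapping.map h b)"
proof (rule poly_mapping_eqI)
  fix Z
  have "(\<Sum>X\<in>keys a. \<Sum>Y\<in>keys b. h (lookup a X) * h (lookup b Y) *
      h (lookup (diagram_mult \<alpha> \<epsilon> \<omega> X Y) Z)) =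
    (\<Sum>X\<in>keys a. \<Sum>Y\<in>keys b. h (lookup a X) * h (lookup b Y) *
      lookup (diagram_mult (h \<alpha>) (h \<epsilon>) (h \<omega>) X Y) Z)"
    using assms by (intro sum.cong refl) (auto simp: hom_diagram_mult subsetD)
  then show "lookup (Poly_Mapping.map h (product \<alpha> \<epsilon> \<omega> a b)) Z =
      lookup (bmult (Poly_Mapping.map h a) (Poly_Mapping.map h b)) Z"
    by (simp add: lookup_product[OF finite_keys finite_keys keys_map_h keys_map_h]
        lookup_product[OF finite_keys finite_keys order_refl order_refl, where x = a and y = b])
qed

text \<open>The balanced map sending \<open>(a, c)\<close> to \<open>c\<close> times the image of
  \<open>a\<close> under \<open>h\<close>, extended additively. On classes it becomes the comparison
  of the tensor product with the arc algebra for \<open>h \<alpha>\<close>,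
  \<open>h \<epsilon>\<close>, \<open>h \<omega>\<close>.\<close>

definition total :: "((diagram \<Rightarrow>\<^sub>0 's) \<times> 'k \<Rightarrow>\<^sub>0 int) \<Rightarrow> (diagram \<Rightarrow>\<^sub>0 'k)" where
  "total z = (\<Sum>p\<in>keys z. scale (of_int (lookup z p) * snd p) (Poly_Mapping.map h (fst p)))"

lemma total_add [simp]: "total (z + w) = total z + total w"
  unfolding total_def
  by (rule setsum_keys_plus_distrib[where f = "\<lambda>p n. scale (of_int n * snd p) (Poly_Mapping.map h (fst p))"])
    (simp_all add: distrib_right scale_add_left)

lemma total_0 [simp]: "total 0 = 0"
  by (simp add: total_def)

lemma total_uminus [simp]: "total (- z) = - total z"
  using total_add[of z "- z"] by (simp add: eq_neg_iff_add_eq_0 add.commute)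

lemma total_diff [simp]: "total (z - w) = total z - total w"
  using total_add[of z "- w"] by simp

lemma total_sum: "total (sum f I) = (\<Sum>i\<in>I. total (f i))"
  by (induction I rule: infinite_finite_induct) simp_all

lemma total_single: "total (single (a, c) n) = scale (of_int n * c) (Poly_Mapping.map h a)"
  by (cases "n = 0") (simp_all add: total_def)

lemma carrier_G [simp]:
  "z \<in> carrier G \<longleftrightarrow> (\<forall>p \<in> keys z. keys (fst p) \<subseteq> oriented_diagrams)"
  unfolding tensor_free_def carrier_free_Abelian_group_iff by (auto simp: subset_iff)

lemma G_simps [simp]: "monoid.mult G = (+)" "one G = 0"
  by (simp_all add: tensor_free_def free_Abelian_group_def)

lemma comm_group_G: "comm_group G"
  by (simp add: tensor_free_def abelian_free_Abelian_group)

lemma inv_G: "z \<in> carrier G \<Longrightarrow> inv\<^bsub>G\<^esub> z = - z"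
  unfolding tensor_free_def by simp

lemma total_free_scale: "total (free_scale c z) = scale c (total z)"
  unfolding free_scale_def total_def[of z] scale_sum total_sum
  by (rule sum.cong) (auto simp: total_single scale_scale ac_simps split: prod.splits)

lemma free_scale_closed: "z \<in> carrier G \<Longrightarrow> free_scale c z \<in> carrier G"
proof -
  assume z: "z \<in> carrier G"
  have "keys (free_scale c z) \<subseteq> {p. keys (fst p) \<subseteq> oriented_diagrams}"
    unfolding free_scale_def
  proof (rule keys_sum_subset)
    fix p assume "p \<in> keys z"
    then have "keys (fst p) \<subseteq> oriented_diagrams" using z by simp
    then show "keys (case p of (a, b) \<Rightarrow> single (a, c * b) (lookup z (a, b)))
        \<subseteq> {p. keys (fst p) \<subseteq> oriented_diagrams}"
      by (simp add: case_prod_beta)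
  qed
  then show ?thesis by auto
qed

lemma total_free_mult:
  assumes z: "z \<in> carrier G" and w: "w \<in> carrier G"
  shows "total (free_mult A z w) = bmult (total z) (total w)"
proof -
  have "total (free_mult A z w) = (\<Sum>p\<in>keys z. \<Sum>q\<in>keys w.
      total (single (product \<alpha> \<epsilon> \<omega> (fst p) (fst q), snd p * snd q)
        (lookup z p * lookup w q)))"
    unfolding free_mult_def by (simp add: total_sum case_prod_beta)
  also have "\<dots> = (\<Sum>p\<in>keys z. \<Sum>q\<in>keys w.
      bmult (scale (of_int (lookup z p) * snd p) (Poly_Mapping.map h (fst p)))
        (scale (of_int (lookup w q) * snd q) (Poly_Mapping.map h (fst q))))"
  proof (intro sum.cong refl)
    fix p q assume "p \<in> keys z" "q \<in> keys w"
    then have "keys (fst p) \<subseteq> oriented_diagrams" "keys (fst q) \<subseteq> oriented_diagrams"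
      using z w by auto
    from map_h_product[OF this]
    show "total (single (product \<alpha> \<epsilon> \<omega> (fst p) (fst q), snd p * snd q)
        (lookup z p * lookup w q)) =
      bmult (scale (of_int (lookup z p) * snd p) (Poly_Mapping.map h (fst p)))
        (scale (of_int (lookup w q) * snd q) (Poly_Mapping.map h (fst q)))"
      by (simp add: total_single product_scale ac_simps)
  qed
  finally show ?thesis
    unfolding total_def[of z] total_def[of w] product_sum .
qed

lemma free_mult_closed:
  assumes z: "z \<in> carrier G" and w: "w \<in> carrier G"
  shows "free_mult A z w \<in> carrier G"
proof -
  have "keys (free_mult A z w) \<subseteq> {p. keys (fst p) \<subseteq> oriented_diagrams}"
    unfolding free_mult_def case_prod_beta
  proof (intro keys_sum_subset)
    fix p q assume "p \<in> keys z" "q \<in> keys w"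
    then have "keys (fst p) \<subseteq> oriented_diagrams" "keys (fst q) \<subseteq> oriented_diagrams"
      using z w by simp_all
    from keys_product[OF this, of \<alpha> \<epsilon> \<omega>]
    show "keys (single (amult A (fst p) (fst q), snd p * snd q)
        (lookup z (fst p, snd p) * lookup w (fst q, snd q)))
        \<subseteq> {p. keys (fst p) \<subseteq> oriented_diagrams}"
      by simp
  qed
  then show ?thesis by auto
qed

lemma total_closed:
  assumes "z \<in> carrier G"
  shows "keys (total z) \<subseteq> oriented_diagrams"
  unfolding total_def
proof (rule keys_sum_subset)
  fix p assume "p \<in> keys z"
  then have "keys (fst p) \<subseteq> oriented_diagrams" using assms by auto
  then show "keys (scale (of_int (lookup z p) * snd p) (Poly_Mapping.map h (fst p))) \<subseteq> oriented_diagrams"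
    using keys_scale keys_map_h by (meson order_trans)
qed

abbreviation pair :: "(diagram \<Rightarrow>\<^sub>0 's) \<Rightarrow> 'k \<Rightarrow> ((diagram \<Rightarrow>\<^sub>0 's) \<times> 'k \<Rightarrow>\<^sub>0 int)" where
  "pair a c \<equiv> single (a, c) 1"

lemma pair_closed: "keys a \<subseteq> oriented_diagrams \<Longrightarrow> pair a c \<in> carrier G"
  by simp

lemma G_closed: "z \<in> carrier G \<Longrightarrow> w \<in> carrier G \<Longrightarrow> z + w \<in> carrier G"
  "z \<in> carrier G \<Longrightarrow> - z \<in> carrier G" "z \<in> carrier G \<Longrightarrow> w \<in> carrier G \<Longrightarrow> z - w \<in> carrier G"
proof -
  interpret comm_group G by (rule comm_group_G)
  show add: "z + w \<in> carrier G" if "z \<in> carrier G" "w \<in> carrier G" for z w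
    using m_closed[OF that] by (simp only: G_simps)
  show minus: "- z \<in> carrier G" if "z \<in> carrier G" for z
    using inv_closed[OF that] inv_G[OF that] by (simp only:)
  show "z \<in> carrier G \<Longrightarrow> w \<in> carrier G \<Longrightarrow> z - w \<in> carrier G"
    using add[of z "- w"] minus[of w] by (simp only: diff_conv_add_uminus)
qed

lemma relators:
  "keys a \<subseteq> oriented_diagrams \<Longrightarrow> keys b \<subseteq> oriented_diagrams \<Longrightarrow>
    pair (a + b) c - pair a c - pair b c \<in> tensor_relators h A"
  "keys a \<subseteq> oriented_diagrams \<Longrightarrow> pair a (c + c') - pair a c - pair a c' \<in> tensor_relators h A"
  "keys a \<subseteq> oriented_diagrams \<Longrightarrow> pair (scale s a) c - pair a (h s * c) \<in> tensor_relators h A"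
  unfolding tensor_relators_def Let_def arc_algebra_simps by blast+

lemma relator_cases:
  assumes "r \<in> tensor_relators h A"
  obtains a b c where "keys a \<subseteq> oriented_diagrams" "keys b \<subseteq> oriented_diagrams"
      "r = pair (a + b) c - pair a c - pair b c"
  | a c c' where "keys a \<subseteq> oriented_diagrams" "r = pair a (c + c') - pair a c - pair a c'"
  | s a c where "keys a \<subseteq> oriented_diagrams" "r = pair (scale s a) c - pair a (h s * c)"
  using assms unfolding tensor_relators_def Let_def arc_algebra_simps by blast

lemma relators_closed: "tensor_relators h A \<subseteq> carrier G"
proof
  fix r assume "r \<in> tensor_relators h A"
  then show "r \<in> carrier G"
  proof (cases rule: relator_cases)
    case (1 a b c)
    then have "keys (a + b) \<subseteq> oriented_diagrams" using keys_add[of a b] by auto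
    then show ?thesis using 1 by (auto intro!: G_closed pair_closed simp del: carrier_G)
  next
    case (2 a c c')
    then show ?thesis by (auto intro!: G_closed pair_closed simp del: carrier_G)
  next
    case (3 s a c)
    then have "keys (scale s a) \<subseteq> oriented_diagrams" using keys_scale[of s a] by auto
    then show ?thesis using 3 by (auto intro!: G_closed pair_closed simp del: carrier_G)
  qed
qed

lemma subgroup_N: "subgroup N G"
proof -
  interpret comm_group G by (rule comm_group_G)
  show ?thesis unfolding tensor_null_def by (rule generate_is_subgroup[OF relators_closed])
qed

lemma N_closed: "0 \<in> N" "z \<in> N \<Longrightarrow> w \<in> N \<Longrightarrow> z + w \<in> N" "z \<in> N \<Longrightarrow> - z \<in> N" "z \<in> N \<Longrightarrow> w \<in> N \<Longrightarrow> z - w \<in> N"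
  "z \<in> N \<Longrightarrow> z \<in> carrier G"
proof -
  show 1: "z \<in> carrier G" if "z \<in> N" for z using subgroup.mem_carrier[OF subgroup_N that] .
  show "0 \<in> N" using subgroup.one_closed[OF subgroup_N] by (simp only: G_simps)
  show 2: "z + w \<in> N" if "z \<in> N" "w \<in> N" for z w
    using subgroup.m_closed[OF subgroup_N that] by (simp only: G_simps)
  show 3: "- z \<in> N" if "z \<in> N" for z
    using subgroup.m_inv_closed[OF subgroup_N that] inv_G[OF 1[OF that]] by (simp only:)
  show "z \<in> N \<Longrightarrow> w \<in> N \<Longrightarrow> z - w \<in> N"
    using 2[of z "- w"] 3[of w] by (simp only: diff_conv_add_uminus)
qed

lemma relators_N: "r \<in> tensor_relators h A \<Longrightarrow> r \<in> N"
  unfolding tensor_null_def by (rule generate.incl)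

lemma total_N:
  assumes "z \<in> N"
  shows "total z = 0"
proof -
  have rel: "total r = 0" if "r \<in> tensor_relators h A" for r
    using that
    by (cases rule: relator_cases) (simp_all add: total_single map_h_linear scale_add_left scale_scale mult.commute)
  show ?thesis
    using assms unfolding tensor_null_def
  proof (induction rule: generate.induct)
    case (inv r)
    then have "r \<in> carrier G" using relators_closed by blast
    then show ?case using inv_G[of r] rel[OF inv] by (simp del: carrier_G)
  qed (simp_all add: rel)
qed

text \<open>The normal form of a tensor: one summand \<open>X \<otimes> g X\<close> for each basis
  diagram.\<close>

definition spread :: "diagram set \<Rightarrow> (diagram \<Rightarrow> 'k) \<Rightarrow> ((diagram \<Rightarrow>\<^sub>0 's) \<times> 'k \<Rightarrow>\<^sub>0 int)" where
  "spread F g = (\<Sum>X\<in>F. pair (single X 1) (g X))"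

lemma N_sum: "(\<And>i. i \<in> I \<Longrightarrow> f i \<in> N) \<Longrightarrow> sum f I \<in> N"
  by (induction I rule: infinite_finite_induct) (simp_all add: N_closed)

lemma single_oriented: "X \<in> oriented_diagrams \<Longrightarrow> keys (single X (1::'s)) \<subseteq> oriented_diagrams"
  by simp

lemma spread_add:
  assumes "F \<subseteq> oriented_diagrams"
  shows "spread F (\<lambda>X. g X + g' X) - spread F g - spread F g' \<in> N"
proof -
  have "spread F (\<lambda>X. g X + g' X) - spread F g - spread F g' =
      (\<Sum>X\<in>F. pair (single X 1) (g X + g' X) - pair (single X 1) (g X) - pair (single X 1) (g' X))"
    by (simp add: spread_def sum_subtractf)
  also have "\<dots> \<in> N"
    using assms by (intro N_sum relators_N relators(2) single_oriented) blast
  finally show ?thesis .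
qed

lemma spread_zero:
  assumes "F \<subseteq> oriented_diagrams"
  shows "spread F (\<lambda>X. 0) \<in> N"
  using N_closed(3)[OF spread_add[OF assms, of "\<lambda>X. 0" "\<lambda>X. 0"]] by simp

lemma spread_diff:
  assumes "F \<subseteq> oriented_diagrams"
  shows "spread F (\<lambda>X. g X - g' X) - (spread F g - spread F g') \<in> N"
  using N_closed(3)[OF spread_add[OF assms, of "\<lambda>X. g X - g' X" g']] by (simp add: algebra_simps)

text \<open>Additivity in the first argument splits a basis expansion into its terms, and the scalar
  relation moves each coefficient into the second factor.\<close>

lemma pair_spread:
  assumes F: "finite F" "F \<subseteq> oriented_diagrams"
  shows "pair (\<Sum>X\<in>F. scale (g X) (single X 1)) c - spread F (\<lambda>X. h (g X) * c) \<in> N"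
  using F
proof (induction F rule: finite_induct)
  case empty
  \<comment> \<open>\<open>pair 0 c\<close> is a nonzero generator of the free group; the additivity
    relation for \<open>0 + 0\<close> puts it into \<open>N\<close>.\<close>
  have "pair (0 + 0) c - pair 0 c - pair 0 c \<in> N"
    by (intro relators_N relators(1)) simp_all
  then have "- pair 0 c \<in> N" by simp
  then have "pair 0 c \<in> N" using N_closed(3) by fastforce
  then show ?case by (simp add: spread_def)
next
  case (insert X F)
  let ?b = "single X (1::'s)" and ?r = "\<Sum>X\<in>F. scale (g X) (single X 1)"
  have kb: "keys ?b \<subseteq> oriented_diagrams" "keys (scale (g X) ?b) \<subseteq> oriented_diagrams"
    using insert.prems keys_scale[of "g X" ?b] by auto
  have kr: "keys ?r \<subseteq> oriented_diagrams"
  proof (rule keys_sum_subset)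
    fix Y assume "Y \<in> F"
    then show "keys (scale (g Y) (single Y 1)) \<subseteq> oriented_diagrams"
      using insert.prems keys_scale[of "g Y" "single Y 1"] by auto
  qed
  have "pair (scale (g X) ?b + ?r) c - pair (scale (g X) ?b) c - pair ?r c \<in> N"
    by (intro relators_N relators(1) kb kr)
  moreover have "pair (scale (g X) ?b) c - pair ?b (h (g X) * c) \<in> N"
    by (intro relators_N relators(3) kb)
  moreover have "pair ?r c - spread F (\<lambda>X. h (g X) * c) \<in> N"
    using insert by simp
  ultimately have "(pair (scale (g X) ?b + ?r) c - pair (scale (g X) ?b) c - pair ?r c) +
      ((pair (scale (g X) ?b) c - pair ?b (h (g X) * c)) + (pair ?r c - spread F (\<lambda>X. h (g X) * c))) \<in> N"
    by (intro N_closed(2))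
  then show ?case
    using insert.hyps by (simp add: spread_def algebra_simps)
qed

text \<open>The claim is made for all sufficiently large \<open>F\<close> instead of the support of
  \<open>total z\<close>: a difference can have smaller support, and the induction needs one index
  set for both of its parts.\<close>

lemma spread_total:
  assumes "z \<in> carrier G"
  shows "\<exists>F0. finite F0 \<and> F0 \<subseteq> oriented_diagrams \<and>
    (\<forall>F. finite F \<and> F0 \<subseteq> F \<and> F \<subseteq> oriented_diagrams \<longrightarrow> z - spread F (lookup (total z)) \<in> N)"
proof -
  have "keys z \<subseteq> {p. keys (fst p) \<subseteq> oriented_diagrams}"
    using assms by auto
  then show ?thesis
  proof (induction z rule: frag_induction)
    case zero
    have "0 - spread F (\<lambda>X. 0) \<in> N" if "F \<subseteq> oriented_diagrams" for F
      using N_closed(3)[OF spread_zero[OF that]] by simp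
    moreover have "lookup (total 0) = (\<lambda>X. 0)" by (simp add: fun_eq_iff)
    ultimately show ?case by (intro exI[of _ "{}"]) simp
  next
    case (one p)
    obtain a c where p: "p = (a, c)" by force
    have "pair a c - spread F (lookup (total (pair a c))) \<in> N"
      if F: "finite F" "keys a \<subseteq> F" "F \<subseteq> oriented_diagrams" for F
    proof -
      have "lookup (total (pair a c)) = (\<lambda>X. h (lookup a X) * c)"
        by (rule ext) (simp add: total_single mult.commute)
      then show ?thesis
        using pair_spread[OF F(1,3), of "lookup a" c] poly_mapping_eq_sum_single[OF F(1,2)] by simp
    qed
    then show ?case using one p by (intro exI[of _ "keys a"]) simp
  next
    case (diff z w)
    then obtain F1 F2 where F: "finite F1" "F1 \<subseteq> oriented_diagrams" "finite F2" "F2 \<subseteq> oriented_diagrams"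
      and N1: "\<And>F. finite F \<Longrightarrow> F1 \<subseteq> F \<Longrightarrow> F \<subseteq> oriented_diagrams \<Longrightarrow> z - spread F (lookup (total z)) \<in> N"
      and N2: "\<And>F. finite F \<Longrightarrow> F2 \<subseteq> F \<Longrightarrow> F \<subseteq> oriented_diagrams \<Longrightarrow> w - spread F (lookup (total w)) \<in> N"
      by metis
    have "z - w - spread F (lookup (total (z - w))) \<in> N"
      if "finite F" "F1 \<union> F2 \<subseteq> F" "F \<subseteq> oriented_diagrams" for F
    proof -
      let ?z = "lookup (total z)" and ?w = "lookup (total w)"
      have "(z - spread F ?z) - (w - spread F ?w) - (spread F (\<lambda>X. ?z X - ?w X) - (spread F ?z - spread F ?w)) \<in> N"
        using that by (intro N_closed(4) N1 N2 spread_diff) auto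
      moreover have "lookup (total (z - w)) = (\<lambda>X. ?z X - ?w X)"
        by (rule ext) (simp add: lookup_minus)
      ultimately show ?thesis by (simp add: algebra_simps)
    qed
    then show ?case using F by (intro exI[of _ "F1 \<union> F2"]) simp
  qed
qed

text \<open>One inclusion is the validity of the relations under \<open>total\<close>. Conversely,
  an element with vanishing total is congruent to the normal form with all coefficients 0.\<close>

lemma N_eq: "N = {z \<in> carrier G. total z = 0}"
proof (intro equalityI subsetI)
  fix z assume "z \<in> N"
  then show "z \<in> {z \<in> carrier G. total z = 0}" using N_closed(5) total_N by (simp del: carrier_G)
next
  fix z assume "z \<in> {z \<in> carrier G. total z = 0}"
  then have z: "z \<in> carrier G" "total z = 0" by blast+
  obtain F where F: "F \<subseteq> oriented_diagrams" "z - spread F (lookup (total z)) \<in> N"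
    using spread_total[OF z(1)] by blast
  moreover have "lookup (total z) = (\<lambda>X. 0)" using z(2) by (simp add: fun_eq_iff)
  ultimately show "z \<in> N"
    using N_closed(2)[OF F(2) spread_zero[OF F(1)]] by simp
qed

text \<open>The isomorphism from the tensor product to the algebra with specialized parameters sends a
  coset to the common value of \<open>total\<close> on it; its inverse sends an element to its fibre.\<close>

definition fibre :: "(diagram \<Rightarrow>\<^sub>0 'k) \<Rightarrow> ((diagram \<Rightarrow>\<^sub>0 's) \<times> 'k \<Rightarrow>\<^sub>0 int) set" where
  "fibre x = {z \<in> carrier G. total z = x}"

lemma tensor_class_eq:
  assumes z: "z \<in> carrier G"
  shows "tensor_class h A z = fibre (total z)"
proof (intro equalityI subsetI)
  fix w assume "w \<in> tensor_class h A z"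
  then obtain n where "n \<in> N" "w = n + z" by (auto simp: tensor_class_def r_coset_def)
  then show "w \<in> fibre (total z)"
    using z N_closed(5) total_N G_closed(1) by (simp add: fibre_def del: carrier_G)
next
  fix w assume w: "w \<in> fibre (total z)"
  then have "w - z \<in> N"
    unfolding N_eq fibre_def using z G_closed(3)[of w z] by (simp del: carrier_G)
  then show "w \<in> tensor_class h A z"
    unfolding tensor_class_def r_coset_def by (auto intro!: bexI[of _ "w - z"])
qed

lemma total_spread:
  "total (spread (keys x) (lookup x)) = x"
  using poly_mapping_eq_sum_single[OF finite_keys order_refl, of x]
  by (simp add: spread_def total_sum total_single map_h_linear)

lemma spread_closed:
  assumes "F \<subseteq> oriented_diagrams"
  shows "spread F g \<in> carrier G"
proof -
  have "keys (spread F g) \<subseteq> {p. keys (fst p) \<subseteq> oriented_diagrams}"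
    unfolding spread_def by (rule keys_sum_subset) (use assms in auto)
  then show ?thesis by auto
qed

lemma fibre_mem:
  assumes "keys x \<subseteq> oriented_diagrams"
  shows "spread (keys x) (lookup x) \<in> fibre x"
  unfolding fibre_def using spread_closed[OF assms] total_spread by blast

lemma fibre_eq_class:
  assumes "keys x \<subseteq> oriented_diagrams"
  obtains z where "z \<in> carrier G" "total z = x" "fibre x = tensor_class h A z"
proof -
  define z where "z = spread (keys x) (lookup x)"
  have "z \<in> carrier G \<and> total z = x"
    using fibre_mem[OF assms] unfolding z_def[symmetric] fibre_def by (simp only: mem_Collect_eq)
  then show ?thesis using that[of z] tensor_class_eq[of z] by (simp only:)
qed

lemma normal_N: "N \<lhd> G"
  using comm_group.normal_iff_subgroup[OF comm_group_G] subgroup_N by blast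

lemma carrier_tensor_group:
  "carrier (tensor_group h A) = fibre ` {x. keys x \<subseteq> oriented_diagrams}"
proof -
  have "carrier (tensor_group h A) = tensor_class h A ` carrier G"
    unfolding tensor_group_def carrier_FactGroup tensor_class_def ..
  also have "\<dots> = fibre ` {x. keys x \<subseteq> oriented_diagrams}"
    using tensor_class_eq total_closed by (auto simp del: carrier_G elim!: fibre_eq_class)
  finally show ?thesis .
qed

lemma inj_fibre: "inj_on fibre {x. keys x \<subseteq> oriented_diagrams}"
proof (rule inj_onI)
  fix x y assume xy: "x \<in> {x. keys x \<subseteq> oriented_diagrams}" "fibre x = fibre y"
  then have "spread (keys x) (lookup x) \<in> fibre y" using fibre_mem[of x] by simp
  then show "x = y" unfolding fibre_def using total_spread by simp
qed

lemma fibre_add: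
  assumes "keys x \<subseteq> oriented_diagrams" "keys y \<subseteq> oriented_diagrams"
  shows "monoid.mult (tensor_group h A) (fibre x) (fibre y) = fibre (x + y)"
proof -
  obtain z where z: "z \<in> carrier G" "total z = x" "fibre x = tensor_class h A z"
    using fibre_eq_class[OF assms(1)] .
  obtain w where w: "w \<in> carrier G" "total w = y" "fibre y = tensor_class h A w"
    using fibre_eq_class[OF assms(2)] .
  show ?thesis
    using normal.rcos_sum[OF normal_N z(1) w(1)] tensor_class_eq[OF G_closed(1)[OF z(1) w(1)]] z(2,3) w(2,3)
    by (simp add: tensor_group_def tensor_class_def)
qed

lemma fibre_zero: "fibre 0 = one (tensor_group h A)"
  unfolding tensor_group_def one_FactGroup fibre_def N_eq ..

text \<open>All representatives lead to the class with the same \<open>total\<close>, so the union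
  over them collapses to one class.\<close>

lemma fibre_scale:
  assumes "keys x \<subseteq> oriented_diagrams"
  shows "ascale (scalar_extension h A) c (fibre x) = fibre (scale c x)"
proof -
  have "tensor_class h A (free_scale c z) = fibre (scale c x)" if "z \<in> fibre x" for z
    using that tensor_class_eq[OF free_scale_closed] total_free_scale unfolding fibre_def by auto
  then show ?thesis
    using fibre_mem[OF assms] by (auto simp: scalar_extension_def)
qed

lemma fibre_mult:
  assumes "keys x \<subseteq> oriented_diagrams" "keys y \<subseteq> oriented_diagrams"
  shows "amult (scalar_extension h A) (fibre x) (fibre y) = fibre (bmult x y)"
proof -
  have "tensor_class h A (free_mult A z w) = fibre (bmult x y)" if "z \<in> fibre x" "w \<in> fibre y" for z w
    using that tensor_class_eq[OF free_mult_closed] total_free_mult unfolding fibre_def by auto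
  then show ?thesis
    using fibre_mem[OF assms(1)] fibre_mem[OF assms(2)] by (auto simp: scalar_extension_def)
qed

lemma group_tensor_group: "Group.group (tensor_group h A)"
  unfolding tensor_group_def by (rule normal.factorgroup_is_group[OF normal_N])

lemma inv_fibre:
  assumes "keys x \<subseteq> oriented_diagrams"
  shows "inv\<^bsub>tensor_group h A\<^esub> (fibre x) = fibre (- x)"
proof (rule group.inv_equality[OF group_tensor_group])
  show "fibre x \<in> carrier (tensor_group h A)" "fibre (- x) \<in> carrier (tensor_group h A)"
    using assms by (auto simp: carrier_tensor_group)
  show "fibre (- x) \<otimes>\<^bsub>tensor_group h A\<^esub> fibre x = \<one>\<^bsub>tensor_group h A\<^esub>"
    using assms by (simp add: fibre_add fibre_zero)
qed

lemma fibre_single: "X \<in> oriented_diagrams \<Longrightarrow> fibre (scale c (single X 1)) = pure_tensor h A (single X 1) c"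
  unfolding pure_tensor_def by (simp add: tensor_class_eq[OF pair_closed] total_single map_h_linear)

text \<open>The fibres of homogeneous elements form a subgroup containing the generators; conversely
  such an element is the sum of its terms, each of which gives a generator.\<close>

lemma fibre_arc_grade:
  fixes gr :: "nat \<Rightarrow> 'k set"
  assumes gr: "\<And>e. 0 \<in> gr e" "\<And>e a b. a \<in> gr e \<Longrightarrow> b \<in> gr e \<Longrightarrow> a + b \<in> gr e"
    "\<And>e a. a \<in> gr e \<Longrightarrow> - a \<in> gr e"
  shows "extension_grade h A gr d = fibre ` arc_grade gr d"
proof
  let ?P = "{pure_tensor h A (single X 1) c | X c e.
    X \<in> oriented_diagrams \<and> c \<in> gr e \<and> diagram_degree X + e = d}"
  have od: "keys x \<subseteq> oriented_diagrams" if "x \<in> arc_grade gr d" for x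
    using that by (simp add: arc_grade_def)
  have grade: "\<exists>e. lookup x X \<in> gr e \<and> diagram_degree X + e = d"
    if "x \<in> arc_grade gr d" "X \<in> keys x" for x X
  proof -
    have "\<forall>X\<in>keys x. \<exists>e. lookup x X \<in> gr e \<and> diagram_degree X + e = d"
      using that(1) unfolding arc_grade_def mem_Collect_eq by (rule conjunct2)
    then show ?thesis using that(2) by (rule bspec)
  qed
  have zero: "0 \<in> arc_grade gr d" by (simp add: arc_grade_def)
  have add: "x + y \<in> arc_grade gr d" if x: "x \<in> arc_grade gr d" and y: "y \<in> arc_grade gr d" for x y
  proof -
    have *: "\<exists>e. lookup (x + y) X \<in> gr e \<and> diagram_degree X + e = d"
      if X: "X \<in> keys (x + y)" for X
    proof -
      \<comment> \<open>The degree of a coefficient is known only on the support. Elsewhere the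
        coefficient is 0 and lies in every component, so \<open>d - diagram_degree X\<close> serves
        uniformly; the second claim makes the truncated subtraction exact on the support.\<close>
      have "lookup w X \<in> gr (d - diagram_degree X)" "X \<in> keys w \<Longrightarrow> diagram_degree X \<le> d"
        if w: "w \<in> arc_grade gr d" for w
      proof -
        have "lookup w X \<in> gr (d - diagram_degree X) \<and> diagram_degree X \<le> d"
          if X: "X \<in> keys w"
        proof -
          obtain e where "lookup w X \<in> gr e" "diagram_degree X + e = d"
            using grade[OF w X] by blast
          then show ?thesis by auto
        qed
        then show "lookup w X \<in> gr (d - diagram_degree X)"
          "X \<in> keys w \<Longrightarrow> diagram_degree X \<le> d"
          using gr(1) by (cases "X \<in> keys w"; simp add: in_keys_iff)+
      qed
      note this[OF x] this[OF y]
      moreover have "X \<in> keys x \<or> X \<in> keys y"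
        using X keys_add[of x y] by blast
      ultimately show ?thesis
        by (intro exI[of _ "d - diagram_degree X"]) (auto simp: lookup_add gr(2))
    qed
    moreover have "keys (x + y) \<subseteq> oriented_diagrams"
      using keys_add[of x y] od[OF x] od[OF y] by blast
    ultimately show ?thesis by (simp add: arc_grade_def)
  qed
  have minus: "- x \<in> arc_grade gr d" if "x \<in> arc_grade gr d" for x
    using that gr(3) by (fastforce simp: arc_grade_def)
  have gen: "P \<in> fibre ` arc_grade gr d" if mem: "P \<in> ?P" for P
  proof -
    obtain X c e where P: "P = pure_tensor h A (single X 1) c" "X \<in> oriented_diagrams"
      "c \<in> gr e" "diagram_degree X + e = d" using mem by blast
    have "scale c (single X 1) \<in> arc_grade gr d"
      using P(2-4) by (auto simp: arc_grade_def in_keys_iff lookup_single when_def split: if_splits)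
    then show ?thesis using P(1) fibre_single[OF P(2)] by auto
  qed
  show "extension_grade h A gr d \<subseteq> fibre ` arc_grade gr d"
  proof
    fix P assume "P \<in> extension_grade h A gr d"
    then show "P \<in> fibre ` arc_grade gr d"
      unfolding extension_grade_def
    proof (induction rule: generate.induct)
      case one
      then show ?case using zero fibre_zero by force
    next
      case (incl P)
      then show ?case by (rule gen)
    next
      case (inv P)
      then obtain x where "x \<in> arc_grade gr d" "P = fibre x" using gen by blast
      then show ?case using inv_fibre[OF od] minus by auto
    next
      case (eng P R)
      then obtain x y where "x \<in> arc_grade gr d" "P = fibre x" "y \<in> arc_grade gr d" "R = fibre y" by auto
      then show ?case using fibre_add[OF od od] add by auto
    qed
  qed
  show "fibre ` arc_grade gr d \<subseteq> extension_grade h A gr d"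
  proof
    fix P assume "P \<in> fibre ` arc_grade gr d"
    then obtain x where x: "x \<in> arc_grade gr d" "P = fibre x" by auto
    have "fibre (\<Sum>X\<in>F. scale (lookup x X) (single X 1)) \<in> extension_grade h A gr d"
      if "finite F" "F \<subseteq> keys x" for F
      using that
    proof (induction F rule: finite_induct)
      case empty
      then show ?case unfolding extension_grade_def using generate.one fibre_zero by fastforce
    next
      case (insert X F)
      then have X: "X \<in> keys x" "X \<in> oriented_diagrams" using od[OF x(1)] by auto
      let ?t = "scale (lookup x X) (single X 1)"
        and ?r = "\<Sum>X\<in>F. scale (lookup x X) (single X (1::'k))"
      obtain e where "lookup x X \<in> gr e" "diagram_degree X + e = d"
        using grade[OF x(1) X(1)] by blast
      then have "pure_tensor h A (single X 1) (lookup x X) \<in> extension_grade h A gr d"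
        unfolding extension_grade_def using X(2) by (intro generate.incl) blast
      then have "fibre ?t \<in> extension_grade h A gr d"
        using fibre_single[OF X(2)] by simp
      moreover have "fibre ?r \<in> extension_grade h A gr d" using insert by simp
      ultimately have "fibre ?t \<otimes>\<^bsub>tensor_group h A\<^esub> fibre ?r \<in> extension_grade h A gr d"
        unfolding extension_grade_def by (rule generate.eng)
      moreover have "keys ?t \<subseteq> oriented_diagrams"
        using X(2) by (auto simp: in_keys_iff lookup_single when_def split: if_splits)
      moreover have "keys ?r \<subseteq> oriented_diagrams"
        using insert.prems od[OF x(1)]
        by (intro keys_sum_subset) (auto simp: in_keys_iff lookup_single when_def split: if_splits)
      ultimately show ?case using insert.hyps fibre_add by simp
    qed
    from this[OF finite_keys order_refl] show "P \<in> extension_grade h A gr d"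
      using x(2) poly_mapping_eq_sum_single[OF finite_keys order_refl, of x] by simp
  qed
qed

end

section \<open>Units of the ground ring\<close>

definition eps_sign :: "int \<Rightarrow> bit \<Rightarrow> int" where
  "eps_sign s e = (if e = 0 then 1 else s)"

lemma eps_sign_add: "s * s = 1 \<Longrightarrow> eps_sign s (e + e') = eps_sign s e * eps_sign s e'"
  by (cases e; cases e') (simp_all add: eps_sign_def)

text \<open>\<open>Q\<close> has zero divisors; after \<open>\<epsilon>\<close> is sent to a sign, units are constant polynomials in \<open>\<alpha>\<close>.\<close>

definition Q_specialize :: "int \<Rightarrow> Q \<Rightarrow> (int \<Rightarrow>\<^sub>0 int) poly" where
  "Q_specialize s x = (\<Sum>k\<in>keys x. case k of (a, e, w) \<Rightarrow>
     monom (single w (eps_sign s e * lookup x k)) a)"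

lemma Q_specialize_single:
  "Q_specialize s (single (a, e, w) c) = monom (single w (eps_sign s e * c)) a"
  by (cases "c = 0") (simp_all add: Q_specialize_def)

lemma Q_specialize_add: "Q_specialize s (x + y) = Q_specialize s x + Q_specialize s y"
  unfolding Q_specialize_def
  by (rule setsum_keys_plus_distrib[where f = "\<lambda>k n. case k of (a, e, w) \<Rightarrow> monom (single w (eps_sign s e * n)) a"])
    (auto simp: distrib_left single_add add_monom)

lemma Q_specialize_sum: "Q_specialize s (sum f I) = (\<Sum>i\<in>I. Q_specialize s (f i))"
proof -
  have "Q_specialize s 0 = 0" by (simp add: Q_specialize_def)
  then show ?thesis
    by (induction I rule: infinite_finite_induct) (simp_all add: Q_specialize_add)
qed

lemma Q_expansion: "x = (\<Sum>k\<in>keys x. single k (lookup x k))" for x :: Q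
proof (rule poly_mapping_eqI)
  fix l
  have "(\<Sum>k\<in>keys x. lookup x k when k = l) =
      (\<Sum>k\<in>keys x. if k = l then lookup x l else 0)"
    by (rule sum.cong) (auto simp: when_def)
  then show "lookup x l =
      lookup (\<Sum>k\<in>keys x. single k (lookup x k)) l"
    by (simp add: lookup_sum lookup_single in_keys_iff)
qed

lemma Q_specialize_mult:
  assumes "s * s = 1"
  shows "Q_specialize s (x * y) = Q_specialize s x * Q_specialize s y"
proof -
  have single: "Q_specialize s (single k c * single l d) =
      Q_specialize s (single k c) * Q_specialize s (single l d)" for k l c d
    by (cases k; cases l)
      (simp only: add_Pair mult_single Q_specialize_single mult_monom eps_sign_add[OF assms] ac_simps)
  show ?thesis
    by (subst (1 2) Q_expansion[of x], subst (1 2) Q_expansion[of y])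
      (simp only: sum_product Q_specialize_sum single)
qed

lemma coeff_Q_specialize:
  "lookup (coeff (Q_specialize s x) a) w =
    lookup x (a, 0, w) + s * lookup x (a, 1, w)"
proof -
  let ?g = "\<lambda>k. eps_sign s (fst (snd k)) * lookup x k"
  have "lookup (coeff (Q_specialize s x) a) w =
      (\<Sum>k\<in>keys x. if k \<in> {(a, 0, w), (a, 1, w)} then ?g k else 0)"
    unfolding Q_specialize_def coeff_sum lookup_sum
  proof (rule sum.cong)
    fix k :: "nat \<times> bit \<times> int"
    obtain a' e' w' where k: "k = (a', e', w')" by (metis surj_pair)
    show "lookup (coeff (case k of (a, e, w) \<Rightarrow>
        monom (single w (eps_sign s e * lookup x k)) a) a) w =
      (if k \<in> {(a, 0, w), (a, 1, w)} then ?g k else 0)"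
      unfolding k by (cases e') (auto simp: lookup_single when_def)
  qed simp
  also have "\<dots> = (\<Sum>k\<in>keys x \<union> {(a, 0, w), (a, 1, w)}. if k \<in> {(a, 0, w), (a, 1, w)} then ?g k else 0)"
    by (rule sum.mono_neutral_left) (auto simp: in_keys_iff)
  also have "\<dots> = (\<Sum>k\<in>{(a, 0, w), (a, 1, w)}. ?g k)"
    by (rule sum.mono_neutral_cong_right) auto
  also have "\<dots> = lookup x (a, 0, w) + s * lookup x (a, 1, w)"
    by (simp add: eps_sign_def)
  finally show ?thesis .
qed

text \<open>For both signs a unit is mapped to a unit of a polynomial ring in
  \<open>\<alpha>\<close> over Laurent polynomials in \<open>\<omega>\<close>, a domain, hence to a
  constant. So in positive \<open>\<alpha>\<close>-degree the sum and the difference of the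
  coefficients without and with \<open>\<epsilon>\<close> vanish, which over the integers makes both
  0.\<close>

lemma Q_unit_grade:
  fixes u v :: Q
  assumes "u * v = 1"
  shows "u \<in> Q_grade 0"
proof -
  have *: "lookup u (a, 0, w) + s * lookup u (a, 1, w) = 0"
    if s: "s * s = 1" and a: "a \<noteq> 0" for s a w
  proof -
    have "(1 :: Q) = single (0, 0, 0) 1"
      by (simp add: zero_prod_def flip: single_one)
    moreover have "Q_specialize s (single (0, 0, 0) 1) = 1"
      unfolding Q_specialize_single by (simp add: eps_sign_def monom_0)
    ultimately have "Q_specialize s 1 = 1" by (simp only:)
    then have "Q_specialize s u * Q_specialize s v = 1"
      using assms Q_specialize_mult[OF s, of u v] by simp
    then have "Q_specialize s u dvd 1" by (metis dvd_triv_left)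
    then obtain c where "Q_specialize s u = [:c:]"
      using is_unit_poly_iff by blast
    then have "coeff (Q_specialize s u) a = 0"
      using a by (cases a) simp_all
    then show ?thesis
      using coeff_Q_specialize[of s u a w] by simp
  qed
  have "lookup u (a, e, w) = 0" if "a \<noteq> 0" for a e w
    using *[of 1 a w] *[of "-1" a w] that by (cases e) simp_all
  then show ?thesis
    unfolding Q_grade_def by (auto simp: in_keys_iff) (metis neq0_conv)
qed

lemma Q_grade_mult:
  assumes "x \<in> Q_grade 0" "y \<in> Q_grade e"
  shows "x * y \<in> Q_grade e"
proof -
  have "4 * fst k = e" if k: "k \<in> keys (x * y)" for k
  proof -
    obtain l m where "k = l + m" "l \<in> keys x" "m \<in> keys y"
      using keys_mult[of x y] k by blast
    moreover have "fst l = 0" "4 * fst m = e"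
      using assms \<open>l \<in> _\<close> \<open>m \<in> _\<close> unfolding Q_grade_def by (cases l; cases m; fastforce)+
    ultimately show ?thesis by simp
  qed
  then show ?thesis by (auto simp: Q_grade_def)
qed

lemma Q_grade_add:
  "0 \<in> Q_grade e" "x \<in> Q_grade e \<Longrightarrow> y \<in> Q_grade e \<Longrightarrow> x + y \<in> Q_grade e" "x \<in> Q_grade e \<Longrightarrow> - x \<in> Q_grade e"
  using keys_add[of x y] by (auto simp: Q_grade_def)

section \<open>The isomorphism\<close>

lemma rescale_arc_grade:
  assumes "\<And>X. v X \<in> Q_grade 0" "\<And>X. v' X \<in> Q_grade 0" "\<And>X. v X * v' X = 1"
  shows "rescale v ` arc_grade Q_grade d = arc_grade Q_grade d"
proof -
  have sub: "rescale v x \<in> arc_grade Q_grade d" if x: "x \<in> arc_grade Q_grade d" and v: "\<And>X. v X \<in> Q_grade 0" for x v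
  proof -
    have "\<exists>e. lookup (rescale v x) X \<in> Q_grade e \<and> diagram_degree X + e = d"
      if X: "X \<in> keys (rescale v x)" for X
    proof -
      have "X \<in> keys x" using X keys_rescale by blast
      then obtain e where "lookup x X \<in> Q_grade e" "diagram_degree X + e = d"
        using x by (fastforce simp: arc_grade_def)
      then show ?thesis using Q_grade_mult[OF v] by (intro exI[of _ e]) simp
    qed
    moreover have "keys (rescale v x) \<subseteq> oriented_diagrams"
      using x keys_rescale[of v x] by (auto simp: arc_grade_def)
    ultimately show ?thesis by (simp add: arc_grade_def)
  qed
  have inv: "rescale v (rescale v' x) = x" for x
    by (rule poly_mapping_eqI) (simp add: assms(3) flip: mult.assoc)
  show ?thesis
    using sub assms inv by (metis (no_types, lifting) image_subset_iff imageI subsetI subset_antisym)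
qed

text \<open>The isomorphism is a diagonal rescaling over \<open>Q\<close>, whose entries are units
  of degree 0, followed by the identification \<open>fibre\<close> with the tensor product.\<close>

lemma graded_alg_iso_twist:
  fixes \<iota> :: "'r::comm_ring_1 \<Rightarrow> Q" and v v' :: "diagram \<Rightarrow> Q"
  assumes hom: "is_ring_hom \<iota>"
    and v: "\<And>X. v X \<in> Q_grade 0" "\<And>X. v' X \<in> Q_grade 0" "\<And>X. v X * v' X = 1"
    and twist: "\<And>X Y Z. X \<in> oriented_diagrams \<Longrightarrow> Y \<in> oriented_diagrams \<Longrightarrow>
      lookup (diagram_mult (\<iota> \<alpha>) \<epsilon>' \<omega>' X Y) Z * v Z =
      v X * v Y * lookup (diagram_mult (\<iota> \<alpha>) (\<iota> \<epsilon>) (\<iota> \<omega>) X Y) Z"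
  shows "\<exists>\<Psi>. graded_alg_iso \<Psi> (arc_algebra (\<iota> \<alpha>) \<epsilon>' \<omega>') (arc_grade Q_grade)
    (scalar_extension \<iota> (arc_algebra \<alpha> \<epsilon> \<omega>)) (extension_grade \<iota> (arc_algebra \<alpha> \<epsilon> \<omega>) Q_grade)"
proof -
  interpret scalar_extension_hom \<iota> \<alpha> \<epsilon> \<omega>
    using hom by unfold_locales
  let ?C = "{x :: diagram \<Rightarrow>\<^sub>0 Q. keys x \<subseteq> oriented_diagrams}"
  have C: "rescale u x \<in> ?C" if "x \<in> ?C" for u x
    using that keys_rescale[of u x] by auto
  have sub: "rescale u ` ?C \<subseteq> ?C" for u
    using C by blast
  have inv: "rescale v (rescale v' x) = x" "rescale v' (rescale v x) = x" for x
    by (rule poly_mapping_eqI, simp add: v(3) flip: mult.assoc)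
      (rule poly_mapping_eqI, simp add: v(3) mult.commute[of "v' _" "v _"] flip: mult.assoc)
  have bij: "bij_betw (rescale v) ?C ?C"
    by (rule bij_betw_byWitness[where f' = "rescale v'"])
      (rule sub ballI inv)+
  show ?thesis
    unfolding graded_alg_iso_def
  proof (intro exI[of _ "fibre \<circ> rescale v"] conjI ballI allI)
    show "bij_betw (fibre \<circ> rescale v) (acarrier (arc_algebra (\<iota> \<alpha>) \<epsilon>' \<omega>')) (acarrier (scalar_extension \<iota> A))"
      using bij_betw_trans[OF bij bij_betw_imageI[OF inj_fibre refl]] carrier_tensor_group
      by (simp add: scalar_extension_def)
  next
    fix x y assume "x \<in> acarrier (arc_algebra (\<iota> \<alpha>) \<epsilon>' \<omega>')" "y \<in> acarrier (arc_algebra (\<iota> \<alpha>) \<epsilon>' \<omega>')"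
    then have xy: "keys x \<subseteq> oriented_diagrams" "keys y \<subseteq> oriented_diagrams"
      "keys (rescale v x) \<subseteq> oriented_diagrams" "keys (rescale v y) \<subseteq> oriented_diagrams"
      using C[of x v] C[of y v] by simp_all
    show "(fibre \<circ> rescale v) (aadd (arc_algebra (\<iota> \<alpha>) \<epsilon>' \<omega>') x y) =
        aadd (scalar_extension \<iota> A) ((fibre \<circ> rescale v) x) ((fibre \<circ> rescale v) y)"
      using fibre_add[OF xy(3,4)] by (simp add: rescale_linear scalar_extension_def)
    show "(fibre \<circ> rescale v) (amult (arc_algebra (\<iota> \<alpha>) \<epsilon>' \<omega>') x y) =
        amult (scalar_extension \<iota> A) ((fibre \<circ> rescale v) x) ((fibre \<circ> rescale v) y)"
      using fibre_mult[OF xy(3,4)] rescale_product[OF xy(1,2) twist] by simp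
  next
    fix c x assume "x \<in> acarrier (arc_algebra (\<iota> \<alpha>) \<epsilon>' \<omega>')"
    then have x: "keys (rescale v x) \<subseteq> oriented_diagrams" using C[of x v] by simp
    show "(fibre \<circ> rescale v) (ascale (arc_algebra (\<iota> \<alpha>) \<epsilon>' \<omega>') c x) =
        ascale (scalar_extension \<iota> A) c ((fibre \<circ> rescale v) x)"
      using fibre_scale[OF x] by (simp add: rescale_linear)
  next
    fix d
    show "(fibre \<circ> rescale v) ` arc_grade Q_grade d = extension_grade \<iota> A Q_grade d"
      unfolding image_comp[symmetric] rescale_arc_grade[OF v]
      using fibre_arc_grade[of Q_grade d] Q_grade_add by blast
  qed
qed

lemma Q_relations: "Q_eps * Q_eps = 1" "Q_omega * single (0, 0, - 1) 1 = 1"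
proof -
  have "(1 :: Q) = single (0, 0, 0) 1"
    by (simp add: zero_prod_def flip: single_one)
  then show "Q_eps * Q_eps = 1" "Q_omega * single (0, 0, - 1) 1 = 1"
    by (simp_all add: Q_eps_def Q_omega_def mult_single)
qed

theorem theorem3p2:
  fixes q :: "Q \<Rightarrow> 'r::idom poly" and \<iota> :: "'r poly \<Rightarrow> Q"
  assumes "is_ring_hom q" and "q Q_alpha = poly_alpha"
    and "is_ring_hom \<iota>" and "inj \<iota>" and "\<iota> poly_alpha = Q_alpha"
  shows "\<exists>\<Psi>. graded_alg_iso \<Psi>
           (arc_algebra Q_alpha Q_eps Q_omega)
           (arc_grade Q_grade)
           (scalar_extension \<iota> (arc_algebra poly_alpha (q Q_eps) (q Q_omega)))
           (extension_grade \<iota> (arc_algebra poly_alpha (q Q_eps) (q Q_omega)) Q_grade)"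
proof -
  interpret q: ring_hom_1 q by unfold_locales (rule assms(1))
  interpret i: ring_hom_1 \<iota> by unfold_locales (rule assms(3))
  define \<epsilon> where "\<epsilon> = \<iota> (q Q_eps)"
  define \<omega> where "\<omega> = \<iota> (q Q_omega)"
  \<comment> \<open>Ring homomorphisms preserve units, so the image of \<open>\<omega>\<close> stays
    invertible.\<close>
  define \<omega>_inv where "\<omega>_inv = \<iota> (q (single (0, 0, - 1) 1))"
  define \<omega>Q_inv :: Q where "\<omega>Q_inv = single (0, 0, - 1) 1"
  note Q = Q_relations[folded \<omega>Q_inv_def]
  have e: "\<epsilon> * \<epsilon> = 1"
    unfolding \<epsilon>_def i.hom_simps(3)[symmetric] q.hom_simps(3)[symmetric] Q by simp
  have w: "\<omega> * \<omega>_inv = 1"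
    unfolding \<omega>_def \<omega>_inv_def i.hom_simps(3)[symmetric] q.hom_simps(3)[symmetric] Q_relations by simp
  define u where "u = normalizer Q_eps Q_omega"
  define u' where "u' = normalizer Q_eps \<omega>Q_inv"
  define n where "n = normalizer \<epsilon> \<omega>"
  define n' where "n' = normalizer \<epsilon> \<omega>_inv"
  have u: "u X * u' X = 1" for X
    unfolding u_def u'_def by (rule normalizer_inverse[OF Q])
  have n: "n X * n' X = 1" for X
    unfolding n_def n'_def by (rule normalizer_inverse[OF e w])
  \<comment> \<open>The passage goes through the parameters \<open>\<alpha>, 1, 1\<close>:
    \<open>u\<close> leads there from the original parameters, and \<open>n'\<close>, inverse to
    \<open>n\<close>, leads on to the specialized ones.\<close>
  define v where "v X = u X * n' X" for X
  define v' where "v' X = u' X * n X" for X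
  have vv': "v X * v' X = 1" for X
  proof -
    have "v X * v' X = (u X * u' X) * (n X * n' X)" by (simp add: v_def v'_def ac_simps)
    then show ?thesis by (simp add: u n)
  qed
  have grade: "v X \<in> Q_grade 0" "v' X \<in> Q_grade 0" for X
    using Q_unit_grade[OF vv', of X] Q_unit_grade[of "v' X" "v X"] vv'[of X] by (simp_all add: mult.commute)
  have twist: "lookup (diagram_mult (\<iota> poly_alpha) Q_eps Q_omega X Y) Z * v Z =
      v X * v Y * lookup (diagram_mult (\<iota> poly_alpha) (\<iota> (q Q_eps)) (\<iota> (q Q_omega)) X Y) Z"
    if XY: "X \<in> oriented_diagrams" "Y \<in> oriented_diagrams" for X Y Z
  proof -
    let ?a = "lookup (diagram_mult (\<iota> poly_alpha) Q_eps Q_omega X Y) Z"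
      and ?b = "lookup (diagram_mult (\<iota> poly_alpha) \<epsilon> \<omega> X Y) Z"
      and ?c = "lookup (diagram_mult (\<iota> poly_alpha) 1 1 X Y) Z"
    have a: "?a * u Z = u X * u Y * ?c" and b: "?b * n Z = n X * n Y * ?c"
      unfolding u_def n_def using diagram_mult_twist Q(1) e XY by blast+
    \<comment> \<open>The relation for \<open>n\<close> carries a factor \<open>n Z\<close>, which
      is supplied by inserting \<open>n Z * n' Z = 1\<close>.\<close>
    have "v X * v Y * ?b = v X * v Y * (?b * n Z) * n' Z"
      using n[of Z] by (simp add: mult.assoc)
    also have "\<dots> = u X * u Y * ?c * n' Z * (n X * n' X) * (n Y * n' Y)"
      unfolding b by (simp only: v_def ac_simps)
    also have "\<dots> = ?a * v Z"
      unfolding a[symmetric] n by (simp add: v_def mult.assoc)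
    finally show ?thesis by (simp add: \<epsilon>_def \<omega>_def)
  qed
  show ?thesis
    unfolding assms(5)[symmetric] by (rule graded_alg_iso_twist[OF assms(3) grade vv' twist])
qed

end
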